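(* There exists an absolute constant $c>0$ such that, for every $n\geq 2$ and every convex body $K$ in $\mathbb{R}^n$ which is in the minimal surface area position, $$|K|^{\frac{1}{n}}\,\min_{\xi\in S^{n-1}}S(P_{\xi^{\perp}}(K))\geq \frac{c}{\sqrt{n}}\,S(K).$$
   Context: A convex body in $\mathbb{R}^n$ is a compact convex set with non-empty interior. $|\cdot|$ denotes volume, $S^{n-1}$ is the Euclidean unit sphere, and $P_{\xi^{\perp}}$ is the orthogonal projection onto the hyperplane $\xi^{\perp}$. $S(A)$ is the surface area of a convex body $A$; $P_{\xi^\perp}(K)$ is regarded as a convex body in the $(n-1)$-dimensional Euclidean space $\xi^\perp$, and its surface area is taken there. In dimension $m$ one has $S(A)=mV((A,m-1),(B_2^m,1))$ (a mixed volume, $B_2^m$ the Euclidean unit ball); in particular the surface area of a segment in a one-dimensional space is $2$. $K$ is in the minimal surface area position if $S(K)\leq S(T(K))$ for every $T\in SL(n)$. "Absolute constant" means a constant independent of $n$ and of $K$. *)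

theory Defs
  imports "HOL-Analysis.Analysis" "Jordan_Normal_Form.Determinant"
begin

text \<open>
  Since the dimension \<open>n\<close> is quantified inside the statement, it cannot be a type. We use
  \<^const>\<open>Euclidean_space\<close> from the library, whose points are the functions
  \<open>nat \<Rightarrow> real\<close> vanishing at all indices \<open>\<ge> n\<close>; accordingly, vector operations are written
  pointwise. The sphere \<open>S^(n-1)\<close> in dimension \<open>n\<close> is \<open>nsphere (n - 1)\<close>.
\<close>

definition dotn :: "nat \<Rightarrow> (nat \<Rightarrow> real) \<Rightarrow> (nat \<Rightarrow> real) \<Rightarrow> real" where
  "dotn n x y = (\<Sum>i<n. x i * y i)"

definition unit_balln :: "nat \<Rightarrow> (nat \<Rightarrow> real) set" where
  "unit_balln n = {x \<in> topspace (Euclidean_space n). L2_set x {..<n} \<le> 1}"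

text \<open>
  The product measure lives on functions that are \<^const>\<open>undefined\<close> outside \<open>{..<n}\<close>, hence the
  re-extension by zero before testing membership.
\<close>

definition voln :: "nat \<Rightarrow> (nat \<Rightarrow> real) set \<Rightarrow> real" where
  "voln n A = measure (Pi\<^sub>M {..<n} (\<lambda>_. lborel))
     {x \<in> space (Pi\<^sub>M {..<n} (\<lambda>_. lborel)). (\<lambda>i. if i < n then x i else 0) \<in> A}"

definition convexn :: "(nat \<Rightarrow> real) set \<Rightarrow> bool" where
  "convexn A \<longleftrightarrow>
     (\<forall>x\<in>A. \<forall>y\<in>A. \<forall>t\<in>{0..1}. (\<lambda>i. (1 - t) * x i + t * y i) \<in> A)"

definition convex_body :: "nat \<Rightarrow> (nat \<Rightarrow> real) set \<Rightarrow> bool" where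
  "convex_body n K \<longleftrightarrow>
     compactin (Euclidean_space n) K \<and> convexn K \<and> Euclidean_space n interior_of K \<noteq> {}"

text \<open>
  The Minkowski sum \<open>A + t B\<close>, and the surface area of a convex body \<open>A\<close> in dimension \<open>m\<close> as
  the right derivative at \<open>t = 0\<close> of the volume of \<open>A + t B\<close>, where \<open>B\<close> is the unit ball. Since
  this volume is the polynomial whose \<open>t^j\<close>-coefficient is \<open>m choose j\<close> times the mixed volume
  \<open>V((A,m-j),(B,j))\<close>, the derivative is \<open>m V((A,m-1),(B,1))\<close>.
\<close>

definition mink_sum :: "(nat \<Rightarrow> real) set \<Rightarrow> real \<Rightarrow> (nat \<Rightarrow> real) set \<Rightarrow> (nat \<Rightarrow> real) set" where
  "mink_sum A t B = {(\<lambda>i. a i + t * b i) | a b. a \<in> A \<and> b \<in> B}"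

definition surface_area :: "nat \<Rightarrow> (nat \<Rightarrow> real) set \<Rightarrow> real" where
  "surface_area m A =
     Lim (at_right 0) (\<lambda>t. (voln m (mink_sum A t (unit_balln m)) - voln m A) / t)"

definition mat_map :: "nat \<Rightarrow> real mat \<Rightarrow> (nat \<Rightarrow> real) \<Rightarrow> (nat \<Rightarrow> real)" where
  "mat_map n T x = (\<lambda>i. if i < n then (\<Sum>j<n. T $$ (i, j) * x j) else 0)"

definition SLn :: "nat \<Rightarrow> real mat set" where
  "SLn n = {T \<in> carrier_mat n n. Determinant.det T = 1}"

definition minimal_surface_area_position :: "nat \<Rightarrow> (nat \<Rightarrow> real) set \<Rightarrow> bool" where
  "minimal_surface_area_position n K \<longleftrightarrow>
     (\<forall>T\<in>SLn n. surface_area n K \<le> surface_area n (mat_map n T ` K))"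

definition proj_perp :: "nat \<Rightarrow> (nat \<Rightarrow> real) \<Rightarrow> (nat \<Rightarrow> real) \<Rightarrow> (nat \<Rightarrow> real)" where
  "proj_perp n \<xi> x = (\<lambda>i. x i - dotn n x \<xi> * \<xi> i)"

text \<open>
  An orthonormal basis \<open>u 0, \<dots>, u (n - 2)\<close> of the hyperplane orthogonal to the unit vector \<open>\<xi>\<close>.
\<close>

definition perp_basis :: "nat \<Rightarrow> (nat \<Rightarrow> real) \<Rightarrow> (nat \<Rightarrow> nat \<Rightarrow> real) \<Rightarrow> bool" where
  "perp_basis n \<xi> u \<longleftrightarrow>
     (\<forall>j<n - 1. u j \<in> topspace (Euclidean_space n) \<and> dotn n (u j) \<xi> = 0) \<and>
     (\<forall>j<n - 1. \<forall>k<n - 1. dotn n (u j) (u k) = (if j = k then 1 else 0))"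

definition perp_coords :: "nat \<Rightarrow> (nat \<Rightarrow> nat \<Rightarrow> real) \<Rightarrow> (nat \<Rightarrow> real) set \<Rightarrow> (nat \<Rightarrow> real) set" where
  "perp_coords n u A =
     {y \<in> topspace (Euclidean_space (n - 1)). (\<lambda>i. \<Sum>j<n - 1. y j * u j i) \<in> A}"

text \<open>
  The surface area of a subset \<open>A\<close> of the hyperplane orthogonal to \<open>\<xi>\<close>, taken in that hyperplane:
  the hyperplane is identified isometrically with \<open>(n - 1)\<close>-dimensional Euclidean space by an
  orthonormal basis. The choice of basis is immaterial (volume and ball are invariant under
  orthogonal maps), and a basis exists by lemma \<open>perp_basis_exists\<close> below.
\<close>

definition surface_area_perp :: "nat \<Rightarrow> (nat \<Rightarrow> real) \<Rightarrow> (nat \<Rightarrow> real) set \<Rightarrow> real" where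
  "surface_area_perp n \<xi> A = surface_area (n - 1) (perp_coords n (SOME u. perp_basis n \<xi> u) A)"

lemma dotn_sphere:
  assumes "1 \<le> n" "\<xi> \<in> topspace (nsphere (n - 1))"
  shows "dotn n \<xi> \<xi> = 1"
proof -
  have "{..n - 1} = {..<n}" using assms(1) by auto
  then show ?thesis
    using assms(2) by (simp add: nsphere_def dotn_def power2_eq_square)
qed

text \<open>The basis is the image of the first \<open>n - 1\<close> standard vectors under a Householder reflection.\<close>

lemma perp_basis_exists:
  assumes "1 \<le> n" "\<xi> \<in> topspace (nsphere (n - 1))"
  shows "\<exists>u. perp_basis n \<xi> u"
proof -
  define e :: "nat \<Rightarrow> nat \<Rightarrow> real" where "e j = (\<lambda>i. if i = j then 1 else 0)" for j
  define w where "w = (\<lambda>i. \<xi> i - e (n - 1) i)"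
  define d where "d = dotn n w w"
  define u where "u j = (\<lambda>i. e j i - 2 * w j / d * w i)" for j
  have \<xi>n: "\<xi> i = 0" if "n \<le> i" for i
    using assms that by (auto simp: nsphere_def topspace_Euclidean_space)
  have e_dot: "dotn n (e j) x = x j" if "j < n" for j x
  proof -
    have "dotn n (e j) x = (\<Sum>i<n. if i = j then x i else 0)"
      unfolding dotn_def e_def by (intro sum.cong) auto
    then show ?thesis using that by simp
  qed
  have sym: "dotn n x y = dotn n y x" for x y
    unfolding dotn_def by (simp add: mult.commute)
  have lin: "dotn n (\<lambda>i. a i - c * b i) y = dotn n a y - c * dotn n b y" for a b c y
    unfolding dotn_def by (simp add: left_diff_distrib sum_subtractf sum_distrib_left mult.assoc)
  have w_dot: "dotn n w y = dotn n \<xi> y - y (n - 1)" for y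
    using lin[of \<xi> 1 "e (n - 1)" y] e_dot[of "n - 1" y] assms(1) by (simp add: w_def)
  have d_eq: "d = 2 - 2 * \<xi> (n - 1)"
  proof -
    have "d = dotn n \<xi> w - w (n - 1)" unfolding d_def by (rule w_dot)
    also have "dotn n \<xi> w = dotn n w \<xi>" by (rule sym)
    also have "\<dots> = 1 - \<xi> (n - 1)" using w_dot[of \<xi>] dotn_sphere[OF assms] by simp
    finally show ?thesis by (simp add: w_def e_def)
  qed
  have d0: "w j = 0" if "d = 0" "j < n" for j
    using that by (auto simp: d_def dotn_def sum_nonneg_eq_0_iff)
  have main: "u j \<in> topspace (Euclidean_space n) \<and> dotn n (u j) \<xi> = 0" if "j < n - 1" for j
  proof
    show "u j \<in> topspace (Euclidean_space n)"
      using that \<xi>n by (auto simp: topspace_Euclidean_space u_def w_def e_def)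
    have "dotn n (u j) \<xi> = dotn n (e j) \<xi> - 2 * w j / d * dotn n w \<xi>"
      unfolding u_def by (rule lin)
    also have "\<dots> = \<xi> j - 2 * w j / d * (1 - \<xi> (n - 1))"
      using e_dot that w_dot[of \<xi>] dotn_sphere[OF assms] by simp
    also have "2 * w j / d * (1 - \<xi> (n - 1)) = w j / d * (2 - 2 * \<xi> (n - 1))"
      by (simp add: algebra_simps diff_divide_distrib)
    also have "\<dots> = w j / d * d" by (simp only: d_eq)
    also have "\<dots> = w j" using d0 that by (cases "d = 0") auto
    also have "\<xi> j - w j = 0" using that by (simp add: w_def e_def)
    finally show "dotn n (u j) \<xi> = 0" .
  qed
  have orth: "dotn n (u j) (u k) = (if j = k then 1 else 0)" if "j < n - 1" "k < n - 1" for j k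
  proof -
    have "dotn n w (u k) = dotn n (u k) w" by (rule sym)
    also have "\<dots> = dotn n (e k) w - 2 * w k / d * dotn n w w"
      unfolding u_def by (rule lin)
    also have "\<dots> = w k - 2 * w k / d * d"
      using e_dot[of k w] that unfolding d_def by simp
    finally have wu: "dotn n w (u k) = w k - 2 * w k / d * d" .
    have "dotn n (u j) (u k) = dotn n (e j) (u k) - 2 * w j / d * dotn n w (u k)"
      unfolding u_def[of j] by (rule lin)
    also have "\<dots> = u k j - 2 * w j / d * (w k - 2 * w k / d * d)"
      using e_dot that wu by simp
    also have "\<dots> = e k j"
      using d0 that by (cases "d = 0") (auto simp: u_def)
    finally show ?thesis by (simp add: e_def)
  qed
  show ?thesis
    unfolding perp_basis_def using main orth by blast
qed

end

theory Submission
  imports Defs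
begin

text \<open>
  Write \<open>n = m + 1\<close>. If \<open>D\<close> halves a body in the direction \<open>\<xi>\<close>, a fibrewise comparison gives
  \<open>S(D K) \<le> S(K) / 2 + |P K|\<close>, where \<open>P\<close> is the projection along \<open>\<xi>\<close>. In minimal surface area
  position \<open>S(K) \<le> S(2 powr (1/n) D K)\<close>, hence \<open>|P K| \<ge> S(K) / (4 n)\<close> for every \<open>\<xi>\<close>. Applied to the direction
  of a long chord this yields the crude bound \<open>S(K) / (4 n) \<le> 2^(m+3) |K| powr (m/n)\<close>, whose exponential
  loss disappears after taking an \<open>m\<close>-th root. The isoperimetric inequality
  \<open>S(P K) \<ge> 2 sqrt m |P K| powr ((m-1)/m)\<close> then gives the theorem. Brunn-Minkowski supplies
  the isoperimetric inequality and the existence of the limit in the definition of surface area.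
\<close>

section \<open>Lebesgue measure on the Euclidean space of functions\<close>

text \<open>Put \<open>s = S(K) / (4 n)\<close> and \<open>w = s powr (1/m)\<close>. The bound
  \<open>|P K| \<ge> s\<close> and the isoperimetric inequality in dimension \<open>m\<close> give
  \<open>S(P K) \<ge> 2 sqrt m * w ^ (m-1)\<close>, and \<open>w ^ (m-1)\<close> is
  \<open>s / w\<close>. So the crude bound enters only through
  \<open>w \<le> 16 |K| powr (1/n)\<close>, where a loss exponential in \<open>m\<close> is a
  constant. The lower bound on \<open>|P K|\<close> is required in every direction, but the crude
  bound concerns \<open>S(K)\<close> alone and may come from one convenient direction. The factor
  \<open>4 n\<close> arises as follows. With \<open>c = 2 powr (1/n)\<close>, minimality and
  homogeneity give \<open>S(K) \<le> c ^ m * (S(K) / 2 + |P K|)\<close>. Multiplication by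
  \<open>c\<close> turns this into \<open>(c - 1) S(K) \<le> 2 |P K|\<close>, and
  \<open>c - 1 \<ge> 1 / (2 n)\<close>. All dimensions share the type
  \<open>nat \<Rightarrow> real\<close>, so slicing, projecting and induction on the dimension never
  change the type. The price is that many set identities hold only on vectors vanishing from index
  \<open>n\<close> on, that is, up to null sets.\<close>

lemma borel_measurable_coordI:
  fixes f :: "'a \<Rightarrow> nat \<Rightarrow> real"
  assumes "\<And>i. (\<lambda>x. f x i) \<in> borel_measurable M"
  shows "f \<in> borel_measurable M"
proof -
  have "f \<in> measurable M (Pi\<^sub>M UNIV (\<lambda>_::nat. borel :: real measure))"
    using assms by (intro measurable_PiM_single') auto
  then show ?thesis
    by (simp add: sets_PiM_equal_borel cong: measurable_cong_sets)
qed

lemma borel_measurable_coord [measurable]: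
  "(\<lambda>x. (x :: nat \<Rightarrow> real) i) \<in> borel_measurable borel"
  by (rule borel_measurable_continuous_onI) (rule continuous_on_product_coordinates)

lemma borel_measurable_coord_comp:
  fixes f :: "'a \<Rightarrow> nat \<Rightarrow> real"
  assumes "f \<in> borel_measurable M"
  shows "(\<lambda>x. f x i) \<in> borel_measurable M"
  by (rule measurable_compose[OF assms borel_measurable_coord])

text \<open>Lebesgue measure of \<open>R^n\<close>, pushed forward to the type shared by all
  dimensions. Its space is \<open>UNIV\<close>, so Borel measurability does not mention
  \<open>n\<close>, while the mass sits on the vectors that vanish from index \<open>n\<close>
  on.\<close>

definition emeas :: "nat \<Rightarrow> (nat \<Rightarrow> real) measure" where
  "emeas n = distr (Pi\<^sub>M {..<n} (\<lambda>_. lborel)) borel (\<lambda>x i. if i < n then x i else 0)"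

lemma ext_zero_measurable [measurable]:
  "(\<lambda>x (i::nat). if i < n then x i else 0)
     \<in> borel_measurable (Pi\<^sub>M {..<n} (\<lambda>_. lborel :: real measure))"
proof (rule borel_measurable_coordI, goal_cases)
  case (1 i)
  show "(\<lambda>x. if i < n then x i else 0) \<in> borel_measurable (Pi\<^sub>M {..<n} (\<lambda>_. lborel :: real measure))"
    using measurable_component_singleton[of i "{..<n}" "\<lambda>_. lborel :: real measure"]
    by (cases "i < n") auto
qed

lemma sets_emeas [simp, measurable_cong]: "sets (emeas n) = sets borel"
  and space_emeas [simp]: "space (emeas n) = UNIV"
  by (auto simp: emeas_def)

lemma voln_eq_measure:
  assumes "A \<in> sets borel"
  shows "voln n A = measure (emeas n) A"
  unfolding voln_def emeas_def using assms
  by (subst measure_distr) (auto simp: vimage_def Int_def conj_commute)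

text \<open>Fubini with the last coordinate split off, in both orders. Integrating the fibre first
  compares a body with its projection; integrating the slice at height \<open>z\<close> first
  supports induction on the dimension.\<close>

lemma nn_integral_emeas_Suc:
  assumes [measurable]: "f \<in> borel_measurable borel"
  shows "(\<integral>\<^sup>+x. f x \<partial>emeas (Suc n)) = (\<integral>\<^sup>+x. \<integral>\<^sup>+z. f (x(n := z)) \<partial>lborel \<partial>emeas n)" (is ?A)
    and "(\<integral>\<^sup>+x. f x \<partial>emeas (Suc n)) = (\<integral>\<^sup>+z. \<integral>\<^sup>+x. f (x(n := z)) \<partial>emeas n \<partial>lborel)" (is ?B)
proof -
  interpret P: product_sigma_finite "\<lambda>_::nat. lborel :: real measure"
    by (simp add: product_sigma_finite_def lborel.sigma_finite_measure_axioms)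
  let ?e = "\<lambda>n x i. if i < n then x i else (0::real)"
  have [simp]: "?e (Suc n) (x(n := z)) = (?e n x)(n := z)" for x z
    by auto
  have [measurable]: "(\<lambda>(x, z). x(n := z)) \<in> borel_measurable ((borel :: (nat \<Rightarrow> real) measure) \<Otimes>\<^sub>M (borel :: real measure))"
    by (rule borel_measurable_coordI) (auto simp: fun_upd_def split_beta)
  have [measurable]: "(\<lambda>p. f ((fst p)(n := snd p))) \<in> borel_measurable ((borel :: (nat \<Rightarrow> real) measure) \<Otimes>\<^sub>M (borel :: real measure))"
    using measurable_compose[OF \<open>(\<lambda>(x, z). x(n := z)) \<in> _\<close> assms] by (simp add: split_beta)
  have f2: "(\<lambda>x. f (x(n := z))) \<in> borel_measurable borel" for z
    by (rule measurable_compose[OF _ assms]) (rule borel_measurable_coordI, auto simp: fun_upd_def)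
  have f1: "(\<lambda>x. \<integral>\<^sup>+z. f (x(n := z)) \<partial>lborel) \<in> borel_measurable borel"
    using lborel.borel_measurable_nn_integral[of "\<lambda>x z. f (x(n := z))" borel]
    by (simp add: split_beta)
  have *: "(\<integral>\<^sup>+x. f x \<partial>emeas (Suc n)) = (\<integral>\<^sup>+x. f (?e (Suc n) x) \<partial>(Pi\<^sub>M (insert n {..<n}) (\<lambda>_. lborel)))"
    unfolding emeas_def using ext_zero_measurable[of "Suc n"]
    by (subst nn_integral_distr) (auto simp: lessThan_Suc)
  have m: "(\<lambda>x. f (?e (Suc n) x)) \<in> borel_measurable (Pi\<^sub>M (insert n {..<n}) (\<lambda>_. lborel))"
    using measurable_compose[OF ext_zero_measurable[of "Suc n"] assms] by (simp add: lessThan_Suc)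
  show ?A
    unfolding * unfolding emeas_def
    by (subst P.product_nn_integral_insert[OF _ _ m], simp, simp, subst nn_integral_distr)
      (use f1 in \<open>auto intro!: nn_integral_cong\<close>)
  show ?B
    unfolding * unfolding emeas_def
    by (subst P.product_nn_integral_insert_rev[OF _ _ m], simp, simp, subst nn_integral_distr)
      (use f2 in \<open>auto intro!: nn_integral_cong\<close>)
qed

lemma borel_measurable_fun_upd [measurable]:
  "(\<lambda>x. x(n := z)) \<in> borel_measurable (borel :: (nat \<Rightarrow> real) measure)"
  "(\<lambda>z. x(n := z)) \<in> borel_measurable (borel :: real measure)"
  by (rule borel_measurable_coordI, auto simp: fun_upd_def)+

lemma emeasure_emeas_Suc:
  assumes [measurable]: "A \<in> sets borel"
  shows "emeasure (emeas (Suc n)) A = (\<integral>\<^sup>+x. emeasure lborel {z. x(n := z) \<in> A} \<partial>emeas n)"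
    and "emeasure (emeas (Suc n)) A = (\<integral>\<^sup>+z. emeasure (emeas n) {x. x(n := z) \<in> A} \<partial>lborel)"
proof -
  have i1: "indicator A (x(n := z)) = (indicator {z. x(n := z) \<in> A} z :: ennreal)"
    and i2: "indicator A (x(n := z)) = (indicator {x. x(n := z) \<in> A} x :: ennreal)" for x z
    by (auto simp: indicator_def)
  have s: "{z. x(n := z) \<in> A} \<in> sets borel" "{x. x(n := z) \<in> A} \<in> sets borel" for x z
    using measurable_sets[OF borel_measurable_fun_upd(2)[of x n] assms]
      measurable_sets[OF borel_measurable_fun_upd(1)[of n z] assms]
    by (simp_all add: vimage_def)
  show "emeasure (emeas (Suc n)) A = (\<integral>\<^sup>+x. emeasure lborel {z. x(n := z) \<in> A} \<partial>emeas n)"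
    using s nn_integral_emeas_Suc(1)[of "indicator A" n] by (simp add: i1 del: fun_upd_apply)
  show "emeasure (emeas (Suc n)) A = (\<integral>\<^sup>+z. emeasure (emeas n) {x. x(n := z) \<in> A} \<partial>lborel)"
    using s nn_integral_emeas_Suc(2)[of "indicator A" n] by (simp add: i2 del: fun_upd_apply)
qed

lemma emeas_0: "emeasure (emeas 0) A = indicator A (\<lambda>_. 0)" if "A \<in> sets borel"
  using that unfolding emeas_def
  by (subst emeasure_distr) (auto simp: PiM_empty indicator_def split: if_splits)

text \<open>Facts true only for points of \<open>R^n\<close> enter integrals over the whole type
  through this.\<close>

lemma AE_emeas: "AE x in emeas n. \<forall>i\<ge>n. x i = 0"
  unfolding emeas_def by (subst AE_distr_iff) auto

section \<open>Boxes, sigma-finiteness and affine substitutions\<close>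

lemma emeasure_emeas_box:
  "emeasure (emeas n) {x. \<forall>i<n. \<bar>x i\<bar> \<le> r} = ennreal ((2 * r) ^ n)" if "r \<ge> 0"
proof (induction n)
  case 0
  then show ?case by (simp add: emeas_0)
next
  case (Suc n)
  have [measurable]: "{x :: nat \<Rightarrow> real. \<forall>i<n. \<bar>x i\<bar> \<le> r} \<in> sets borel" for n
    by measurable
  have "{x. x(n := z) \<in> {x. \<forall>i<Suc n. \<bar>x i\<bar> \<le> r}} = (if z \<in> {-r..r} then {x. \<forall>i<n. \<bar>x i\<bar> \<le> r} else {})" for z
    by (auto simp: less_Suc_eq)
  then have "emeasure (emeas n) {x. x(n := z) \<in> {x. \<forall>i<Suc n. \<bar>x i\<bar> \<le> r}}
      = ennreal ((2 * r) ^ n) * indicator {-r..r} z" for z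
    using Suc by (auto split: split_indicator)
  then have "emeasure (emeas (Suc n)) {x. \<forall>i<Suc n. \<bar>x i\<bar> \<le> r}
      = (\<integral>\<^sup>+z. ennreal ((2 * r) ^ n) * indicator {-r..r} z \<partial>lborel)"
    by (subst emeasure_emeas_Suc(2)) simp_all
  also have "\<dots> = ennreal ((2 * r) ^ Suc n)"
    using that by (subst nn_integral_cmult_indicator) (auto simp flip: ennreal_mult simp: mult.commute)
  finally show ?case .
qed

text \<open>The exhausting sets are cylinders: they restrict only the first \<open>n\<close>
  coordinates, so they cover the whole type and still have finite mass.\<close>

lemma sigma_finite_emeas: "sigma_finite_measure (emeas n)"
proof
  let ?A = "range (\<lambda>k::nat. {x :: nat \<Rightarrow> real. \<forall>i<n. \<bar>x i\<bar> \<le> real k})"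
  have "\<exists>k::nat. \<forall>i<n. \<bar>x i\<bar> \<le> real k" for x :: "nat \<Rightarrow> real"
  proof -
    obtain k :: nat where "(\<Sum>i<n. \<bar>x i\<bar>) \<le> real k" using real_arch_simple by blast
    moreover have "\<bar>x i\<bar> \<le> (\<Sum>i<n. \<bar>x i\<bar>)" if "i < n" for i
      using that by (intro member_le_sum) auto
    ultimately show ?thesis by (meson order_trans)
  qed
  then have "countable ?A \<and> ?A \<subseteq> sets (emeas n) \<and> \<Union> ?A = space (emeas n) \<and>
    (\<forall>a\<in>?A. emeasure (emeas n) a \<noteq> \<infinity>)"
    by (auto simp: emeasure_emeas_box)
  then show "\<exists>A. countable A \<and> A \<subseteq> sets (emeas n) \<and> \<Union> A = space (emeas n) \<and>
    (\<forall>a\<in>A. emeasure (emeas n) a \<noteq> \<infinity>)" by blast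
qed

lemma nn_integral_emeas_0: "(\<integral>\<^sup>+x. f x \<partial>emeas 0) = f (\<lambda>_. 0)" if "f \<in> borel_measurable borel"
  using that unfolding emeas_def
  by (subst nn_integral_distr) (auto simp: PiM_empty)

text \<open>Dilation and translation act on each coordinate separately, so every induction step is a
  one-dimensional substitution contributing one factor \<open>s\<close>.\<close>

lemma nn_integral_emeas_affine:
  assumes "f \<in> borel_measurable borel" "s > 0" "\<And>i. n \<le> i \<Longrightarrow> v i = 0"
  shows "(\<integral>\<^sup>+x. f x \<partial>emeas n) = ennreal (s ^ n) * (\<integral>\<^sup>+x. f (\<lambda>i. s * x i + v i) \<partial>emeas n)"
  using assms
proof (induction n arbitrary: f v)
  case 0
  have "(\<lambda>x. f (\<lambda>i. s * x i + v i)) \<in> borel_measurable borel"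
    by (rule measurable_compose[OF _ 0(1)], rule borel_measurable_coordI) simp
  moreover have "v = (\<lambda>_. 0)" using 0 by auto
  ultimately show ?case using 0 by (simp add: nn_integral_emeas_0)
next
  case (Suc n)
  note [measurable] = Suc.prems(1)
  \<comment> \<open>The induction hypothesis in dimension \<open>n\<close> accepts only vectors
    vanishing at index \<open>n\<close>; the entry \<open>v n\<close> is handled by the substitution
    in \<open>z\<close>.\<close>
  let ?w = "v(n := 0)"
  have w: "?w i = 0" if "n \<le> i" for i using that Suc.prems(3)[of i] by auto
  have mf: "(\<lambda>x. f (g x)) \<in> borel_measurable M"
    if "\<And>i. (\<lambda>x. g x i) \<in> borel_measurable M" for g and M :: "'b measure"
    by (rule measurable_compose[OF _ Suc.prems(1)], rule borel_measurable_coordI) (rule that)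
  have eq: "(\<lambda>i. s * x i + ?w i)(n := s * z + v n) = (\<lambda>i. s * (x(n := z)) i + v i)" for x z
    by auto
  interpret sigma_finite_measure "emeas n" by (rule sigma_finite_emeas)
  have m2: "(\<lambda>z. \<integral>\<^sup>+x. f ((\<lambda>i. s * x i + ?w i)(n := z)) \<partial>emeas n) \<in> borel_measurable borel"
    by (rule borel_measurable_nn_integral, unfold split_beta, rule mf) (auto simp: fun_upd_def)
  have m3: "(\<lambda>z. \<integral>\<^sup>+x. f (\<lambda>i. s * (x(n := z)) i + v i) \<partial>emeas n) \<in> borel_measurable borel"
    by (rule borel_measurable_nn_integral, unfold split_beta, rule mf) (auto simp: fun_upd_def)
  have "(\<integral>\<^sup>+x. f x \<partial>emeas (Suc n)) = (\<integral>\<^sup>+z. \<integral>\<^sup>+x. f (x(n := z)) \<partial>emeas n \<partial>lborel)"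
    by (rule nn_integral_emeas_Suc) fact
  also have "\<dots> = (\<integral>\<^sup>+z. ennreal (s ^ n) * \<integral>\<^sup>+x. f ((\<lambda>i. s * x i + ?w i)(n := z)) \<partial>emeas n \<partial>lborel)"
    by (intro nn_integral_cong Suc.IH[OF _ Suc.prems(2) w] mf) (auto simp: fun_upd_def)
  also have "\<dots> = ennreal (s ^ n) * (\<integral>\<^sup>+z. \<integral>\<^sup>+x. f ((\<lambda>i. s * x i + ?w i)(n := z)) \<partial>emeas n \<partial>lborel)"
    using m2 by (intro nn_integral_cmult) simp
  also have "(\<integral>\<^sup>+z. \<integral>\<^sup>+x. f ((\<lambda>i. s * x i + ?w i)(n := z)) \<partial>emeas n \<partial>lborel)
      = ennreal s * (\<integral>\<^sup>+z. \<integral>\<^sup>+x. f ((\<lambda>i. s * x i + ?w i)(n := s * z + v n)) \<partial>emeas n \<partial>lborel)"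
    using nn_integral_real_affine[OF m2, of s "v n"] Suc.prems(2) by (simp add: add.commute)
  also have "(\<integral>\<^sup>+z. \<integral>\<^sup>+x. f ((\<lambda>i. s * x i + ?w i)(n := s * z + v n)) \<partial>emeas n \<partial>lborel)
      = (\<integral>\<^sup>+x. f (\<lambda>i. s * x i + v i) \<partial>emeas (Suc n))"
    unfolding eq by (rule nn_integral_emeas_Suc(2)[symmetric]) (auto intro!: mf)
  finally show ?case
    using Suc.prems(2) by (simp add: mult.assoc[symmetric] ennreal_mult[symmetric] mult.commute)
qed

lemma emeasure_emeas_affine:
  assumes "A \<in> sets borel" "s > 0" "\<And>i. n \<le> i \<Longrightarrow> v i = 0"
  shows "emeasure (emeas n) A = ennreal (s ^ n) * emeasure (emeas n) {x. (\<lambda>i. s * x i + v i) \<in> A}"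
proof -
  have "(\<lambda>x i. s * x i + v i) \<in> borel_measurable (borel :: (nat \<Rightarrow> real) measure)"
    by (rule borel_measurable_coordI) simp
  from measurable_sets[OF this assms(1)] have "{x. (\<lambda>i. s * x i + v i) \<in> A} \<in> sets borel"
    by (simp add: vimage_def)
  moreover have "indicator A (\<lambda>i. s * x i + v i) = (indicator {x. (\<lambda>i. s * x i + v i) \<in> A} x :: ennreal)" for x
    by (auto simp: indicator_def)
  ultimately show ?thesis
    using nn_integral_emeas_affine[OF borel_measurable_indicator[OF assms(1)] assms(2,3)] assms(1)
    by simp
qed

lemma emeasure_emeas_translate:
  assumes "A \<in> sets borel" "\<And>i. n \<le> i \<Longrightarrow> v i = 0"
  shows "emeasure (emeas n) {x. (\<lambda>i. x i + v i) \<in> A} = emeasure (emeas n) A"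
  using emeasure_emeas_affine[of A 1 n v] assms by simp

lemma sets_borel_vimageI:
  fixes h :: "(nat \<Rightarrow> real) \<Rightarrow> nat \<Rightarrow> real"
  assumes "h \<in> borel_measurable borel" "A \<in> sets borel"
  shows "{x. h x \<in> A} \<in> sets borel"
  using measurable_sets[OF assms] by (simp add: vimage_def)

text \<open>
  Uniqueness of Haar measure: Fubini gives \<open>\<mu>(A) \<nu>(B) = \<nu>(A) \<mu>(B)\<close> for the translation
  invariant measures \<open>\<mu>\<close> and \<open>\<nu> = \<mu> \<circ> h\<inverse>\<close> and a symmetric set \<open>B\<close>.
\<close>

lemma emeas_additive_invariant:
  fixes h :: "(nat \<Rightarrow> real) \<Rightarrow> nat \<Rightarrow> real"
  assumes hm [measurable]: "h \<in> borel_measurable borel"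
    and add: "\<And>x y. h (\<lambda>i. x i + y i) = (\<lambda>i. h x i + h y i)"
    and maps: "\<And>x i. n \<le> i \<Longrightarrow> h x i = 0"
    and onto: "\<And>v. (\<And>i. n \<le> i \<Longrightarrow> v i = 0) \<Longrightarrow> \<exists>w. (\<forall>i\<ge>n. w i = 0) \<and> h w = v"
    and B: "B \<in> sets borel" "\<And>x. (\<lambda>i. - x i) \<in> B \<longleftrightarrow> x \<in> B"
      "\<And>x. (\<forall>i\<ge>n. x i = 0) \<Longrightarrow> h x \<in> B \<longleftrightarrow> x \<in> B"
      "emeasure (emeas n) B \<noteq> 0" "emeasure (emeas n) B \<noteq> \<infinity>"
    and A: "A \<in> sets borel"
  shows "emeasure (emeas n) {x. h x \<in> A} = emeasure (emeas n) A"
proof -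
  let ?M = "emeas n" and ?V = "borel :: (nat \<Rightarrow> real) measure"
  define \<nu> where "\<nu> X = emeasure ?M {x. h x \<in> X}" for X
  interpret P: pair_sigma_finite ?M ?M
    by (simp add: pair_sigma_finite_def sigma_finite_emeas)
  have sets: "{x. h x \<in> X} \<in> sets borel" if "X \<in> sets borel" for X
    by (rule sets_borel_vimageI[OF hm that])
  have fadd: "f \<in> borel_measurable M \<Longrightarrow> g \<in> borel_measurable M \<Longrightarrow>
      (\<lambda>p i. f p i + g p i) \<in> borel_measurable M" for f g :: "'a \<Rightarrow> nat \<Rightarrow> real" and M
    by (rule borel_measurable_coordI)
      (auto dest: borel_measurable_coord_comp)
  have fdiff: "f \<in> borel_measurable M \<Longrightarrow> g \<in> borel_measurable M \<Longrightarrow>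
      (\<lambda>p i. f p i - g p i) \<in> borel_measurable M" for f g :: "'a \<Rightarrow> nat \<Rightarrow> real" and M
    by (rule borel_measurable_coordI)
      (auto dest: borel_measurable_coord_comp)
  have ind: "f \<in> borel_measurable M \<Longrightarrow> X \<in> sets borel \<Longrightarrow>
      (\<lambda>p. indicator X (f p) :: ennreal) \<in> borel_measurable M" for f :: "'a \<Rightarrow> nat \<Rightarrow> real" and M X
    by (rule measurable_compose[where N = borel]) auto
  have h1: "(\<lambda>p. h (fst p)) \<in> borel_measurable (?V \<Otimes>\<^sub>M ?V)"
    by (rule measurable_compose[OF measurable_fst]) fact
  have m1: "(\<lambda>p. indicator B (h (fst p)) * indicator A (\<lambda>i. snd p i + h (fst p) i) :: ennreal)
      \<in> borel_measurable (?V \<Otimes>\<^sub>M ?V)"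
    by (intro borel_measurable_times_ennreal ind fadd h1 measurable_snd A B)
  have m2: "(\<lambda>p. indicator B (\<lambda>i. h (fst p) i - snd p i) * indicator A (h (fst p)) :: ennreal)
      \<in> borel_measurable (?V \<Otimes>\<^sub>M ?V)"
    by (intro borel_measurable_times_ennreal ind fdiff h1 measurable_snd A B)
  have nuI: "(\<integral>\<^sup>+x. indicator X (h x) \<partial>?M) = \<nu> X" if "X \<in> sets borel" for X
  proof -
    have "(\<integral>\<^sup>+x. indicator X (h x) \<partial>?M) = (\<integral>\<^sup>+x. indicator {x. h x \<in> X} x \<partial>?M)"
      by (intro nn_integral_cong) (auto simp: indicator_def)
    then show ?thesis using sets[OF that] by (simp add: \<nu>_def)
  qed
  \<comment> \<open>The double integral of \<open>indicator B (h x) * indicator A (y + h x)\<close>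
    is evaluated in both orders. With \<open>y\<close> innermost, translation invariance yields this
    product.\<close>
  have "emeasure ?M A * \<nu> B = (\<integral>\<^sup>+x. indicator B (h x) * emeasure ?M A \<partial>?M)"
    using nuI[OF B(1)] ind[OF hm B(1)] by (subst nn_integral_multc) (auto simp: mult.commute)
  also have "\<dots> = (\<integral>\<^sup>+x. \<integral>\<^sup>+y. indicator B (h x) * indicator A (\<lambda>i. y i + h x i) \<partial>?M \<partial>?M)"
  proof (rule nn_integral_cong)
    fix x
    have mm: "(\<lambda>y i. y i + h x i) \<in> borel_measurable borel"
      by (rule borel_measurable_coordI) simp
    have "(\<integral>\<^sup>+y. indicator A (\<lambda>i. y i + h x i) \<partial>?M) = (\<integral>\<^sup>+y. indicator {y. (\<lambda>i. y i + h x i) \<in> A} y \<partial>?M)"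
      by (intro nn_integral_cong) (auto simp: indicator_def)
    also have "\<dots> = emeasure ?M A"
      using emeasure_emeas_translate[OF A, of n "h x"] sets_borel_vimageI[OF mm A] maps by simp
    finally show "indicator B (h x) * emeasure ?M A
        = (\<integral>\<^sup>+y. indicator B (h x) * indicator A (\<lambda>i. y i + h x i) \<partial>?M)"
      using ind[OF mm A] by (subst nn_integral_cmult) auto
  qed
  also have "\<dots> = (\<integral>\<^sup>+y. \<integral>\<^sup>+x. indicator B (h x) * indicator A (\<lambda>i. y i + h x i) \<partial>?M \<partial>?M)"
    using m1 by (intro P.Fubini'[symmetric]) (simp add: split_beta cong: measurable_cong_sets)
  \<comment> \<open>For almost every \<open>y\<close>, surjectivity provides \<open>w\<close> with
    \<open>h w = y\<close>; translating \<open>x\<close> by \<open>w\<close> moves \<open>y\<close>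
    from the argument of \<open>A\<close> to that of \<open>B\<close>.\<close>
  also have "\<dots> = (\<integral>\<^sup>+y. \<integral>\<^sup>+x. indicator B (\<lambda>i. h x i - y i) * indicator A (h x) \<partial>?M \<partial>?M)"
  proof (rule nn_integral_cong_AE, use AE_emeas[of n] in eventually_elim)
    fix y :: "nat \<Rightarrow> real" assume "\<forall>i\<ge>n. y i = 0"
    then obtain w where w: "\<forall>i\<ge>n. w i = 0" "h w = y" using onto[of y] by auto
    have [simp]: "h (\<lambda>i. x i + w i) = (\<lambda>i. h x i + y i)" for x
      using add[of x w] w by simp
    have "(\<lambda>x. indicator B (\<lambda>i. h x i - y i) * indicator A (h x) :: ennreal) \<in> borel_measurable borel"
      by (intro borel_measurable_times_ennreal ind fdiff A B hm) auto
    from nn_integral_emeas_affine[OF this, of 1 n w] w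
    show "(\<integral>\<^sup>+x. indicator B (h x) * indicator A (\<lambda>i. y i + h x i) \<partial>?M)
       = (\<integral>\<^sup>+x. indicator B (\<lambda>i. h x i - y i) * indicator A (h x) \<partial>?M)"
      by (simp add: add.commute)
  qed
  also have "\<dots> = (\<integral>\<^sup>+x. \<integral>\<^sup>+y. indicator B (\<lambda>i. h x i - y i) * indicator A (h x) \<partial>?M \<partial>?M)"
    using m2 by (intro P.Fubini') (simp add: split_beta cong: measurable_cong_sets)
  also have "\<dots> = (\<integral>\<^sup>+x. indicator A (h x) * emeasure ?M B \<partial>?M)"
  proof (rule nn_integral_cong)
    fix x
    \<comment> \<open>Symmetry of \<open>B\<close> replaces the reflection in \<open>y\<close> by a
      translation, under which the measure is known to be invariant.\<close>
    have "(\<lambda>i. - (h x i - y i)) \<in> B \<longleftrightarrow> (\<lambda>i. h x i - y i) \<in> B" for y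
      by (rule B(2))
    then have eq: "(\<lambda>i. h x i - y i) \<in> B \<longleftrightarrow> (\<lambda>i. y i + - h x i) \<in> B" for y
      by simp
    have mm: "(\<lambda>y i. y i + - h x i) \<in> borel_measurable borel"
      by (rule borel_measurable_coordI) simp
    have "(\<integral>\<^sup>+y. indicator B (\<lambda>i. h x i - y i) \<partial>?M) = (\<integral>\<^sup>+y. indicator {y. (\<lambda>i. y i + - h x i) \<in> B} y \<partial>?M)"
      using eq by (intro nn_integral_cong) (auto simp: indicator_def)
    also have "\<dots> = emeasure ?M B"
      using emeasure_emeas_translate[OF B(1), of n "\<lambda>i. - h x i"] sets_borel_vimageI[OF mm B(1)] maps by simp
    finally show "(\<integral>\<^sup>+y. indicator B (\<lambda>i. h x i - y i) * indicator A (h x) \<partial>?M)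
        = indicator A (h x) * emeasure ?M B"
      by (subst nn_integral_multc) (auto simp: mult.commute intro!: ind fdiff B)
  qed
  also have "\<dots> = \<nu> A * emeasure ?M B"
    using nuI[OF A] ind[OF hm A] by (subst nn_integral_multc) auto
  finally have eq: "emeasure ?M A * \<nu> B = \<nu> A * emeasure ?M B" .
  \<comment> \<open>\<open>h\<close> preserves \<open>B\<close> up to a null set, so both measures
    agree on \<open>B\<close>, and this finite positive number cancels.\<close>
  have "\<nu> B = emeasure ?M B"
    unfolding \<nu>_def using AE_emeas[of n] B(1,3) sets
    by (intro emeasure_eq_AE) (auto elim!: eventually_mono)
  with eq B(4,5) have "emeasure ?M A = \<nu> A"
    by (simp add: ennreal_mult_cancel_left mult.commute[of _ "emeasure (emeas n) B"])
  then show ?thesis by (simp add: \<nu>_def)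
qed

section \<open>The Brunn-Minkowski inequality\<close>

text \<open>The translates \<open>A + min B\<close> and \<open>B + max A\<close> both lie in
  \<open>C\<close> and meet in at most the point \<open>max A + min B\<close>.\<close>

lemma emeasure_lborel_sumset_compact:
  fixes A B C :: "real set"
  assumes "compact A" "compact B" "A \<noteq> {}" "B \<noteq> {}" "C \<in> sets borel"
    and sub: "\<And>x y. x \<in> A \<Longrightarrow> y \<in> B \<Longrightarrow> x + y \<in> C"
  shows "emeasure lborel A + emeasure lborel B \<le> emeasure lborel C"
proof -
  define a b where "a = Sup A" and "b = Inf B"
  have a: "a \<in> A" "\<And>x. x \<in> A \<Longrightarrow> x \<le> a"
    unfolding a_def using assms
    by (auto intro!: closed_contains_Sup cSup_upper bounded_imp_bdd_above compact_imp_bounded compact_imp_closed)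
  have b: "b \<in> B" "\<And>x. x \<in> B \<Longrightarrow> b \<le> x"
    unfolding b_def using assms
    by (auto intro!: closed_contains_Inf cInf_lower bounded_imp_bdd_below compact_imp_bounded compact_imp_closed)
  have tr: "(\<lambda>x. x + c) ` S \<in> sets borel \<and> emeasure lborel ((\<lambda>x. x + c) ` S) = emeasure lborel S"
    if "compact S" for c and S :: "real set"
  proof -
    have K: "compact ((+) c ` S)" using that by (rule compact_translation)
    have "emeasure lborel ((+) c ` S) = emeasure (distr lborel borel ((+) c)) ((+) c ` S)"
      by (simp add: lborel_distr_plus)
    also have "\<dots> = emeasure lborel S"
      using K by (subst emeasure_distr) (auto simp: borel_compact inj_vimage_image_eq)
    finally show ?thesis
      using borel_compact[OF K] by (simp add: add.commute[of _ c])
  qed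
  let ?A = "(\<lambda>x. x + b) ` A" and ?B = "(\<lambda>x. x + a) ` B"
  have "?A \<inter> ?B \<subseteq> {a + b}"
    using a b by (force simp: add.commute)
  then have "emeasure lborel (?A \<inter> ?B) = 0"
    using emeasure_mono[of "?A \<inter> ?B" "{a + b}" lborel] by auto
  then have "emeasure lborel ?A + emeasure lborel ?B = emeasure lborel (?A \<union> ?B)"
    using emeasure_Un_Int[of ?A lborel ?B] tr[OF assms(1)] tr[OF assms(2)] by simp
  also have "\<dots> \<le> emeasure lborel C"
    using assms(5) sub[OF _ b(1)] sub[OF a(1)] by (intro emeasure_mono) (auto simp: add.commute)
  finally show ?thesis using tr assms by simp
qed

text \<open>Superlevel sets of slice volumes are merely Borel. Inner regularity reduces to closed
  subsets, which are compact because everything lies in \<open>{-r..r}\<close>.\<close>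

lemma emeasure_lborel_sumset:
  fixes A B C :: "real set"
  assumes "A \<in> sets borel" "B \<in> sets borel" "C \<in> sets borel" "A \<subseteq> {-r..r}" "B \<subseteq> {-r..r}"
    and "A \<noteq> {}" "B \<noteq> {}"
    and sub: "\<And>x y. x \<in> A \<Longrightarrow> y \<in> B \<Longrightarrow> x + y \<in> C"
  shows "emeasure lborel A + emeasure lborel B \<le> emeasure lborel C"
proof -
  have inner: "\<exists>K. compact K \<and> K \<noteq> {} \<and> K \<subseteq> S \<and> emeasure lborel S \<le> emeasure lborel K + ennreal e"
    if S: "S \<in> sets borel" "S \<subseteq> {-r..r}" "S \<noteq> {}" and "e > 0" for S :: "real set" and e
  proof -
    have "S \<in> sets lebesgue" using S by simp
    from sets_lebesgue_inner_closed[OF this \<open>e > 0\<close>] obtain T where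
      T: "closed T" "T \<subseteq> S" "S - T \<in> lmeasurable" "emeasure lebesgue (S - T) < ennreal e" by blast
    obtain s where s: "s \<in> S" using S by auto
    \<comment> \<open>The closed set \<open>T\<close> may be empty, while the compact case needs
      nonempty sets.\<close>
    let ?K = "insert s T"
    have "bounded T" by (rule bounded_subset[OF bounded_closed_interval[of "-r" r]]) (use S(2) T(2) in auto)
    then have "compact ?K"
      using T(1) by (intro compact_insert) (simp add: compact_eq_bounded_closed)
    have "emeasure lborel S \<le> emeasure lborel (?K \<union> (S - T))"
      using S(1) T(1,2) by (intro emeasure_mono) auto
    also have "\<dots> \<le> emeasure lborel ?K + emeasure lborel (S - T)"
      using S(1) T(1) by (intro emeasure_subadditive) auto
    also have "\<dots> \<le> emeasure lborel ?K + ennreal e"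
      using T(1,4) S(1) by (intro add_left_mono) (simp add: emeasure_completion less_imp_le)
    finally show ?thesis using \<open>compact ?K\<close> T(2) s by blast
  qed
  show ?thesis
  proof (rule ennreal_le_epsilon)
    fix e :: real assume "0 < e"
    then have "e / 2 > 0" by simp
    obtain K where K: "compact K" "K \<noteq> {}" "K \<subseteq> A" "emeasure lborel A \<le> emeasure lborel K + ennreal (e / 2)"
      using inner[OF assms(1,4,6) \<open>e / 2 > 0\<close>] by blast
    obtain L where L: "compact L" "L \<noteq> {}" "L \<subseteq> B" "emeasure lborel B \<le> emeasure lborel L + ennreal (e / 2)"
      using inner[OF assms(2,5,7) \<open>e / 2 > 0\<close>] by blast
    have "emeasure lborel K + emeasure lborel L \<le> emeasure lborel C"
      using K L assms(3) sub by (intro emeasure_lborel_sumset_compact) auto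
    moreover have "ennreal (e / 2) + ennreal (e / 2) = ennreal e"
      using \<open>0 < e\<close> by (simp flip: ennreal_plus)
    ultimately show "emeasure lborel A + emeasure lborel B \<le> emeasure lborel C + ennreal e"
      using add_mono[OF K(4) L(4)] by (metis (no_types, lifting) add.assoc add.commute add_mono order_refl order_trans)
  qed
qed

section \<open>Jensen's inequality and the layer-cake formula\<close>

text \<open>Jensen's inequality for \<open>x ^ Suc n\<close> at the points \<open>a / f\<close> and
  \<open>b / g\<close> with weights \<open>f\<close> and \<open>g\<close>. Bernoulli's inequality is
  the tangent line at the weighted mean \<open>c\<close>, and the linear terms of the two tangents
  cancel in the weighted sum.\<close>

lemma power_sum_le_weighted:
  fixes a b f g :: real
  assumes "a > 0" "b > 0" "f > 0" "g > 0"
  shows "(a + b) ^ Suc n \<le> (f + g) ^ n * (a ^ Suc n / f ^ n + b ^ Suc n / g ^ n)"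
proof -
  define c where "c = (a + b) / (f + g)"
  have c: "c > 0" "(a + b) = c * (f + g)" using assms by (auto simp: c_def)
  have tangent: "c ^ Suc n * (1 + real (Suc n) * (x / c - 1)) \<le> x ^ Suc n" if "x > 0" for x
  proof -
    have "1 + real (Suc n) * (x / c - 1) \<le> (1 + (x / c - 1)) ^ Suc n"
      using that c by (intro Bernoulli_inequality) auto
    also have "\<dots> = x ^ Suc n / c ^ Suc n"
      by (simp add: power_divide)
    finally show ?thesis using c(1) by (simp add: field_simps)
  qed
  have "f * (c ^ Suc n * (1 + real (Suc n) * ((a / f) / c - 1))) + g * (c ^ Suc n * (1 + real (Suc n) * ((b / g) / c - 1)))
      \<le> f * (a / f) ^ Suc n + g * (b / g) ^ Suc n"
    using assms by (intro add_mono mult_left_mono tangent) auto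
  also have "f * (c ^ Suc n * (1 + real (Suc n) * ((a / f) / c - 1))) + g * (c ^ Suc n * (1 + real (Suc n) * ((b / g) / c - 1)))
      = c ^ Suc n * (f + g + real (Suc n) * ((a + b) / c - (f + g)))"
    using assms c(1) by (simp add: field_simps)
  also have "\<dots> = c ^ Suc n * (f + g)"
    using c by simp
  also have "f * (a / f) ^ Suc n + g * (b / g) ^ Suc n = a ^ Suc n / f ^ n + b ^ Suc n / g ^ n"
    using assms by (simp add: power_divide)
  finally have "(f + g) ^ n * (c ^ Suc n * (f + g)) \<le> (f + g) ^ n * (a ^ Suc n / f ^ n + b ^ Suc n / g ^ n)"
    using assms by (intro mult_left_mono) auto
  moreover have "(f + g) ^ n * (c ^ Suc n * (f + g)) = (a + b) ^ Suc n"
    unfolding c(2) by (simp add: power_mult_distrib mult_ac)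
  ultimately show ?thesis by simp
qed

lemma ennreal_layer:
  fixes h :: ennreal
  shows "(\<integral>\<^sup>+s. indicator {s. 0 < s \<and> s < 1 \<and> ennreal s \<le> h} s \<partial>lborel) \<le> h"
    and "h \<le> 1 \<Longrightarrow> h \<le> (\<integral>\<^sup>+s. indicator {s. 0 < s \<and> s < 1 \<and> ennreal s < h} s \<partial>lborel)"
proof -
  show "(\<integral>\<^sup>+s. indicator {s. 0 < s \<and> s < 1 \<and> ennreal s \<le> h} s \<partial>lborel) \<le> h"
  proof (cases "h \<le> 1")
    case True
    then obtain r where r: "h = ennreal r" "0 \<le> r" "r \<le> 1"
      by (cases h) (auto simp: top_unique)
    have "(\<integral>\<^sup>+s. indicator {s. 0 < s \<and> s < 1 \<and> ennreal s \<le> h} s \<partial>lborel)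
        \<le> (\<integral>\<^sup>+s. indicator {0..r} s \<partial>lborel)"
      using r by (intro nn_integral_mono) (auto split: split_indicator)
    then show ?thesis using r by simp
  next
    case False
    have "(\<integral>\<^sup>+s. indicator {s. 0 < s \<and> s < 1 \<and> ennreal s \<le> h} s \<partial>lborel)
        \<le> (\<integral>\<^sup>+s. indicator {0..1::real} s \<partial>lborel)"
      by (intro nn_integral_mono) (auto split: split_indicator)
    then show ?thesis using False by simp
  qed
  assume "h \<le> 1"
  then obtain r where r: "h = ennreal r" "0 \<le> r" "r \<le> 1"
    by (cases h) (auto simp: top_unique)
  have "{s. 0 < s \<and> s < 1 \<and> ennreal s < h} = {0<..<r}"
    using r by (auto simp: ennreal_less_iff)
  then show "h \<le> (\<integral>\<^sup>+s. indicator {s. 0 < s \<and> s < 1 \<and> ennreal s < h} s \<partial>lborel)"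
    using r by simp
qed

text \<open>Levels are cut off at 1. Closed superlevel sets then bound the integral from below for
  every \<open>h\<close>, and strict ones bound it from above once \<open>h \<le> 1\<close>. In
  Brunn-Minkowski the second form serves the two summands, normalised to be at most 1, and the first
  serves the sum, whose slices have no upper bound.\<close>

lemma layer_cake:
  fixes h :: "real \<Rightarrow> ennreal"
  assumes [measurable]: "h \<in> borel_measurable borel"
  shows "(\<integral>\<^sup>+s. indicator {0<..<1} s * emeasure lborel {z. ennreal s \<le> h z} \<partial>lborel) \<le> (\<integral>\<^sup>+z. h z \<partial>lborel)"
    and "(\<And>z. h z \<le> 1) \<Longrightarrow>
      (\<integral>\<^sup>+z. h z \<partial>lborel) \<le> (\<integral>\<^sup>+s. indicator {0<..<1} s * emeasure lborel {z. ennreal s < h z} \<partial>lborel)"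
proof -
  have "(\<integral>\<^sup>+s. indicator {0<..<1} s * emeasure lborel {z. ennreal s \<le> h z} \<partial>lborel)
      = (\<integral>\<^sup>+s. \<integral>\<^sup>+z. indicator {s. 0 < s \<and> s < 1 \<and> ennreal s \<le> h z} s \<partial>lborel \<partial>lborel)"
  proof (intro nn_integral_cong)
    fix s :: real
    have "(\<integral>\<^sup>+z. indicator {s. 0 < s \<and> s < 1 \<and> ennreal s \<le> h z} s \<partial>lborel)
      = (\<integral>\<^sup>+z. indicator {0<..<1} s * indicator {z. ennreal s \<le> h z} z \<partial>lborel)"
      by (intro nn_integral_cong) (auto split: split_indicator)
    then show "indicator {0<..<1} s * emeasure lborel {z. ennreal s \<le> h z}
      = (\<integral>\<^sup>+z. indicator {s. 0 < s \<and> s < 1 \<and> ennreal s \<le> h z} s \<partial>lborel)"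
      by (simp add: nn_integral_cmult)
  qed
  also have "\<dots> = (\<integral>\<^sup>+z. \<integral>\<^sup>+s. indicator {s. 0 < s \<and> s < 1 \<and> ennreal s \<le> h z} s \<partial>lborel \<partial>lborel)"
    by (rule lborel_pair.Fubini') (simp add: indicator_def split_beta)
  also have "\<dots> \<le> (\<integral>\<^sup>+z. h z \<partial>lborel)"
    by (intro nn_integral_mono ennreal_layer)
  finally show "(\<integral>\<^sup>+s. indicator {0<..<1} s * emeasure lborel {z. ennreal s \<le> h z} \<partial>lborel) \<le> (\<integral>\<^sup>+z. h z \<partial>lborel)" .
  assume "\<And>z. h z \<le> 1"
  then have "(\<integral>\<^sup>+z. h z \<partial>lborel)
      \<le> (\<integral>\<^sup>+z. \<integral>\<^sup>+s. indicator {s. 0 < s \<and> s < 1 \<and> ennreal s < h z} s \<partial>lborel \<partial>lborel)"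
    by (intro nn_integral_mono ennreal_layer)
  also have "\<dots> = (\<integral>\<^sup>+s. \<integral>\<^sup>+z. indicator {s. 0 < s \<and> s < 1 \<and> ennreal s < h z} s \<partial>lborel \<partial>lborel)"
    by (rule lborel_pair.Fubini') (simp add: indicator_def split_beta)
  also have "\<dots> = (\<integral>\<^sup>+s. indicator {0<..<1} s * emeasure lborel {z. ennreal s < h z} \<partial>lborel)"
  proof (intro nn_integral_cong)
    fix s :: real
    have "(\<integral>\<^sup>+z. indicator {s. 0 < s \<and> s < 1 \<and> ennreal s < h z} s \<partial>lborel)
      = (\<integral>\<^sup>+z. indicator {0<..<1} s * indicator {z. ennreal s < h z} z \<partial>lborel)"
      by (intro nn_integral_cong) (auto split: split_indicator)
    then show "(\<integral>\<^sup>+z. indicator {s. 0 < s \<and> s < 1 \<and> ennreal s < h z} s \<partial>lborel)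
      = indicator {0<..<1} s * emeasure lborel {z. ennreal s < h z}"
      by (simp add: nn_integral_cmult)
  qed
  finally show "(\<integral>\<^sup>+z. h z \<partial>lborel) \<le> (\<integral>\<^sup>+s. indicator {0<..<1} s * emeasure lborel {z. ennreal s < h z} \<partial>lborel)" .
qed

section \<open>Slices and the induction on the dimension\<close>

lemma borel_measurable_emeas_section:
  assumes "A \<in> sets borel"
  shows "(\<lambda>z. emeasure (emeas n) {x. x(n := z) \<in> A}) \<in> borel_measurable borel"
proof -
  interpret sigma_finite_measure "emeas n" by (rule sigma_finite_emeas)
  have m: "(\<lambda>p. (snd p)(n := fst p)) \<in> borel_measurable (borel \<Otimes>\<^sub>M emeas n)"
    by (rule borel_measurable_coordI) (auto simp: fun_upd_def dest: borel_measurable_coord_comp)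
  have "(\<lambda>p. indicator A ((snd p)(n := fst p)) :: ennreal) \<in> borel_measurable (borel \<Otimes>\<^sub>M emeas n)"
    by (rule measurable_compose[OF m]) (use assms in simp)
  then have "(\<lambda>z. \<integral>\<^sup>+x. indicator A (x(n := z)) \<partial>emeas n) \<in> borel_measurable borel"
    by (intro borel_measurable_nn_integral) (simp add: split_beta)
  moreover have "(\<integral>\<^sup>+x. indicator A (x(n := z)) \<partial>emeas n) = emeasure (emeas n) {x. x(n := z) \<in> A}" for z
  proof -
    have "(\<integral>\<^sup>+x. indicator A (x(n := z)) \<partial>emeas n) = (\<integral>\<^sup>+x. indicator {x. x(n := z) \<in> A} x \<partial>emeas n)"
      by (intro nn_integral_cong) (auto split: split_indicator)
    also have "\<dots> = emeasure (emeas n) {x. x(n := z) \<in> A}"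
      using sets_borel_vimageI[OF borel_measurable_fun_upd(1) assms] by simp
    finally show ?thesis .
  qed
  ultimately show ?thesis by simp
qed

text \<open>\<open>f ^ n\<close> is the supremum of the slice volumes. It need not be attained, so
  slices are only claimed to exceed \<open>s * f ^ n\<close> for \<open>s < 1\<close>. The number
  \<open>p\<close> is the \<open>n\<close>-th root of a slice volume; \<open>max 1 n\<close> makes
  the root meaningful when the slices have dimension 0.\<close>

lemma emeas_section_normalised:
  assumes A: "A \<in> sets borel" "\<forall>x\<in>A. \<forall>i<Suc n. \<bar>x i\<bar> \<le> r"
    and a: "a > 0" "emeasure (emeas (Suc n)) A = ennreal (a ^ Suc n)"
  defines "F \<equiv> \<lambda>z. emeasure (emeas n) {x. x(n := z) \<in> A}"
  obtains f where "f > 0" "\<And>z. F z \<le> ennreal (f ^ n)"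
    "\<And>s. 0 < s \<Longrightarrow> s < 1 \<Longrightarrow> \<exists>z. ennreal (s * f ^ n) < F z"
    "\<And>s z. 0 < s \<Longrightarrow> s < 1 \<Longrightarrow> ennreal (s * f ^ n) < F z \<Longrightarrow>
      \<exists>p>0. F z = ennreal (p ^ n) \<and> root (max 1 n) s * f \<le> p"
proof -
  have Fm: "F \<in> borel_measurable borel"
    unfolding F_def by (rule borel_measurable_emeas_section[OF A(1)])
  have int: "(\<integral>\<^sup>+z. F z \<partial>lborel) = ennreal (a ^ Suc n)"
    unfolding F_def using emeasure_emeas_Suc(2)[OF A(1)] a(2) by simp
  have "A \<noteq> {}" using a by auto
  then have r: "r \<ge> 0" using A(2) by (meson abs_ge_zero all_not_in_conv order_trans zero_less_Suc)
  have box: "{x :: nat \<Rightarrow> real. \<forall>i<n. \<bar>x i\<bar> \<le> r} \<in> sets borel" by measurable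
  have Fle: "F z \<le> ennreal ((2 * r) ^ n)" for z
  proof -
    have "F z \<le> emeasure (emeas n) {x. \<forall>i<n. \<bar>x i\<bar> \<le> r}"
      unfolding F_def
    proof (rule emeasure_mono)
      show "{x. x(n := z) \<in> A} \<subseteq> {x. \<forall>i<n. \<bar>x i\<bar> \<le> r}"
      proof clarify
        fix x i assume "x(n := z) \<in> A" "i < n"
        then show "\<bar>x i\<bar> \<le> r" using A(2)[rule_format, of "x(n := z)" i] by simp
      qed
    qed (use box in simp)
    then show ?thesis using r by (simp add: emeasure_emeas_box)
  qed
  define F' where "F' z = enn2real (F z)" for z
  have FF: "F z = ennreal (F' z)" for z
    unfolding F'_def using Fle[of z] by (intro ennreal_enn2real[symmetric]) (auto simp: less_top[symmetric] top_unique)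
  have F'0: "F' z \<ge> 0" for z by (simp add: F'_def)
  have F'le: "F' z \<le> (2 * r) ^ n" for z
    using Fle[of z] r F'0[of z] by (simp add: FF)
  then have bdd: "bdd_above (range F')" by (rule bdd_aboveI2)
  define m where "m = Sup (range F')"
  have le_m: "F' z \<le> m" for z unfolding m_def using bdd by (intro cSup_upper) auto
  have "\<exists>z. F' z > 0"
  proof (rule ccontr)
    assume "\<not> ?thesis"
    then have "F z = 0" for z using F'0[of z] FF[of z] by (metis ennreal_0 less_eq_real_def)
    then show False using int a by simp
  qed
  then obtain z0 where z0: "F' z0 > 0" by blast
  then have m0: "m > 0" using le_m[of z0] by simp
  \<comment> \<open>A slice of dimension 0 has mass 0 or 1, so the supremum is 1 and any positive
    \<open>f\<close> satisfies \<open>f ^ 0 = 1\<close>.\<close>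
  have F01: "F' z = 1" if "n = 0" "F' z > 0" for z
  proof -
    have "F z = indicator {x. x(n := z) \<in> A} (\<lambda>_. 0)"
      unfolding F_def using that(1) sets_borel_vimageI[OF borel_measurable_fun_upd(1) A(1)]
      by (auto intro!: emeas_0)
    then show ?thesis using that(2)
      by (cases "(\<lambda>_. 0)(n := z) \<in> A") (simp_all add: F'_def del: fun_upd_apply)
  qed
  obtain f where f: "f > 0" "f ^ n = m"
  proof (cases "n = 0")
    case True
    have "m \<le> 1" unfolding m_def
      using F01[OF True] by (intro cSup_least) (auto, metis F'0 less_eq_real_def order_refl zero_le_one)
    then have "m = 1" using le_m[of z0] F01[OF True z0] by simp
    then show ?thesis using True that[of 1] by simp
  next
    case False
    then show ?thesis using m0 by (intro that[of "root n m"]) auto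
  qed
  show ?thesis
  proof (rule that[of f])
    show "f > 0" by fact
    show "F z \<le> ennreal (f ^ n)" for z
      using le_m[of z] f by (simp add: FF ennreal_leI)
  next
    fix s :: real assume s: "0 < s" "s < 1"
    then have "s * m < m" using m0 by simp
    then obtain z where "s * m < F' z"
      unfolding m_def by (auto simp: less_cSup_iff[OF _ bdd])
    then show "\<exists>z. ennreal (s * f ^ n) < F z"
      using s m0 f by (auto simp: FF ennreal_less_iff intro!: exI[of _ z])
  next
    fix s z :: real assume s: "0 < s" "s < 1" "ennreal (s * f ^ n) < F z"
    then have sz: "s * f ^ n < F' z" using f(1) by (simp add: FF ennreal_less_iff)
    moreover have "0 < s * f ^ n" using s f(1) by simp
    ultimately have pos: "F' z > 0" by linarith
    show "\<exists>p>0. F z = ennreal (p ^ n) \<and> root (max 1 n) s * f \<le> p"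
    proof (cases "n = 0")
      case True
      then show ?thesis using f(1) s F01[OF True pos] by (auto simp: FF intro!: exI[of _ f])
    next
      case False
      let ?p = "root n (F' z)"
      have p: "?p > 0" "?p ^ n = F' z" using False pos by auto
      have "(root n s * f) ^ n < ?p ^ n"
        using False s sz p by (simp add: power_mult_distrib)
      then have "root n s * f < ?p"
        using p by (intro power_less_imp_less_base[of _ n ?p]) auto
      moreover have "max 1 n = n" using False by simp
      ultimately show ?thesis using p by (auto simp: FF intro!: exI[of _ ?p])
    qed
  qed
qed

lemma ennreal_level_iff:
  assumes "c > 0" "s \<ge> 0"
  shows "ennreal s < x / ennreal c \<longleftrightarrow> ennreal (s * c) < x"
    and "ennreal s \<le> x / ennreal c \<longleftrightarrow> ennreal (s * c) \<le> x"
  using assms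
  by (cases x; auto simp: divide_ennreal ennreal_less_iff ennreal_top_divide field_simps)+

text \<open>Slice volumes of \<open>A\<close> and \<open>B\<close> are divided by their suprema
  \<open>f ^ n\<close> and \<open>g ^ n\<close>, those of \<open>C\<close> by
  \<open>(f + g) ^ n\<close>. By induction, heights where the first two ratios exceed
  \<open>s\<close> add up to heights where the third is at least \<open>s\<close>. The sumset
  inequality on the line and the layer-cake formula then compare the integrals of the ratios, and
  Jensen's inequality removes the normalisation. Writing volumes as \<open>a ^ n\<close> instead of
  taking roots keeps the statement meaningful for \<open>n = 0\<close>.\<close>

lemma brunn_minkowski:
  assumes "A \<in> sets borel" "B \<in> sets borel" "C \<in> sets borel"
    and "\<forall>x\<in>A. \<forall>i<n. \<bar>x i\<bar> \<le> r" "\<forall>x\<in>B. \<forall>i<n. \<bar>x i\<bar> \<le> r"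
    and "\<And>x y. x \<in> A \<Longrightarrow> y \<in> B \<Longrightarrow> (\<lambda>i. x i + y i) \<in> C"
    and "a > 0" "emeasure (emeas n) A = ennreal (a ^ n)"
    and "b > 0" "emeasure (emeas n) B = ennreal (b ^ n)"
  shows "ennreal ((a + b) ^ n) \<le> emeasure (emeas n) C"
  using assms
proof (induction n arbitrary: A B C a b)
  case 0
  have z: "(\<lambda>_. 0) \<in> A" "(\<lambda>_. 0) \<in> B"
    using 0 by (auto simp: emeas_0 indicator_def split: if_splits)
  then have "(\<lambda>_. 0) \<in> C" using 0(6)[OF z] by simp
  then show ?case using 0 by (simp add: emeas_0)
next
  case (Suc n)
  note sets = Suc.prems(1-3)
  define F where "F = (\<lambda>z. emeasure (emeas n) {x. x(n := z) \<in> A})"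
  define G where "G = (\<lambda>z. emeasure (emeas n) {x. x(n := z) \<in> B})"
  define H where "H = (\<lambda>z. emeasure (emeas n) {x. x(n := z) \<in> C})"
  have meas: "F \<in> borel_measurable borel" "G \<in> borel_measurable borel" "H \<in> borel_measurable borel"
    unfolding F_def G_def H_def using sets by (auto intro!: borel_measurable_emeas_section)
  obtain f where f: "f > 0" "\<And>z. F z \<le> ennreal (f ^ n)"
    "\<And>s. 0 < s \<Longrightarrow> s < 1 \<Longrightarrow> \<exists>z. ennreal (s * f ^ n) < F z"
    "\<And>s z. 0 < s \<Longrightarrow> s < 1 \<Longrightarrow> ennreal (s * f ^ n) < F z \<Longrightarrow>
      \<exists>p>0. F z = ennreal (p ^ n) \<and> root (max 1 n) s * f \<le> p"
    unfolding F_def by (rule emeas_section_normalised[of A n r a, OF sets(1) Suc.prems(4,7,8)]) auto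
  obtain g where g: "g > 0" "\<And>z. G z \<le> ennreal (g ^ n)"
    "\<And>s. 0 < s \<Longrightarrow> s < 1 \<Longrightarrow> \<exists>z. ennreal (s * g ^ n) < G z"
    "\<And>s z. 0 < s \<Longrightarrow> s < 1 \<Longrightarrow> ennreal (s * g ^ n) < G z \<Longrightarrow>
      \<exists>p>0. G z = ennreal (p ^ n) \<and> root (max 1 n) s * g \<le> p"
    unfolding G_def by (rule emeas_section_normalised[of B n r b, OF sets(2) Suc.prems(5,9,10)]) auto
  define Fn Gn Hn where "Fn = (\<lambda>z. F z / ennreal (f ^ n))" and "Gn = (\<lambda>z. G z / ennreal (g ^ n))"
    and "Hn = (\<lambda>z. H z / ennreal ((f + g) ^ n))"
  have [measurable]: "Fn \<in> borel_measurable borel" "Gn \<in> borel_measurable borel" "Hn \<in> borel_measurable borel"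
    unfolding Fn_def Gn_def Hn_def using meas by auto
  have le1: "Fn z \<le> 1" "Gn z \<le> 1" for z
    unfolding Fn_def Gn_def using f(1,2) g(1,2) by (auto intro!: divide_le_posI_ennreal)
  have F0: "{x. x(n := z) \<in> A} = {}" if "z \<notin> {-r..r}" for z
    using Suc.prems(4)[rule_format, of "x(n := z)" n for x] that by (fastforce simp: abs_le_iff)
  have G0: "{x. x(n := z) \<in> B} = {}" if "z \<notin> {-r..r}" for z
    using Suc.prems(5)[rule_format, of "x(n := z)" n for x] that by (fastforce simp: abs_le_iff)
  have level: "emeasure lborel {z. ennreal s < Fn z} + emeasure lborel {z. ennreal s < Gn z}
      \<le> emeasure lborel {z. ennreal s \<le> Hn z}" if s: "0 < s" "s < 1" for s
  proof (rule emeasure_lborel_sumset)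
    show "{z. ennreal s < Fn z} \<subseteq> {-r..r}" "{z. ennreal s < Gn z} \<subseteq> {-r..r}"
      using F0 G0 unfolding Fn_def Gn_def F_def G_def by force+
    show "{z. ennreal s < Fn z} \<noteq> {}" "{z. ennreal s < Gn z} \<noteq> {}"
      using f(3)[OF s] g(3)[OF s] s f(1) g(1) by (auto simp: Fn_def Gn_def ennreal_level_iff)
    fix x y assume "x \<in> {z. ennreal s < Fn z}" "y \<in> {z. ennreal s < Gn z}"
    then have "ennreal (s * f ^ n) < F x" "ennreal (s * g ^ n) < G y"
      using s f(1) g(1) by (auto simp: Fn_def Gn_def ennreal_level_iff)
    from f(4)[OF s this(1)] g(4)[OF s this(2)] obtain p q where
      p: "p > 0" "F x = ennreal (p ^ n)" "root (max 1 n) s * f \<le> p" and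
      q: "q > 0" "G y = ennreal (q ^ n)" "root (max 1 n) s * g \<le> q" by blast
    have "ennreal ((p + q) ^ n) \<le> H (x + y)"
      unfolding H_def
    proof (rule Suc.IH[OF _ _ _ _ _ _ p(1) p(2)[unfolded F_def] q(1) q(2)[unfolded G_def]])
      show "{xa. xa(n := x) \<in> A} \<in> sets borel" "{x. x(n := y) \<in> B} \<in> sets borel"
        "{xa. xa(n := x + y) \<in> C} \<in> sets borel"
        using sets by (auto intro!: sets_borel_vimageI borel_measurable_fun_upd simp del: fun_upd_apply)
    next
      show "\<forall>w\<in>{xa. xa(n := x) \<in> A}. \<forall>i<n. \<bar>w i\<bar> \<le> r"
      proof clarify
        fix w i assume "w(n := x) \<in> A" "i < n"
        then show "\<bar>w i\<bar> \<le> r" using Suc.prems(4)[rule_format, of "w(n := x)" i] by simp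
      qed
      show "\<forall>w\<in>{xa. xa(n := y) \<in> B}. \<forall>i<n. \<bar>w i\<bar> \<le> r"
      proof clarify
        fix w i assume "w(n := y) \<in> B" "i < n"
        then show "\<bar>w i\<bar> \<le> r" using Suc.prems(5)[rule_format, of "w(n := y)" i] by simp
      qed
    next
      fix v w assume "v \<in> {xa. xa(n := x) \<in> A}" "w \<in> {xa. xa(n := y) \<in> B}"
      then have "(\<lambda>i. (v(n := x)) i + (w(n := y)) i) \<in> C" 
        using Suc.prems(6)[of "v(n := x)" "w(n := y)"] by (simp only: mem_Collect_eq)
      moreover have "(\<lambda>i. (v(n := x)) i + (w(n := y)) i) = (\<lambda>i. v i + w i)(n := x + y)" by auto
      ultimately show "(\<lambda>i. v i + w i) \<in> {xa. xa(n := x + y) \<in> C}" by simp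
    qed
    \<comment> \<open>Both \<open>p\<close> and \<open>q\<close> carry the common factor
      \<open>?S\<close>, the \<open>n\<close>-th root of the level \<open>s\<close>; for
      \<open>n = 0\<close> the estimate \<open>s \<le> ?S ^ n\<close> is just
      \<open>s \<le> 1\<close>.\<close>
    moreover have "s * (f + g) ^ n \<le> (p + q) ^ n"
    proof -
      let ?S = "root (max 1 n) s"
      have "s \<le> ?S ^ n" using s by (cases "n = 0") (auto simp: max_def)
      then have "s * (f + g) ^ n \<le> ?S ^ n * (f + g) ^ n" using f(1) g(1) by (intro mult_right_mono) auto
      also have "\<dots> = (?S * f + ?S * g) ^ n" by (simp add: power_mult_distrib[symmetric] distrib_left)
      also have "\<dots> \<le> (p + q) ^ n" using p q s f(1) g(1) by (intro power_mono add_mono) auto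
      finally show ?thesis .
    qed
    ultimately show "x + y \<in> {z. ennreal s \<le> Hn z}"
      using s f(1) g(1) by (auto simp: Hn_def ennreal_level_iff intro: order_trans[OF ennreal_leI])
  qed measurable
  have "(\<integral>\<^sup>+z. Fn z \<partial>lborel) + (\<integral>\<^sup>+z. Gn z \<partial>lborel)
      \<le> (\<integral>\<^sup>+s. indicator {0<..<1} s * emeasure lborel {z. ennreal s < Fn z} \<partial>lborel)
        + (\<integral>\<^sup>+s. indicator {0<..<1} s * emeasure lborel {z. ennreal s < Gn z} \<partial>lborel)"
    by (intro add_mono layer_cake le1) simp_all
  also have "\<dots> = (\<integral>\<^sup>+s. indicator {0<..<1} s * emeasure lborel {z. ennreal s < Fn z}
        + indicator {0<..<1} s * emeasure lborel {z. ennreal s < Gn z} \<partial>lborel)"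
    by (rule nn_integral_add[symmetric]) measurable
  also have "\<dots> \<le> (\<integral>\<^sup>+s. indicator {0<..<1} s * emeasure lborel {z. ennreal s \<le> Hn z} \<partial>lborel)"
    using level by (intro nn_integral_mono) (auto split: split_indicator)
  also have "\<dots> \<le> (\<integral>\<^sup>+z. Hn z \<partial>lborel)"
    by (rule layer_cake) simp
  also have "\<dots> = emeasure (emeas (Suc n)) C / ennreal ((f + g) ^ n)"
    unfolding Hn_def H_def using meas(3) emeasure_emeas_Suc(2)[OF sets(3)]
    by (subst nn_integral_divide) (auto simp: H_def)
  also have "(\<integral>\<^sup>+z. Fn z \<partial>lborel) = ennreal (a ^ Suc n) / ennreal (f ^ n)"
    unfolding Fn_def F_def using meas(1) emeasure_emeas_Suc(2)[OF sets(1)] Suc.prems(8)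
    by (subst nn_integral_divide) (auto simp: F_def)
  also have "(\<integral>\<^sup>+z. Gn z \<partial>lborel) = ennreal (b ^ Suc n) / ennreal (g ^ n)"
    unfolding Gn_def G_def using meas(2) emeasure_emeas_Suc(2)[OF sets(2)] Suc.prems(10)
    by (subst nn_integral_divide) (auto simp: G_def)
  also have "ennreal (a ^ Suc n) / ennreal (f ^ n) + ennreal (b ^ Suc n) / ennreal (g ^ n)
      = ennreal (a ^ Suc n / f ^ n + b ^ Suc n / g ^ n)"
    using f(1) g(1) Suc.prems(7,9) by (simp add: divide_ennreal)
  finally have "ennreal ((a ^ Suc n / f ^ n + b ^ Suc n / g ^ n) * (f + g) ^ n) \<le> emeasure (emeas (Suc n)) C"
    using f(1) g(1) Suc.prems(7,9) by (subst (asm) ennreal_level_iff) auto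
  moreover have "(a + b) ^ Suc n \<le> (a ^ Suc n / f ^ n + b ^ Suc n / g ^ n) * (f + g) ^ n"
    using power_sum_le_weighted[OF Suc.prems(7,9) f(1) g(1), of n] by (simp add: mult.commute)
  ultimately show ?case by (meson ennreal_leI order_trans)
qed

section \<open>Convex bodies and surface area\<close>

lemma mem_unit_balln: "x \<in> unit_balln n \<longleftrightarrow> (\<forall>i\<ge>n. x i = 0) \<and> (\<Sum>i<n. (x i)\<^sup>2) \<le> 1"
  by (auto simp: unit_balln_def topspace_Euclidean_space L2_set_def)

lemma zero_mem_unit_balln: "(\<lambda>_. 0) \<in> unit_balln n"
  by (simp add: mem_unit_balln)

lemma convexn_unit_balln: "convexn (unit_balln n)"
  unfolding convexn_def
proof (intro ballI)
  fix x y and t :: real assume xy: "x \<in> unit_balln n" "y \<in> unit_balln n" and t: "t \<in> {0..1}"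
  have "L2_set (\<lambda>i. (1 - t) * x i + t * y i) {..<n} \<le> L2_set (\<lambda>i. (1 - t) * x i) {..<n} + L2_set (\<lambda>i. t * y i) {..<n}"
    by (rule L2_set_triangle_ineq)
  also have "\<dots> = (1 - t) * L2_set x {..<n} + t * L2_set y {..<n}"
    using t by (simp add: L2_set_right_distrib)
  also have "\<dots> \<le> (1 - t) * 1 + t * 1"
    using t xy by (intro add_mono mult_left_mono) (auto simp: unit_balln_def)
  finally show "(\<lambda>i. (1 - t) * x i + t * y i) \<in> unit_balln n"
    using xy by (auto simp: unit_balln_def topspace_Euclidean_space)
qed

text \<open>Tychonoff's theorem, with the singleton of 0 as factor from index \<open>n\<close>
  on.\<close>

lemma compact_coord_box: "compact {x :: nat \<Rightarrow> real. (\<forall>i<n. \<bar>x i\<bar> \<le> r) \<and> (\<forall>i\<ge>n. x i = 0)}"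
proof -
  let ?S = "\<lambda>i. if i < n then {-r..r} else {0}"
  have "compactin (product_topology (\<lambda>_. euclideanreal) UNIV) (Pi\<^sub>E UNIV ?S)"
    unfolding compactin_PiE by auto
  then have "compact (Pi\<^sub>E UNIV ?S)"
    by (simp add: euclidean_product_topology)
  also have "Pi\<^sub>E UNIV ?S = {x :: nat \<Rightarrow> real. (\<forall>i<n. \<bar>x i\<bar> \<le> r) \<and> (\<forall>i\<ge>n. x i = 0)}"
  proof -
    have "x i \<in> ?S i \<longleftrightarrow> (i < n \<longrightarrow> \<bar>x i\<bar> \<le> r) \<and> (n \<le> i \<longrightarrow> x i = 0)" for x :: "nat \<Rightarrow> real" and i
      by (auto simp: abs_le_iff)
    then show ?thesis by (simp add: PiE_UNIV_domain Pi_def) blast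
  qed
  finally show ?thesis .
qed

lemma compact_unit_balln: "compact (unit_balln n)"
proof -
  have "\<bar>x i\<bar> \<le> 1" if "x \<in> unit_balln n" "i < n" for x i
  proof -
    have "(x i)\<^sup>2 \<le> (\<Sum>i<n. (x i)\<^sup>2)" using that(2) by (intro member_le_sum) auto
    then have "(x i)\<^sup>2 \<le> 1" using that(1) by (simp add: mem_unit_balln)
    then show ?thesis by (simp add: abs_square_le_1)
  qed
  then have "unit_balln n = {x. (\<forall>i<n. \<bar>x i\<bar> \<le> 1) \<and> (\<forall>i\<ge>n. x i = 0)} \<inter> {x. (\<Sum>i<n. (x i)\<^sup>2) \<le> 1}"
    by (auto simp: mem_unit_balln)
  moreover have "closed {x :: nat \<Rightarrow> real. (\<Sum>i<n. (x i)\<^sup>2) \<le> 1}"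
    by (intro closed_Collect_le continuous_intros continuous_on_product_coordinates)
  ultimately show ?thesis
    using compact_Int_closed[OF compact_coord_box] by simp
qed

lemma compact_bounded_coord:
  fixes K :: "(nat \<Rightarrow> real) set"
  assumes "compact K"
  obtains r where "r \<ge> 0" "\<forall>x\<in>K. \<forall>i<n. \<bar>x i\<bar> \<le> r"
proof -
  have "\<exists>r. \<forall>x\<in>K. \<bar>x i\<bar> \<le> r" for i
  proof -
    have "compact ((\<lambda>x. x i) ` K)"
      by (rule compact_continuous_image[OF continuous_on_subset[OF continuous_on_product_coordinates] assms]) simp
    then have "bounded ((\<lambda>x. x i) ` K)" by (rule compact_imp_bounded)
    then show ?thesis by (auto simp: bounded_iff)
  qed
  then obtain r where r: "\<And>i x. x \<in> K \<Longrightarrow> \<bar>x i\<bar> \<le> r i" by metis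
  have "\<bar>x i\<bar> \<le> (\<Sum>i<n. \<bar>r i\<bar>)" if "x \<in> K" "i < n" for x i
  proof -
    have "\<bar>x i\<bar> \<le> \<bar>r i\<bar>" using r[OF that(1), of i] by simp
    also have "\<dots> \<le> (\<Sum>i<n. \<bar>r i\<bar>)" using that(2) by (intro member_le_sum) auto
    finally show ?thesis .
  qed
  then show ?thesis by (intro that[of "\<Sum>i<n. \<bar>r i\<bar>"]) (auto intro: sum_nonneg)
qed

lemma compact_imp_borel: "compact K \<Longrightarrow> K \<in> sets borel" for K :: "(nat \<Rightarrow> real) set"
  by (intro borel_closed compact_imp_closed)

lemma emeasure_emeas_compact:
  assumes "compact K"
  shows "emeasure (emeas n) K = ennreal (voln n K)"
proof -
  obtain r where r: "r \<ge> 0" "\<forall>x\<in>K. \<forall>i<n. \<bar>x i\<bar> \<le> r" by (rule compact_bounded_coord[OF assms])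
  have "{x :: nat \<Rightarrow> real. \<forall>i<n. \<bar>x i\<bar> \<le> r} \<in> sets borel" by measurable
  then have "emeasure (emeas n) K \<le> ennreal ((2 * r) ^ n)"
    unfolding emeasure_emeas_box[OF r(1), symmetric] using r by (intro emeasure_mono) auto
  then have "emeasure (emeas n) K \<noteq> \<infinity>" by (auto simp: top_unique)
  then show ?thesis
    by (simp add: voln_eq_measure[OF compact_imp_borel[OF assms]] emeasure_eq_ennreal_measure)
qed

lemma voln_nonneg: "voln n K \<ge> 0"
  by (simp add: voln_def)

lemma voln_mono:
  assumes "compact K" "compact L" "K \<subseteq> L"
  shows "voln n K \<le> voln n L"
proof -
  have "emeasure (emeas n) K \<le> emeasure (emeas n) L"
    using assms by (intro emeasure_mono) (auto intro: compact_imp_borel)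
  then show ?thesis
    using assms voln_nonneg by (simp add: emeasure_emeas_compact)
qed

lemma compact_affine_image:
  fixes K :: "(nat \<Rightarrow> real) set"
  assumes "compact K"
  shows "compact ((\<lambda>x i. s * x i + v i) ` K)"
proof (rule compact_continuous_image[OF continuous_on_coordinatewise_then_product assms])
  have "continuous_on K (\<lambda>x. x i)" for i :: nat
    by (rule continuous_on_subset[OF continuous_on_product_coordinates]) simp
  then show "continuous_on K (\<lambda>x. s * x i + v i)" for i
    by (intro continuous_intros)
qed

lemma voln_affine:
  assumes "compact K" "s > 0" "\<And>i. n \<le> i \<Longrightarrow> v i = 0"
  shows "voln n ((\<lambda>x i. s * x i + v i) ` K) = s ^ n * voln n K"
proof -
  let ?f = "\<lambda>x i. s * x i + v i"
  have "inj ?f"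
  proof (rule injI)
    fix x y assume "?f x = ?f y"
    then have "s * x i + v i = s * y i + v i" for i by meson
    then show "x = y" using assms(2) by auto
  qed
  then have "{x. ?f x \<in> ?f ` K} = K" by (auto dest: injD)
  then have "emeasure (emeas n) (?f ` K) = ennreal (s ^ n) * emeasure (emeas n) K"
    using emeasure_emeas_affine[of "?f ` K" s n v] assms compact_imp_borel[OF compact_affine_image[OF assms(1)]]
    by simp
  then show ?thesis
    using assms compact_affine_image[OF assms(1)] voln_nonneg
    by (simp add: emeasure_emeas_compact ennreal_mult[symmetric])
qed

lemma compact_scale_image:
  fixes K :: "(nat \<Rightarrow> real) set"
  assumes "compact K"
  shows "compact ((\<lambda>x i. s * x i) ` K)"
  using compact_affine_image[OF assms, of s "\<lambda>_. 0"] by simp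

lemma voln_scale:
  assumes "compact K" "s > 0"
  shows "voln n ((\<lambda>x i. s * x i) ` K) = s ^ n * voln n K"
  using voln_affine[OF assms, of n "\<lambda>_. 0"] by simp

lemma brunn_minkowski_root:
  assumes "compact K" "compact L" "compact M" "n \<ge> 1" "voln n K > 0" "voln n L > 0"
    and "\<And>x y. x \<in> K \<Longrightarrow> y \<in> L \<Longrightarrow> (\<lambda>i. x i + y i) \<in> M"
  shows "root n (voln n K) + root n (voln n L) \<le> root n (voln n M)"
proof -
  obtain r1 where r1: "\<forall>x\<in>K. \<forall>i<n. \<bar>x i\<bar> \<le> r1" by (rule compact_bounded_coord[OF assms(1)])
  obtain r2 where r2: "\<forall>x\<in>L. \<forall>i<n. \<bar>x i\<bar> \<le> r2" by (rule compact_bounded_coord[OF assms(2)])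
  have r: "\<forall>x\<in>K. \<forall>i<n. \<bar>x i\<bar> \<le> max r1 r2" "\<forall>x\<in>L. \<forall>i<n. \<bar>x i\<bar> \<le> max r1 r2"
    using r1 r2 by (meson le_max_iff_disj)+
  have "ennreal ((root n (voln n K) + root n (voln n L)) ^ n) \<le> emeasure (emeas n) M"
    using assms by (intro brunn_minkowski[OF _ _ _ r]) (auto simp: emeasure_emeas_compact compact_imp_borel)
  then have "(root n (voln n K) + root n (voln n L)) ^ n \<le> voln n M"
    using assms voln_nonneg by (simp add: emeasure_emeas_compact)
  then have "root n ((root n (voln n K) + root n (voln n L)) ^ n) \<le> root n (voln n M)"
    using assms(4) by (intro real_root_le_mono) auto
  then show ?thesis
    using assms by (simp add: real_root_pos2)
qed

lemma mink_sum_subset_Rn: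
  assumes "\<And>x i. x \<in> K \<Longrightarrow> n \<le> i \<Longrightarrow> x i = 0" "x \<in> mink_sum K t (unit_balln n)" "n \<le> i"
  shows "x i = 0"
  using assms by (auto simp: mink_sum_def mem_unit_balln)

lemma mink_sum_0 [simp]: "mink_sum K 0 (unit_balln n) = K"
  using zero_mem_unit_balln by (auto simp: mink_sum_def)

lemma compact_mink_sum:
  assumes "compact K"
  shows "compact (mink_sum K t (unit_balln n))"
proof -
  have "mink_sum K t (unit_balln n) = (\<lambda>p i. fst p i + t * snd p i) ` (K \<times> unit_balln n)"
  proof (intro equalityI subsetI)
    fix x assume "x \<in> mink_sum K t (unit_balln n)"
    then obtain a b where "a \<in> K" "b \<in> unit_balln n" "x = (\<lambda>i. a i + t * b i)"
      by (auto simp: mink_sum_def)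
    then show "x \<in> (\<lambda>p i. fst p i + t * snd p i) ` (K \<times> unit_balln n)"
      by (intro image_eqI[of _ _ "(a, b)"]) auto
  next
    fix x assume "x \<in> (\<lambda>p i. fst p i + t * snd p i) ` (K \<times> unit_balln n)"
    then obtain p where "p \<in> K \<times> unit_balln n" "x = (\<lambda>i. fst p i + t * snd p i)"
      by (rule imageE)
    then show "x \<in> mink_sum K t (unit_balln n)"
      by (cases p) (auto simp: mink_sum_def)
  qed
  moreover have "continuous_on (K \<times> unit_balln n) (\<lambda>p. fst p i + t * snd p i)" for i
  proof -
    have "continuous_on (K \<times> unit_balln n) (\<lambda>p. fst p i)" "continuous_on (K \<times> unit_balln n) (\<lambda>p. snd p i)"
      by (rule continuous_on_product_then_coordinatewise, intro continuous_intros)+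
    then show ?thesis by (intro continuous_intros)
  qed
  ultimately show ?thesis
    using assms by (auto intro!: compact_continuous_image continuous_on_coordinatewise_then_product
      compact_Times compact_unit_balln)
qed

text \<open>The cube with half-side \<open>1 / sqrt n\<close> is inscribed in the ball. Its side has
  the same order as the \<open>n\<close>-th root of the volume of the ball, so the isoperimetric
  constant keeps its order \<open>sqrt n\<close>.\<close>

lemma voln_unit_balln_ge: "n \<ge> 1 \<Longrightarrow> (2 / sqrt n) ^ n \<le> voln n (unit_balln n)"
proof -
  assume n: "n \<ge> 1"
  let ?r = "1 / sqrt n"
  let ?Q = "{x :: nat \<Rightarrow> real. \<forall>i<n. \<bar>x i\<bar> \<le> ?r}"
  have Q: "?Q \<in> sets borel" by measurable
  have "x \<in> unit_balln n" if "\<forall>i\<ge>n. x i = 0" "x \<in> ?Q" for x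
  proof -
    have "(\<Sum>i<n. (x i)\<^sup>2) \<le> (\<Sum>i<n. ?r\<^sup>2)"
    proof (intro sum_mono)
      fix i assume "i \<in> {..<n}"
      then have "\<bar>x i\<bar>\<^sup>2 \<le> ?r\<^sup>2" using that(2) by (intro power_mono) auto
      then show "(x i)\<^sup>2 \<le> ?r\<^sup>2" by simp
    qed
    also have "\<dots> = 1" using n by (simp add: power_divide)
    finally show ?thesis using that by (simp add: mem_unit_balln)
  qed
  then have "emeasure (emeas n) ?Q \<le> emeasure (emeas n) (unit_balln n)"
    using AE_emeas[of n] Q compact_imp_borel[OF compact_unit_balln]
    by (intro emeasure_mono_AE) (auto elim!: eventually_mono)
  then show ?thesis
    using voln_nonneg by (simp add: emeasure_emeas_box emeasure_emeas_compact compact_unit_balln)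
qed

section \<open>Bodies with an inscribed ball, and their surface area\<close>

text \<open>The interior point becomes an explicit ball \<open>p + r B\<close>: this form passes
  through halving, projecting and changing the basis, and it bounds Minkowski sums by
  dilates.\<close>

definition cbody :: "nat \<Rightarrow> (nat \<Rightarrow> real) set \<Rightarrow> bool" where
  "cbody n K \<longleftrightarrow> compact K \<and> (\<forall>x\<in>K. \<forall>i\<ge>n. x i = 0) \<and> convexn K \<and>
     (\<exists>p r. r > 0 \<and> (\<forall>b\<in>unit_balln n. (\<lambda>i. p i + r * b i) \<in> K))"

text \<open>A basic open set of the product topology constrains each coordinate separately. The
  first \<open>n\<close> constraints leave room for a ball, and the others hold because vectors of
  the ball vanish there.\<close>

lemma convex_body_imp_cbody:
  assumes "convex_body n K"
  shows "cbody n K"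
proof -
  have K: "compactin (Euclidean_space n) K" "convexn K" "Euclidean_space n interior_of K \<noteq> {}"
    using assms by (auto simp: convex_body_def)
  have "compact K" and sub: "\<forall>x\<in>K. \<forall>i\<ge>n. x i = 0"
    using K(1) by (auto simp: Euclidean_space_def compactin_subtopology euclidean_product_topology)
  obtain p where p: "p \<in> Euclidean_space n interior_of K" using K(3) by blast
  then obtain W where W: "open W" "p \<in> W" "W \<inter> {x. \<forall>i\<ge>n. x i = 0} \<subseteq> K" "\<forall>i\<ge>n. p i = 0"
    unfolding interior_of_def
    by (auto simp: Euclidean_space_def openin_subtopology euclidean_product_topology)
  have "openin (product_topology (\<lambda>_. euclideanreal) UNIV) W"
    using W(1) by (simp add: euclidean_product_topology)
  from product_topology_open_contains_basis[OF this W(2)] obtain X where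
    X: "p \<in> Pi\<^sub>E UNIV X" "\<And>i. open (X i)" "Pi\<^sub>E UNIV X \<subseteq> W" by auto
  have "\<exists>e>0. \<forall>y. \<bar>y - p i\<bar> < e \<longrightarrow> y \<in> X i" for i
    using X(1) X(2)[of i] by (auto simp: open_dist dist_real_def PiE_def Pi_def)
  then obtain e where e: "\<And>i. e i > 0" "\<And>i y. \<bar>y - p i\<bar> < e i \<Longrightarrow> y \<in> X i" by metis
  \<comment> \<open>The inserted 1 keeps the set nonempty when \<open>n = 0\<close>; halving makes
    \<open>r\<close> strictly smaller than each width.\<close>
  define r where "r = Min (insert 1 (e ` {..<n})) / 2"
  have r: "r > 0" "\<And>i. i < n \<Longrightarrow> r < e i"
  proof -
    have pos: "Min (insert 1 (e ` {..<n})) > 0" using e(1) by (subst Min_gr_iff) auto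
    then show "r > 0" by (simp add: r_def)
    fix i assume "i < n"
    then have "Min (insert 1 (e ` {..<n})) \<le> e i" by (intro Min_le) auto
    then show "r < e i" using pos unfolding r_def by linarith
  qed
  have "(\<lambda>i. p i + r * b i) \<in> K" if b: "b \<in> unit_balln n" for b
  proof -
    have "p i + r * b i \<in> X i" for i
    proof (cases "i < n")
      case True
      have "(b i)\<^sup>2 \<le> (\<Sum>i<n. (b i)\<^sup>2)" using True by (intro member_le_sum) auto
      then have "(b i)\<^sup>2 \<le> 1" using b by (simp add: mem_unit_balln)
      then have "\<bar>b i\<bar> \<le> 1" by (simp add: abs_square_le_1)
      then have "\<bar>r * b i\<bar> \<le> r" using mult_left_mono[of "\<bar>b i\<bar>" 1 r] r(1) by (simp add: abs_mult)
      then show ?thesis using r(2)[OF True] by (intro e(2)) simp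
    next
      case False
      then show ?thesis using b e(1)[of i] by (intro e(2)) (simp add: mem_unit_balln)
    qed
    then have "(\<lambda>i. p i + r * b i) \<in> W" using X(3) by auto
    then show ?thesis using W(3,4) b by (auto simp: mem_unit_balln)
  qed
  then show ?thesis
    unfolding cbody_def using \<open>compact K\<close> sub K(2) r(1) by blast
qed

lemma mem_mink_sumI: "a \<in> K \<Longrightarrow> b \<in> B \<Longrightarrow> (\<lambda>i. a i + t * b i) \<in> mink_sum K t B"
  by (auto simp: mink_sum_def)

lemma convexnD: "convexn A \<Longrightarrow> x \<in> A \<Longrightarrow> y \<in> A \<Longrightarrow> 0 \<le> t \<Longrightarrow> t \<le> 1 \<Longrightarrow> (\<lambda>i. (1 - t) * x i + t * y i) \<in> A"
  by (auto simp: convexn_def)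

lemma cbody_voln_pos:
  assumes "cbody n K"
  shows "voln n K > 0"
proof -
  obtain p r where r: "r > 0" "\<forall>b\<in>unit_balln n. (\<lambda>i. p i + r * b i) \<in> K"
    and K: "compact K" "\<forall>x\<in>K. \<forall>i\<ge>n. x i = 0"
    using assms by (auto simp: cbody_def)
  have p: "p i = 0" if "n \<le> i" for i
    using r(2) K(2) zero_mem_unit_balln[of n] that by fastforce
  have "0 < r ^ n * voln n (unit_balln n)"
  proof (cases "n = 0")
    case True
    have "emeasure (emeas 0) (unit_balln 0) = 1"
      using zero_mem_unit_balln[of 0] compact_imp_borel[OF compact_unit_balln] by (simp add: emeas_0)
    then show ?thesis using True by (simp add: emeasure_emeas_compact compact_unit_balln)
  next
    case False
    have "0 < (2 / sqrt n) ^ n" using False by simp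
    also have "\<dots> \<le> voln n (unit_balln n)" using False by (intro voln_unit_balln_ge) simp
    finally show ?thesis using r(1) by simp
  qed
  also have "\<dots> = voln n ((\<lambda>x i. r * x i + p i) ` unit_balln n)"
    using r(1) p by (intro voln_affine[symmetric] compact_unit_balln)
  also have "\<dots> \<le> voln n K"
    using r(2) K by (intro voln_mono compact_affine_image compact_unit_balln) (auto simp: add.commute)
  finally show ?thesis .
qed

text \<open>Since \<open>r B\<close> lies in \<open>K - p\<close>, convexity puts
  \<open>K + t B\<close> inside the dilate \<open>(1 + t / r) K\<close> translated by
  \<open>- (t / r) p\<close>.\<close>

lemma voln_mink_sum_le:
  assumes K: "compact K" "convexn K" and r: "r > 0" "\<forall>b\<in>unit_balln n. (\<lambda>i. p i + r * b i) \<in> K"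
    and p: "\<And>i. n \<le> i \<Longrightarrow> p i = 0" and t: "t \<ge> 0"
  shows "voln n (mink_sum K t (unit_balln n)) \<le> (1 + t / r) ^ n * voln n K"
proof -
  let ?s = "1 + t / r"
  have s: "?s > 0" using r(1) t by (simp add: add_pos_nonneg)
  have "mink_sum K t (unit_balln n) \<subseteq> (\<lambda>x i. ?s * x i + - (t / r) * p i) ` K"
  proof
    fix x assume "x \<in> mink_sum K t (unit_balln n)"
    then obtain a b where ab: "a \<in> K" "b \<in> unit_balln n" "x = (\<lambda>i. a i + t * b i)"
      by (auto simp: mink_sum_def)
    let ?l = "(t / r) / ?s"
    have l: "0 \<le> ?l" "?l \<le> 1" "1 - ?l = 1 / ?s" using r(1) t s by (auto simp: field_simps)
    have "(\<lambda>i. (1 - ?l) * a i + ?l * (p i + r * b i)) \<in> K"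
      using r(2) ab l by (intro convexnD[OF K(2)]) auto
    then show "x \<in> (\<lambda>x i. ?s * x i + - (t / r) * p i) ` K"
    proof (rule rev_image_eqI)
      show "x = (\<lambda>i. ?s * ((1 - ?l) * a i + ?l * (p i + r * b i)) + - (t / r) * p i)"
      proof
      fix i
      have "?s * ((1 - ?l) * a i + ?l * (p i + r * b i)) = (?s * (1 - ?l)) * a i + (?s * ?l) * (p i + r * b i)"
        by (simp only: distrib_left mult.assoc)
      also have "\<dots> = a i + t / r * (p i + r * b i)"
        unfolding l(3) using s by simp
      also have "\<dots> = a i + t * b i + t / r * p i"
        using r(1) by (simp add: field_simps)
      finally show "x i = ?s * ((1 - ?l) * a i + ?l * (p i + r * b i)) + - (t / r) * p i"
        unfolding ab(3) by simp
      qed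
    qed
  qed
  then have "voln n (mink_sum K t (unit_balln n)) \<le> voln n ((\<lambda>x i. ?s * x i + - (t / r) * p i) ` K)"
    by (intro voln_mono compact_mink_sum compact_affine_image K)
  also have "\<dots> = ?s ^ n * voln n K"
    using p s by (intro voln_affine K) auto
  finally show ?thesis .
qed

text \<open>By Brunn-Minkowski the \<open>n\<close>-th root of the volume of \<open>K + t B\<close> is concave in \<open>t\<close>, so its
  difference quotients at 0 are monotone and the limit defining the surface area exists.\<close>

lemma surface_area_limit:
  assumes "cbody n K" "n \<ge> 1"
  shows "((\<lambda>t. (voln n (mink_sum K t (unit_balln n)) - voln n K) / t) \<longlongrightarrow> surface_area n K) (at_right 0)"
    and "2 * sqrt n * root n (voln n K) ^ (n - 1) \<le> surface_area n K"
proof -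
  let ?B = "unit_balln n"
  obtain p r where r: "r > 0" "\<forall>b\<in>?B. (\<lambda>i. p i + r * b i) \<in> K"
    and K: "compact K" "\<forall>x\<in>K. \<forall>i\<ge>n. x i = 0" "convexn K"
    using assms by (auto simp: cbody_def)
  have p: "p i = 0" if "n \<le> i" for i
    using r(2) K(2) zero_mem_unit_balln[of n] that by fastforce
  define V where "V t = voln n (mink_sum K t ?B)" for t
  define \<phi> where "\<phi> t = root n (V t)" for t
  have V0: "V 0 = voln n K" by (simp add: V_def)
  have Vpos: "V t > 0" if "t \<ge> 0" for t
  proof -
    have "K \<subseteq> mink_sum K t ?B"
    proof
      fix x assume "x \<in> K"
      from mem_mink_sumI[OF this zero_mem_unit_balln, of t n] show "x \<in> mink_sum K t ?B" by simp
    qed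
    then have "voln n K \<le> V t" unfolding V_def by (intro voln_mono compact_mink_sum K)
    then show ?thesis using cbody_voln_pos[OF assms(1)] by linarith
  qed
  have \<phi>pos: "\<phi> t > 0" if "t \<ge> 0" for t using Vpos[OF that] assms(2) by (simp add: \<phi>_def)
  have \<phi>V: "\<phi> t ^ n = V t" if "t \<ge> 0" for t
    using Vpos[OF that] assms(2) by (simp add: \<phi>_def)
  define q where "q t = (\<phi> t - \<phi> 0) / t" for t
  have root_scale: "root n (c ^ n * v) = c * root n v" if "c \<ge> 0" for c v
    using that assms(2) by (simp add: real_root_mult real_root_pos2)
  have conc: "q t \<le> q s" if "0 < s" "s \<le> t" for s t
  proof (cases "s = t")
    case False
    define l where "l = s / t"
    have l: "0 < l" "l < 1" and st: "s = l * t" using that False by (auto simp: l_def)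
    \<comment> \<open>Convexity of \<open>K\<close> puts \<open>(1 - l) K + l (K + t B)\<close>
      inside \<open>K + s B\<close>, where \<open>s = l t\<close>; this is the concavity of
      \<open>\<phi>\<close> between 0 and \<open>t\<close>.\<close>
    have "root n (voln n ((\<lambda>x i. (1 - l) * x i) ` K)) + root n (voln n ((\<lambda>x i. l * x i) ` mink_sum K t ?B))
        \<le> root n (voln n (mink_sum K s ?B))"
    proof (rule brunn_minkowski_root)
      show "voln n ((\<lambda>x i. (1 - l) * x i) ` K) > 0" "voln n ((\<lambda>x i. l * x i) ` mink_sum K t ?B) > 0"
        using l Vpos[of 0] Vpos[of t] that voln_scale[OF K(1), of "1 - l" n]
          voln_scale[OF compact_mink_sum[OF K(1), of t n], of l n]
        by (simp_all add: V0 V_def)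
      fix x y assume "x \<in> (\<lambda>x i. (1 - l) * x i) ` K" "y \<in> (\<lambda>x i. l * x i) ` mink_sum K t ?B"
      then obtain a c b where a: "a \<in> K" "x = (\<lambda>i. (1 - l) * a i)" and c: "c \<in> K" "b \<in> ?B" "y = (\<lambda>i. l * (c i + t * b i))"
        by (auto simp: mink_sum_def)
      have "(\<lambda>i. (\<lambda>i. (1 - l) * a i + l * c i) i + s * b i) \<in> mink_sum K s ?B"
        using l a c by (intro mem_mink_sumI convexnD[OF K(3)]) auto
      moreover have "(\<lambda>i. x i + y i) = (\<lambda>i. (\<lambda>i. (1 - l) * a i + l * c i) i + s * b i)"
        unfolding a(2) c(3) st by (auto simp: algebra_simps)
      ultimately show "(\<lambda>i. x i + y i) \<in> mink_sum K s ?B" by simp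
    qed (use assms K in \<open>auto intro!: compact_scale_image compact_mink_sum\<close>)
    moreover have "root n (voln n ((\<lambda>x i. (1 - l) * x i) ` K)) = (1 - l) * \<phi> 0"
      using l voln_scale[OF K(1), of "1 - l" n] root_scale[of "1 - l"] by (simp add: \<phi>_def V0)
    moreover have "root n (voln n ((\<lambda>x i. l * x i) ` mink_sum K t ?B)) = l * \<phi> t"
      using l voln_scale[OF compact_mink_sum[OF K(1), of t n], of l n] root_scale[of l]
      by (simp add: \<phi>_def V_def)
    ultimately have "(1 - l) * \<phi> 0 + l * \<phi> t \<le> \<phi> s"
      by (simp add: \<phi>_def V_def)
    then have "l * (\<phi> t - \<phi> 0) \<le> \<phi> s - \<phi> 0" by (simp add: algebra_simps)
    then have "l * (\<phi> t - \<phi> 0) / s \<le> q s" using that unfolding q_def by (intro divide_right_mono) auto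
    moreover have "l * (\<phi> t - \<phi> 0) / s = q t" using l that by (simp add: q_def st)
    ultimately show ?thesis by simp
  qed simp
  have \<phi>upper: "\<phi> t \<le> \<phi> 0 + t * (\<phi> 0 / r)" if "t \<ge> 0" for t
  proof -
    have "\<phi> t \<le> root n ((1 + t / r) ^ n * V 0)"
      unfolding \<phi>_def V_def using assms(2) voln_mink_sum_le[OF K(1,3) r p that]
      by (intro real_root_le_mono) auto
    also have "\<dots> = (1 + t / r) * \<phi> 0"
      using r(1) that by (simp add: root_scale \<phi>_def)
    finally show ?thesis by (simp add: algebra_simps)
  qed
  \<comment> \<open>An upper bound for the quotients makes their supremum \<open>L\<close>
    finite.\<close>
  have qle: "q t \<le> \<phi> 0 / r" if "t > 0" for t
    using \<phi>upper[of t] that by (simp add: q_def field_simps)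
  let ?b = "root n (voln n ?B)"
  have Bpos: "voln n ?B > 0"
  proof -
    have "0 < (2 / sqrt n) ^ n" using assms(2) by simp
    then show ?thesis using voln_unit_balln_ge[OF assms(2)] by linarith
  qed
  \<comment> \<open>Brunn-Minkowski for \<open>K\<close> and \<open>t B\<close> bounds the slopes of
    \<open>\<phi>\<close> from below by the \<open>n\<close>-th root of the volume of the ball. The
    isoperimetric inequality comes from here.\<close>
  have bq: "?b \<le> q t" if "t > 0" for t
  proof -
    have "root n (voln n K) + root n (voln n ((\<lambda>x i. t * x i) ` ?B)) \<le> root n (voln n (mink_sum K t ?B))"
    proof (rule brunn_minkowski_root)
      show "voln n K > 0" by (rule cbody_voln_pos) fact
      show "voln n ((\<lambda>x i. t * x i) ` ?B) > 0"
        using Bpos that voln_scale[OF compact_unit_balln that, of n] by simp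
    qed (use assms K in \<open>auto intro!: compact_scale_image compact_mink_sum compact_unit_balln mem_mink_sumI\<close>)
    also have "root n (voln n ((\<lambda>x i. t * x i) ` ?B)) = t * ?b"
      using that voln_scale[OF compact_unit_balln that, of n] root_scale[of t] by simp
    finally have "\<phi> 0 + t * ?b \<le> \<phi> t" by (simp add: \<phi>_def V_def)
    then show ?thesis using that by (simp add: q_def field_simps)
  qed
  define L where "L = Sup (q ` {0<..})"
  have bdd: "bdd_above (q ` {0<..})" using qle by (intro bdd_aboveI2[where M = "\<phi> 0 / r"]) auto
  have qL: "q t \<le> L" if "t > 0" for t unfolding L_def using that bdd by (intro cSup_upper) auto
  have limq: "(q \<longlongrightarrow> L) (at_right 0)"
  proof (rule order_tendstoI)
    fix a assume "a < L"
    then obtain s where s: "s > 0" "a < q s"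
      unfolding L_def by (auto simp: less_cSup_iff[OF _ bdd])
    have "a < q t" if "0 < t" "t < s" for t using conc[of t s] that s by simp
    then show "eventually (\<lambda>t. a < q t) (at_right 0)"
      unfolding eventually_at_right_field using s(1) by blast
  next
    fix a assume "L < a"
    then have "q t < a" if "t > 0" for t using qL[OF that] by simp
    then show "eventually (\<lambda>t. q t < a) (at_right 0)"
      unfolding eventually_at_right_field by (intro exI[of _ 1]) auto
  qed
  have id0: "((\<lambda>t::real. t) \<longlongrightarrow> 0) (at_right 0)" by (rule tendsto_ident_at)
  have "((\<lambda>t. \<phi> 0 + t * q t) \<longlongrightarrow> \<phi> 0 + 0 * L) (at_right 0)"
    by (intro tendsto_intros limq id0)
  moreover have "eventually (\<lambda>t. \<phi> 0 + t * q t = \<phi> t) (at_right 0)"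
    unfolding eventually_at_right_field by (intro exI[of _ 1]) (auto simp: q_def)
  ultimately have lim\<phi>: "(\<phi> \<longlongrightarrow> \<phi> 0) (at_right 0)"
    using Lim_transform_eventually by fastforce
  \<comment> \<open>From \<open>\<phi>\<close> back to the volume \<open>\<phi> ^ n\<close>:
    factoring the difference of \<open>n\<close>-th powers makes the quotient of \<open>V\<close>
    equal to \<open>q t\<close> times a sum tending to
    \<open>n * \<phi> 0 ^ (n - 1)\<close>.\<close>
  have "((\<lambda>t. q t * (\<Sum>i<n. \<phi> 0 ^ (n - Suc i) * \<phi> t ^ i)) \<longlongrightarrow> L * (\<Sum>i<n. \<phi> 0 ^ (n - Suc i) * \<phi> 0 ^ i)) (at_right 0)"
    by (intro tendsto_intros limq lim\<phi>)
  also have "(\<Sum>i<n. \<phi> 0 ^ (n - Suc i) * \<phi> 0 ^ i) = (\<Sum>i<n. \<phi> 0 ^ (n - 1))"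
    by (intro sum.cong) (auto simp: power_add[symmetric])
  finally have "((\<lambda>t. q t * (\<Sum>i<n. \<phi> 0 ^ (n - Suc i) * \<phi> t ^ i)) \<longlongrightarrow> L * (n * \<phi> 0 ^ (n - 1))) (at_right 0)"
    by simp
  moreover have "eventually (\<lambda>t. q t * (\<Sum>i<n. \<phi> 0 ^ (n - Suc i) * \<phi> t ^ i) = (V t - V 0) / t) (at_right 0)"
  proof -
    have "q t * (\<Sum>i<n. \<phi> 0 ^ (n - Suc i) * \<phi> t ^ i) = (V t - V 0) / t" if "t > 0" for t
    proof -
      have "V t - V 0 = \<phi> t ^ n - \<phi> 0 ^ n" using that by (simp add: \<phi>V)
      also have "\<dots> = (\<phi> t - \<phi> 0) * (\<Sum>i<n. \<phi> 0 ^ (n - Suc i) * \<phi> t ^ i)"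
        by (rule power_diff_sumr2)
      finally show ?thesis by (simp add: q_def)
    qed
    then show ?thesis
      unfolding eventually_at_right_field by (intro exI[of _ 1]) auto
  qed
  ultimately have lim: "((\<lambda>t. (V t - V 0) / t) \<longlongrightarrow> L * (n * \<phi> 0 ^ (n - 1))) (at_right 0)"
    by (rule Lim_transform_eventually)
  have S: "surface_area n K = L * (n * \<phi> 0 ^ (n - 1))"
    unfolding surface_area_def using lim
    by (intro tendsto_Lim) (auto simp: V_def trivial_limit_at_right_real)
  show "((\<lambda>t. (voln n (mink_sum K t ?B) - voln n K) / t) \<longlongrightarrow> surface_area n K) (at_right 0)"
    using lim by (simp add: S V_def)
  \<comment> \<open>The side of the inscribed cube; multiplied by the factor \<open>n\<close> of the
    derivative it becomes \<open>2 * sqrt n\<close>.\<close>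
  have "2 / sqrt n \<le> ?b"
  proof -
    have "root n ((2 / sqrt n) ^ n) \<le> ?b"
      using assms(2) voln_unit_balln_ge[OF assms(2)] by (intro real_root_le_mono) auto
    then show ?thesis using assms(2) by (simp add: real_root_pos2)
  qed
  also have "?b \<le> L" using bq[of 1] qL[of 1] by simp
  finally have "2 / sqrt n * (n * \<phi> 0 ^ (n - 1)) \<le> L * (n * \<phi> 0 ^ (n - 1))"
    using \<phi>pos[of 0] by (intro mult_right_mono) auto
  moreover have "2 / sqrt n * (n * \<phi> 0 ^ (n - 1)) = 2 * sqrt n * \<phi> 0 ^ (n - 1)"
    using assms(2) by (simp add: field_simps)
  ultimately show "2 * sqrt n * root n (voln n K) ^ (n - 1) \<le> surface_area n K"
    by (simp add: S \<phi>_def V_def)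
qed

section \<open>Halving a body in a coordinate direction\<close>

definition halve :: "nat \<Rightarrow> (nat \<Rightarrow> real) \<Rightarrow> nat \<Rightarrow> real" where
  "halve m x = x(m := x m / 2)"

text \<open>Orthogonal projection along the last axis of dimension \<open>Suc m\<close>. Setting the
  entry to 0 makes the image a body of dimension \<open>m\<close> within the same type.\<close>

definition forget :: "nat \<Rightarrow> (nat \<Rightarrow> real) \<Rightarrow> nat \<Rightarrow> real" where
  "forget m x = x(m := 0)"

lemma continuous_coords:
  fixes f :: "nat \<Rightarrow> real \<Rightarrow> real"
  assumes "\<And>i. continuous_on UNIV (f i)"
  shows "continuous_on K (\<lambda>x i. f i (x i))"
proof (rule continuous_on_coordinatewise_then_product)
  fix i
  have "continuous_on K (\<lambda>x. x i)"
    by (rule continuous_on_subset[OF continuous_on_product_coordinates]) simp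
  then show "continuous_on K (\<lambda>x. f i (x i))"
    by (rule continuous_on_compose2[OF assms]) simp
qed

lemma halve_alt: "halve m = (\<lambda>x i. if i = m then x i / 2 else x i)"
  and forget_alt: "forget m = (\<lambda>x i. if i = m then 0 else x i)"
  by (auto simp: halve_def forget_def fun_eq_iff)

lemma compact_halve: "compact K \<Longrightarrow> compact (halve m ` K)"
proof (rule compact_continuous_image)
  have "continuous_on K (\<lambda>x i. (\<lambda>i z. if i = m then z / 2 else z) i (x i))"
  proof (rule continuous_coords)
    show "continuous_on UNIV (\<lambda>z::real. if i = m then z / 2 else z)" for i
      by (cases "i = m") (auto intro!: continuous_intros)
  qed
  then show "continuous_on K (halve m)" by (simp add: halve_alt)
qed

lemma compact_forget: "compact K \<Longrightarrow> compact (forget m ` K)"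
proof (rule compact_continuous_image)
  have "continuous_on K (\<lambda>x i. (\<lambda>i z. if i = m then 0 else z) i (x i))"
  proof (rule continuous_coords)
    show "continuous_on UNIV (\<lambda>z::real. if i = m then 0 else z)" for i
      by (cases "i = m") (auto intro!: continuous_intros)
  qed
  then show "continuous_on K (forget m)" by (simp add: forget_alt)
qed

lemma unit_balln_Suc:
  assumes "b \<in> unit_balln m"
  shows "b \<in> unit_balln (Suc m)" "b m = 0"
  using assms by (auto simp: mem_unit_balln)

lemma forget_unit_balln:
  assumes "b \<in> unit_balln (Suc m)"
  shows "forget m b \<in> unit_balln m" "\<bar>b m\<bar> \<le> 1"
proof -
  have s: "(\<Sum>i<m. (b i)\<^sup>2) + (b m)\<^sup>2 \<le> 1" and z: "\<forall>i\<ge>Suc m. b i = 0"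
    using assms by (auto simp: mem_unit_balln)
  have "(\<Sum>i<m. (forget m b i)\<^sup>2) = (\<Sum>i<m. (b i)\<^sup>2)"
    by (intro sum.cong) (auto simp: forget_def)
  moreover have "(\<Sum>i<m. (b i)\<^sup>2) \<le> 1" using s zero_le_power2[of "b m"] by linarith
  moreover have "\<forall>i\<ge>m. forget m b i = 0" using z by (simp add: forget_def Suc_le_eq)
  ultimately show "forget m b \<in> unit_balln m" by (simp add: mem_unit_balln)
  have "(b m)\<^sup>2 \<le> 1" using s sum_nonneg[of "{..<m}" "\<lambda>i. (b i)\<^sup>2"] by simp
  then show "\<bar>b m\<bar> \<le> 1" by (simp add: abs_square_le_1)
qed

lemma cbodyE:
  assumes "cbody n K"
  obtains p r where "r > 0" "\<forall>b\<in>unit_balln n. (\<lambda>i. p i + r * b i) \<in> K" "p \<in> K"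
proof -
  obtain p r where r: "r > 0" "\<forall>b\<in>unit_balln n. (\<lambda>i. p i + r * b i) \<in> K"
    using assms by (auto simp: cbody_def)
  have "p \<in> K" using r(2)[rule_format, OF zero_mem_unit_balln] by simp
  then show ?thesis using that r by blast
qed

lemma cbody_halve:
  assumes "cbody (Suc m) K"
  shows "cbody (Suc m) (halve m ` K)"
proof -
  obtain p r where r: "r > 0" "\<forall>b\<in>unit_balln (Suc m). (\<lambda>i. p i + r * b i) \<in> K"
    by (rule cbodyE[OF assms])
  have K: "compact K" "\<forall>x\<in>K. \<forall>i\<ge>Suc m. x i = 0" "convexn K" using assms by (auto simp: cbody_def)
  have "convexn (halve m ` K)"
    unfolding convexn_def
  proof clarify
    fix x y and t :: real assume a: "x \<in> K" "y \<in> K" "t \<in> {0..1}"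
    have "(\<lambda>i. (1 - t) * halve m x i + t * halve m y i) = halve m (\<lambda>i. (1 - t) * x i + t * y i)"
      by (auto simp: halve_def field_simps)
    then show "(\<lambda>i. (1 - t) * halve m x i + t * halve m y i) \<in> halve m ` K"
      using a convexnD[OF K(3) a(1,2), of t] by auto
  qed
  moreover have "(\<lambda>i. halve m p i + r / 2 * b i) \<in> halve m ` K" if b: "b \<in> unit_balln (Suc m)" for b
  proof -
    \<comment> \<open>The vector whose halving is \<open>b / 2\<close>; none of its entries exceeds
      that of \<open>b\<close> in absolute value, so it stays in the ball. This is why radius
      \<open>r / 2\<close> survives halving.\<close>
    let ?c = "\<lambda>i. if i = m then b i else b i / 2"
    have "(\<Sum>i<Suc m. (?c i)\<^sup>2) \<le> (\<Sum>i<Suc m. (b i)\<^sup>2)"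
      by (intro sum_mono) (auto simp: power_divide)
    then have "?c \<in> unit_balln (Suc m)" using b by (auto simp: mem_unit_balln)
    from r(2)[rule_format, OF this] have "(\<lambda>i. p i + r * ?c i) \<in> K" .
    moreover have "(\<lambda>i. halve m p i + r / 2 * b i) = halve m (\<lambda>i. p i + r * ?c i)"
      by (auto simp: halve_def field_simps)
    ultimately show ?thesis by simp
  qed
  moreover have "\<forall>x\<in>halve m ` K. \<forall>i\<ge>Suc m. x i = 0" using K(2) by (auto simp: halve_def)
  ultimately show ?thesis
    unfolding cbody_def using compact_halve[OF K(1)] r(1) half_gt_zero by blast
qed

lemma cbody_forget:
  assumes "cbody (Suc m) K"
  shows "cbody m (forget m ` K)"
proof -
  obtain p r where r: "r > 0" "\<forall>b\<in>unit_balln (Suc m). (\<lambda>i. p i + r * b i) \<in> K"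
    by (rule cbodyE[OF assms])
  have K: "compact K" "\<forall>x\<in>K. \<forall>i\<ge>Suc m. x i = 0" "convexn K" using assms by (auto simp: cbody_def)
  have "convexn (forget m ` K)"
    unfolding convexn_def
  proof clarify
    fix x y and t :: real assume a: "x \<in> K" "y \<in> K" "t \<in> {0..1}"
    have "(\<lambda>i. (1 - t) * forget m x i + t * forget m y i) = forget m (\<lambda>i. (1 - t) * x i + t * y i)"
      by (auto simp: forget_def)
    then show "(\<lambda>i. (1 - t) * forget m x i + t * forget m y i) \<in> forget m ` K"
      using a convexnD[OF K(3) a(1,2), of t] by auto
  qed
  moreover have "(\<lambda>i. forget m p i + r * b i) \<in> forget m ` K" if b: "b \<in> unit_balln m" for b
  proof -
    have "(\<lambda>i. p i + r * b i) \<in> K" using r(2) unit_balln_Suc(1)[OF b] by blast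
    moreover have "(\<lambda>i. forget m p i + r * b i) = forget m (\<lambda>i. p i + r * b i)"
      using unit_balln_Suc(2)[OF b] by (auto simp: forget_def)
    ultimately show ?thesis by simp
  qed
  moreover have "\<forall>x\<in>forget m ` K. \<forall>i\<ge>m. x i = 0"
    using K(2) by (auto simp: forget_def Suc_le_eq)
  ultimately show ?thesis
    unfolding cbody_def using compact_forget[OF K(1)] r(1) by blast
qed

section \<open>Volume and surface area of the halved body\<close>

lemma convexn_mink_sum:
  assumes "convexn K"
  shows "convexn (mink_sum K t (unit_balln n))"
  unfolding convexn_def
proof (intro ballI)
  fix x y and s :: real assume "x \<in> mink_sum K t (unit_balln n)" "y \<in> mink_sum K t (unit_balln n)" and s: "s \<in> {0..1}"
  then obtain a b c d where ab: "a \<in> K" "b \<in> unit_balln n" "x = (\<lambda>i. a i + t * b i)"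
    and cd: "c \<in> K" "d \<in> unit_balln n" "y = (\<lambda>i. c i + t * d i)"
    unfolding mink_sum_def by blast
  have "(\<lambda>i. (\<lambda>i. (1 - s) * a i + s * c i) i + t * (\<lambda>i. (1 - s) * b i + s * d i) i) \<in> mink_sum K t (unit_balln n)"
    using ab cd s by (intro mem_mink_sumI convexnD[OF assms] convexnD[OF convexn_unit_balln]) auto
  moreover have "(\<lambda>i. (1 - s) * x i + s * y i) = (\<lambda>i. (\<lambda>i. (1 - s) * a i + s * c i) i + t * (\<lambda>i. (1 - s) * b i + s * d i) i)"
    unfolding ab cd by (auto simp: algebra_simps)
  ultimately show "(\<lambda>i. (1 - s) * x i + s * y i) \<in> mink_sum K t (unit_balln n)" by simp
qed

text \<open>The slice of the halved body at height \<open>z\<close> is the slice of \<open>K\<close>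
  at height \<open>2 z\<close>.\<close>

lemma voln_halve:
  assumes "compact K"
  shows "voln (Suc m) (halve m ` K) = voln (Suc m) K / 2"
proof -
  have sec: "{x. x(m := z) \<in> halve m ` K} = {x. x(m := 2 * z) \<in> K}" for z
  proof (intro equalityI subsetI CollectI)
    fix x assume "x \<in> {x. x(m := z) \<in> halve m ` K}"
    then obtain y where y: "y \<in> K" "x(m := z) = y(m := y m / 2)" by (auto simp: halve_def)
    then have "z = y m / 2" "\<And>i. i \<noteq> m \<Longrightarrow> x i = y i" by (metis fun_upd_same, metis fun_upd_other)
    then have "x(m := 2 * z) = y" by auto
    then show "x(m := 2 * z) \<in> K" using y by simp
  next
    fix x assume x: "x \<in> {x. x(m := 2 * z) \<in> K}"
    have "x(m := z) = halve m (x(m := 2 * z))" by (auto simp: halve_def)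
    then show "x(m := z) \<in> halve m ` K" using x by blast
  qed
  have "emeasure (emeas (Suc m)) K = (\<integral>\<^sup>+z. emeasure (emeas m) {x. x(m := z) \<in> K} \<partial>lborel)"
    by (rule emeasure_emeas_Suc(2)[OF compact_imp_borel[OF assms]])
  also have "\<dots> = ennreal 2 * (\<integral>\<^sup>+z. emeasure (emeas m) {x. x(m := 2 * z) \<in> K} \<partial>lborel)"
    using nn_integral_real_affine[OF borel_measurable_emeas_section[OF compact_imp_borel[OF assms], of m], of 2 0]
    by simp
  also have "(\<integral>\<^sup>+z. emeasure (emeas m) {x. x(m := 2 * z) \<in> K} \<partial>lborel) = emeasure (emeas (Suc m)) (halve m ` K)"
    unfolding sec[symmetric]
    by (rule emeasure_emeas_Suc(2)[OF compact_imp_borel[OF compact_halve[OF assms]], symmetric])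
  finally have "voln (Suc m) K = 2 * voln (Suc m) (halve m ` K)"
    using voln_nonneg assms compact_halve[OF assms] by (simp add: emeasure_emeas_compact ennreal_mult[symmetric] del: ennreal_numeral)
  then show ?thesis by simp
qed

lemma compact_section:
  fixes A :: "(nat \<Rightarrow> real) set"
  assumes "compact A"
  shows "compact {z. (x(m := z)) \<in> A}"
proof -
  obtain r where r: "\<forall>y\<in>A. \<forall>i<Suc m. \<bar>y i\<bar> \<le> r" by (rule compact_bounded_coord[OF assms])
  have "continuous_on UNIV (\<lambda>z. x(m := z))"
  proof (rule continuous_on_coordinatewise_then_product)
    show "continuous_on UNIV (\<lambda>z. (x(m := z)) i)" for i
      by (cases "i = m") (auto intro: continuous_intros)
  qed
  then have "closed ((\<lambda>z. x(m := z)) -` A)"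
    using compact_imp_closed[OF assms] by (simp add: continuous_closed_vimage continuous_on_eq_continuous_at)
  moreover have "{z. x(m := z) \<in> A} \<subseteq> {-r..r}"
    using r by (auto simp: abs_le_iff) (metis fun_upd_same lessI minus_le_iff, metis fun_upd_same lessI)
  ultimately show ?thesis
    by (auto simp: compact_eq_bounded_closed vimage_def intro: bounded_subset[OF bounded_closed_interval])
qed

text \<open>A point of the left fibre over \<open>x\<close> has height
  \<open>a m / 2 + t * b m\<close>. Over the same \<open>x\<close>, the sum \<open>K + t B\<close>
  contains the height \<open>a m + t * b m\<close>, whose half differs from the former by at most
  \<open>t / 2\<close>. So the left fibre lies within \<open>t / 2\<close> of half the right fibre,
  which is an interval, and its length grows by at most \<open>t\<close>. If the left fibre is
  nonempty, then \<open>x\<close> lies in the projection of \<open>K\<close> enlarged by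
  \<open>t B\<close>, hence the indicator.\<close>

lemma emeasure_section_halve_sum:
  assumes K: "compact K" "convexn K" and x: "\<forall>i\<ge>m. x i = 0" and t: "t \<ge> 0"
  shows "emeasure lborel {z. x(m := z) \<in> mink_sum (halve m ` K) t (unit_balln (Suc m))}
      \<le> ennreal (1/2) * emeasure lborel {z. x(m := z) \<in> mink_sum K t (unit_balln (Suc m))}
        + ennreal t * indicator (mink_sum (forget m ` K) t (unit_balln m)) x"
    (is "emeasure lborel ?F \<le> ennreal (1/2) * emeasure lborel ?G + ennreal t * indicator ?Q x")
proof (cases "?F = {}")
  case False
  have F: "x \<in> ?Q \<and> (\<exists>w\<in>?G. \<bar>z - w / 2\<bar> \<le> t / 2)" if "z \<in> ?F" for z
  proof
    from that obtain a b where ab: "a \<in> K" "b \<in> unit_balln (Suc m)" "x(m := z) = (\<lambda>i. halve m a i + t * b i)"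
      by (auto simp: mink_sum_def)
    have z: "z = a m / 2 + t * b m" using fun_cong[OF ab(3), of m] by (simp add: halve_def)
    have xi: "x i = a i + t * b i" if "i \<noteq> m" for i
      using fun_cong[OF ab(3), of i] that by (simp add: halve_def)
    have "x = (\<lambda>i. forget m a i + t * forget m b i)"
      using xi x by (auto simp: forget_def)
    then show "x \<in> ?Q"
      using mem_mink_sumI[OF imageI[OF ab(1), of "forget m"] forget_unit_balln(1)[OF ab(2)]] by metis
    have "x(m := a m + t * b m) = (\<lambda>i. a i + t * b i)"
      using xi by auto
    then have "a m + t * b m \<in> ?G"
      using mem_mink_sumI[OF ab(1,2), of t] by simp
    moreover have "\<bar>z - (a m + t * b m) / 2\<bar> \<le> t / 2"
    proof -
      have "z - (a m + t * b m) / 2 = t * b m / 2" unfolding z by (simp add: field_simps)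
      moreover have "\<bar>t * b m\<bar> \<le> t"
        using mult_left_mono[OF forget_unit_balln(2)[OF ab(2)] t] t by (simp add: abs_mult)
      ultimately show ?thesis by linarith
    qed
    ultimately show "\<exists>w\<in>?G. \<bar>z - w / 2\<bar> \<le> t / 2" by blast
  qed
  have xQ: "x \<in> ?Q" and Gne: "?G \<noteq> {}" using False F by blast+
  have Gc: "compact ?G" by (intro compact_section compact_mink_sum K)
  define \<alpha> \<beta> where "\<alpha> = Inf ?G" and "\<beta> = Sup ?G"
  have bnd: "bdd_below ?G" "bdd_above ?G"
    using compact_imp_bounded[OF Gc] by (auto intro: bounded_imp_bdd_below bounded_imp_bdd_above)
  have ab: "\<alpha> \<in> ?G" "\<beta> \<in> ?G"
    unfolding \<alpha>_def \<beta>_def using compact_imp_closed[OF Gc] Gne bnd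
    by (metis closed_contains_Inf, metis closed_contains_Sup)
  have w: "\<alpha> \<le> w" "w \<le> \<beta>" if "w \<in> ?G" for w
    unfolding \<alpha>_def \<beta>_def using that bnd by (auto intro: cInf_lower cSup_upper)
  have le: "\<alpha> \<le> \<beta>" using w(1)[OF ab(2)] .
  \<comment> \<open>By convexity the fibre fills the segment between its extreme points, so
    \<open>\<beta> - \<alpha>\<close> is at most its length.\<close>
  have "{\<alpha>..\<beta>} \<subseteq> ?G"
  proof
    fix w assume w': "w \<in> {\<alpha>..\<beta>}"
    show "w \<in> ?G"
    proof (cases "\<alpha> = \<beta>")
      case True
      then show ?thesis using w' ab(1) by simp
    next
      case False
      let ?s = "(w - \<alpha>) / (\<beta> - \<alpha>)"
      have s: "0 \<le> ?s" "?s \<le> 1" using w' False by auto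
      have "(\<lambda>i. (1 - ?s) * (x(m := \<alpha>)) i + ?s * (x(m := \<beta>)) i) \<in> mink_sum K t (unit_balln (Suc m))"
        using ab s by (intro convexnD[OF convexn_mink_sum[OF K(2)]]) (simp_all del: fun_upd_apply)
      moreover have "(1 - ?s) * \<alpha> + ?s * \<beta> = \<alpha> + ?s * (\<beta> - \<alpha>)" by (simp only: algebra_simps)
      then have "(1 - ?s) * \<alpha> + ?s * \<beta> = w" using False by simp
      then have "(\<lambda>i. (1 - ?s) * (x(m := \<alpha>)) i + ?s * (x(m := \<beta>)) i) = x(m := w)"
        by (intro ext) (simp add: algebra_simps)
      ultimately show ?thesis by simp
    qed
  qed
  then have "emeasure lborel {\<alpha>..\<beta>} \<le> emeasure lborel ?G"
    using borel_compact[OF Gc] by (intro emeasure_mono) auto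
  then have G: "ennreal (\<beta> - \<alpha>) \<le> emeasure lborel ?G" using le by simp
  have "?F \<subseteq> {\<alpha> / 2 - t / 2..\<beta> / 2 + t / 2}"
  proof
    fix z assume "z \<in> ?F"
    then obtain v where v: "v \<in> ?G" "\<bar>z - v / 2\<bar> \<le> t / 2" using F by blast
    have "\<alpha> / 2 - t / 2 \<le> z" "z \<le> \<beta> / 2 + t / 2" using w[OF v(1)] v(2) by linarith+
    then show "z \<in> {\<alpha> / 2 - t / 2..\<beta> / 2 + t / 2}" by simp
  qed
  then have "emeasure lborel ?F \<le> emeasure lborel {\<alpha> / 2 - t / 2..\<beta> / 2 + t / 2}"
    by (intro emeasure_mono) auto
  also have "\<dots> = ennreal ((\<beta> - \<alpha>) / 2 + t)"
    using le t by (simp add: field_simps)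
  also have "\<dots> = ennreal (1/2) * ennreal (\<beta> - \<alpha>) + ennreal t"
    using le t by (subst ennreal_mult[symmetric], simp, simp, subst ennreal_plus[symmetric]) auto
  also have "\<dots> \<le> ennreal (1/2) * emeasure lborel ?G + ennreal t * indicator ?Q x"
    using G xQ by (intro add_mono mult_left_mono) auto
  finally show ?thesis .
qed simp

lemma voln_halve_sum_le:
  assumes K: "compact K" "convexn K" and t: "t \<ge> 0"
  shows "voln (Suc m) (mink_sum (halve m ` K) t (unit_balln (Suc m)))
     \<le> voln (Suc m) (mink_sum K t (unit_balln (Suc m))) / 2 + t * voln m (mink_sum (forget m ` K) t (unit_balln m))"
proof -
  let ?A = "mink_sum (halve m ` K) t (unit_balln (Suc m))" and ?C = "mink_sum K t (unit_balln (Suc m))"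
    and ?Q = "mink_sum (forget m ` K) t (unit_balln m)"
  have c: "compact ?A" "compact ?C" "compact ?Q"
    by (intro compact_mink_sum compact_halve compact_forget K)+
  have mC: "(\<lambda>x. emeasure lborel {z. x(m := z) \<in> ?C}) \<in> borel_measurable borel"
  proof -
    have "(\<lambda>p. (fst p)(m := snd p)) \<in> borel_measurable ((borel :: (nat \<Rightarrow> real) measure) \<Otimes>\<^sub>M (lborel :: real measure))"
      by (rule borel_measurable_coordI) (auto simp: fun_upd_def dest: borel_measurable_coord_comp)
    then have "(\<lambda>p. indicator ?C ((fst p)(m := snd p)) :: ennreal) \<in> borel_measurable (borel \<Otimes>\<^sub>M lborel)"
      by (rule measurable_compose) (use compact_imp_borel[OF c(2)] in simp)
    then have "(\<lambda>x. \<integral>\<^sup>+z. indicator ?C (x(m := z)) \<partial>lborel) \<in> borel_measurable borel"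
      by (intro lborel.borel_measurable_nn_integral) (simp add: split_beta)
    moreover have "(\<integral>\<^sup>+z. indicator ?C (x(m := z)) \<partial>lborel) = emeasure lborel {z. x(m := z) \<in> ?C}" for x
    proof -
      have "(\<integral>\<^sup>+z. indicator ?C (x(m := z)) \<partial>lborel) = (\<integral>\<^sup>+z. indicator {z. x(m := z) \<in> ?C} z \<partial>lborel)"
        by (intro nn_integral_cong) (auto split: split_indicator)
      also have "\<dots> = emeasure lborel {z. x(m := z) \<in> ?C}"
        using borel_compact[OF compact_section[OF c(2)]] by (intro nn_integral_indicator) simp
      finally show ?thesis .
    qed
    ultimately show ?thesis by simp
  qed
  have "emeasure (emeas (Suc m)) ?A = (\<integral>\<^sup>+x. emeasure lborel {z. x(m := z) \<in> ?A} \<partial>emeas m)"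
    by (rule emeasure_emeas_Suc(1)[OF compact_imp_borel[OF c(1)]])
  \<comment> \<open>The fibre comparison assumes that \<open>x\<close> vanishes from index
    \<open>m\<close> on, which holds almost everywhere.\<close>
  also have "\<dots> \<le> (\<integral>\<^sup>+x. ennreal (1/2) * emeasure lborel {z. x(m := z) \<in> ?C} + ennreal t * indicator ?Q x \<partial>emeas m)"
    by (rule nn_integral_mono_AE, use AE_emeas[of m] in eventually_elim)
      (rule emeasure_section_halve_sum[OF K _ t])
  also have "\<dots> = ennreal (1/2) * (\<integral>\<^sup>+x. emeasure lborel {z. x(m := z) \<in> ?C} \<partial>emeas m) + ennreal t * emeasure (emeas m) ?Q"
    using mC compact_imp_borel[OF c(3)]
    by (subst nn_integral_add) (auto simp: nn_integral_cmult nn_integral_cmult_indicator)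
  also have "(\<integral>\<^sup>+x. emeasure lborel {z. x(m := z) \<in> ?C} \<partial>emeas m) = emeasure (emeas (Suc m)) ?C"
    by (rule emeasure_emeas_Suc(1)[OF compact_imp_borel[OF c(2)], symmetric])
  finally have "ennreal (voln (Suc m) ?A) \<le> ennreal (1/2) * ennreal (voln (Suc m) ?C) + ennreal t * ennreal (voln m ?Q)"
    unfolding emeasure_emeas_compact[OF c(1)] emeasure_emeas_compact[OF c(2)] emeasure_emeas_compact[OF c(3)] .
  also have "\<dots> = ennreal (1/2 * voln (Suc m) ?C + t * voln m ?Q)"
    using ennreal_mult[of "1/2" "voln (Suc m) ?C"] ennreal_mult[of t "voln m ?Q"]
      ennreal_plus[of "1/2 * voln (Suc m) ?C" "t * voln m ?Q"] t voln_nonneg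
    by simp
  finally show ?thesis
    using t voln_nonneg by (subst (asm) ennreal_le_iff) auto
qed

text \<open>After subtraction of the volumes and division by \<open>t\<close>, the last term of the
  volume estimate is \<open>?W t\<close>, which must tend to the volume of the projection. Writing
  it as \<open>?W 0 + t * ?qW t\<close> reduces this to the convergence of \<open>?qW\<close>,
  available in dimension \<open>m\<close> because \<open>m \<ge> 1\<close>.\<close>

lemma surface_area_halve_le:
  assumes K: "cbody (Suc m) K" and m: "m \<ge> 1"
  shows "surface_area (Suc m) (halve m ` K) \<le> surface_area (Suc m) K / 2 + voln m (forget m ` K)"
proof -
  let ?W = "\<lambda>t. voln m (mink_sum (forget m ` K) t (unit_balln m))"
  let ?qW = "\<lambda>t. (?W t - voln m (forget m ` K)) / t"
  let ?qK = "\<lambda>t. (voln (Suc m) (mink_sum K t (unit_balln (Suc m))) - voln (Suc m) K) / t"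
  have cK: "compact K" "convexn K" using K by (auto simp: cbody_def)
  have id0: "((\<lambda>t::real. t) \<longlongrightarrow> 0) (at_right 0)" by (rule tendsto_ident_at)
  have "((\<lambda>t. ?qK t / 2 + (voln m (forget m ` K) + t * ?qW t)) \<longlongrightarrow>
      surface_area (Suc m) K / 2 + (voln m (forget m ` K) + 0 * surface_area m (forget m ` K))) (at_right 0)"
    using K m by (intro tendsto_intros id0 surface_area_limit cbody_forget) auto
  moreover have "((\<lambda>t. (voln (Suc m) (mink_sum (halve m ` K) t (unit_balln (Suc m))) - voln (Suc m) (halve m ` K)) / t)
      \<longlongrightarrow> surface_area (Suc m) (halve m ` K)) (at_right 0)"
    by (intro surface_area_limit cbody_halve K) simp
  moreover have "eventually (\<lambda>t. (voln (Suc m) (mink_sum (halve m ` K) t (unit_balln (Suc m))) - voln (Suc m) (halve m ` K)) / t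
      \<le> ?qK t / 2 + (voln m (forget m ` K) + t * ?qW t)) (at_right 0)"
    unfolding eventually_at_right_field
  proof (intro exI[of _ 1] conjI allI impI)
    fix t :: real assume t: "0 < t"
    show "(voln (Suc m) (mink_sum (halve m ` K) t (unit_balln (Suc m))) - voln (Suc m) (halve m ` K)) / t
      \<le> ?qK t / 2 + (voln m (forget m ` K) + t * ?qW t)"
      using voln_halve_sum_le[OF cK, of t m] t unfolding voln_halve[OF cK(1)]
      by (simp add: field_simps)
  qed simp
  ultimately show ?thesis
    by (intro tendsto_le[OF trivial_limit_at_right_real]) auto
qed

section \<open>Homogeneity, and volume from a long chord\<close>

text \<open>\<open>c K + t B\<close> equals \<open>c (K + (t / c) B)\<close>: volume contributes
  \<open>c ^ n\<close>, and rescaling the parameter takes one factor \<open>c\<close> back.\<close>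

lemma surface_area_scale:
  assumes "cbody n K" "n \<ge> 1" "c > 0"
  shows "surface_area n ((\<lambda>x i. c * x i) ` K) = c ^ (n - 1) * surface_area n K"
proof -
  let ?B = "unit_balln n"
  have K: "compact K" using assms by (simp add: cbody_def)
  have "filterlim (\<lambda>t::real. t / c) (at_right 0) (at_right 0)"
    unfolding filterlim_at
    using assms(3) by (auto simp: eventually_at_right_field intro!: exI[of _ 1] tendsto_eq_intros)
  then have "((\<lambda>t. (voln n (mink_sum K (t / c) ?B) - voln n K) / (t / c)) \<longlongrightarrow> surface_area n K) (at_right 0)"
    by (rule filterlim_compose[OF surface_area_limit(1)[OF assms(1,2)]])
  then have "((\<lambda>t. c ^ (n - 1) * ((voln n (mink_sum K (t / c) ?B) - voln n K) / (t / c))) \<longlongrightarrow> c ^ (n - 1) * surface_area n K) (at_right 0)"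
    by (intro tendsto_intros)
  moreover have eq: "c ^ (n - 1) * ((voln n (mink_sum K (t / c) ?B) - voln n K) / (t / c))
      = (voln n (mink_sum ((\<lambda>x i. c * x i) ` K) t ?B) - voln n ((\<lambda>x i. c * x i) ` K)) / t" for t
  proof -
    have e: "(\<lambda>i. c * a i + t * b i) = (\<lambda>i. c * (a i + t / c * b i))" for a b :: "nat \<Rightarrow> real"
      using assms(3) by (auto simp: field_simps)
    have "mink_sum ((\<lambda>x i. c * x i) ` K) t ?B = (\<lambda>x i. c * x i) ` mink_sum K (t / c) ?B"
    proof (intro equalityI subsetI)
      fix x assume "x \<in> mink_sum ((\<lambda>x i. c * x i) ` K) t ?B"
      then obtain a b where ab: "a \<in> K" "b \<in> ?B" "x = (\<lambda>i. c * a i + t * b i)" by (auto simp: mink_sum_def)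
      from imageI[OF mem_mink_sumI[OF ab(1,2), of "t / c"], of "\<lambda>x i. c * x i"]
      show "x \<in> (\<lambda>x i. c * x i) ` mink_sum K (t / c) ?B"
        unfolding ab(3) e .
    next
      fix x assume "x \<in> (\<lambda>x i. c * x i) ` mink_sum K (t / c) ?B"
      then obtain a b where ab: "a \<in> K" "b \<in> ?B" "x = (\<lambda>i. c * (a i + t / c * b i))" by (auto simp: mink_sum_def)
      from mem_mink_sumI[OF imageI[OF ab(1), of "\<lambda>x i. c * x i"] ab(2), of t]
      show "x \<in> mink_sum ((\<lambda>x i. c * x i) ` K) t ?B"
        unfolding ab(3) e .
    qed
    then have "voln n (mink_sum ((\<lambda>x i. c * x i) ` K) t ?B) - voln n ((\<lambda>x i. c * x i) ` K)
        = c ^ n * (voln n (mink_sum K (t / c) ?B) - voln n K)"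
      using voln_scale[OF compact_mink_sum[OF K, of "t / c" n] assms(3), of n] voln_scale[OF K assms(3), of n]
      by (simp add: right_diff_distrib)
    moreover have "c ^ n = c ^ (n - 1) * c" using assms(2) by (cases n) auto
    ultimately show ?thesis using assms(3) by simp
  qed
  ultimately have "((\<lambda>t. (voln n (mink_sum ((\<lambda>x i. c * x i) ` K) t ?B) - voln n ((\<lambda>x i. c * x i) ` K)) / t)
      \<longlongrightarrow> c ^ (n - 1) * surface_area n K) (at_right 0)"
    by (simp only: eq)
  then show ?thesis
    unfolding surface_area_def[of n "(\<lambda>x i. c * x i) ` K"]
    by (intro tendsto_Lim trivial_limit_at_right_real)
qed

text \<open>Averaging the chord from \<open>p\<close> with a point \<open>a\<close> of
  \<open>K\<close> gives a segment of length \<open>d / 2\<close> in \<open>K\<close> above the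
  midpoint of the projections of \<open>p\<close> and \<open>a\<close>. So all fibres over a
  half-size copy of the projection have length at least \<open>d / 2\<close>; that copy is the
  source of the factor \<open>(1/2) ^ m\<close>.\<close>

lemma chord_voln_le:
  assumes K: "compact K" "convexn K" "\<forall>x\<in>K. \<forall>i\<ge>Suc m. x i = 0"
    and p: "p \<in> K" "p(m := p m + d) \<in> K" "d \<ge> 0"
  shows "d / 2 * ((1/2) ^ m * voln m (forget m ` K)) \<le> voln (Suc m) K"
proof -
  let ?v = "\<lambda>i. forget m p i / 2"
  let ?Q = "(\<lambda>x i. (1/2) * x i + ?v i) ` (forget m ` K)"
  have cQ: "compact ?Q" by (intro compact_affine_image compact_forget K)
  have v: "?v i = 0" if "m \<le> i" for i
    using K(3) p(1) that by (cases "i = m") (auto simp: forget_def)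
  have fibre: "ennreal (d / 2) * indicator ?Q x \<le> emeasure lborel {z. x(m := z) \<in> K}" for x
  proof (cases "x \<in> ?Q")
    case True
    then obtain a where a: "a \<in> K" "x = (\<lambda>i. (1/2) * forget m a i + ?v i)" by blast
    have "{p m / 2 + a m / 2..p m / 2 + a m / 2 + d / 2} \<subseteq> {z. x(m := z) \<in> K}"
    proof
      fix z assume z: "z \<in> {p m / 2 + a m / 2..p m / 2 + a m / 2 + d / 2}"
      \<comment> \<open>The position on the chord whose average with \<open>a\<close> has height
        \<open>z\<close>. If \<open>d = 0\<close>, the interval is a single point and
        \<open>s = 0\<close> serves.\<close>
      define s where "s = (if d = 0 then 0 else (2 * z - p m - a m) / d)"
      have s: "0 \<le> s" "s \<le> 1" "s * d = 2 * z - p m - a m"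
        using z p(3) by (auto simp: s_def field_simps)
      have "(\<lambda>i. (1 - s) * p i + s * (p(m := p m + d)) i) \<in> K"
        by (rule convexnD[OF K(2) p(1,2) s(1,2)])
      then have "(\<lambda>i. (1 - 1/2) * a i + 1/2 * (\<lambda>i. (1 - s) * p i + s * (p(m := p m + d)) i) i) \<in> K"
        by (intro convexnD[OF K(2) a(1)]) auto
      moreover have "(\<lambda>i. (1 - 1/2) * a i + 1/2 * (\<lambda>i. (1 - s) * p i + s * (p(m := p m + d)) i) i) = x(m := z)"
      proof
        fix i
        have e: "(1 - s) * p m + s * (p m + d) = 2 * z - a m" using s(3) by (simp add: algebra_simps)
        have "(1 - s) * p i + s * p i = p i" by (simp add: algebra_simps)
        then show "(1 - 1/2) * a i + 1/2 * (\<lambda>i. (1 - s) * p i + s * (p(m := p m + d)) i) i = (x(m := z)) i"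
          by (cases "i = m") (simp_all add: a(2) forget_def e diff_divide_distrib)
      qed
      ultimately show "z \<in> {z. x(m := z) \<in> K}" by simp
    qed
    then have "emeasure lborel {p m / 2 + a m / 2..p m / 2 + a m / 2 + d / 2} \<le> emeasure lborel {z. x(m := z) \<in> K}"
      using borel_compact[OF compact_section[OF K(1)]] by (intro emeasure_mono) auto
    then show ?thesis using True p(3) by simp
  qed simp
  have "ennreal (d / 2) * emeasure (emeas m) ?Q = (\<integral>\<^sup>+x. ennreal (d / 2) * indicator ?Q x \<partial>emeas m)"
    using compact_imp_borel[OF cQ] by (intro nn_integral_cmult_indicator[symmetric]) simp
  also have "\<dots> \<le> (\<integral>\<^sup>+x. emeasure lborel {z. x(m := z) \<in> K} \<partial>emeas m)"
    by (intro nn_integral_mono fibre)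
  also have "\<dots> = emeasure (emeas (Suc m)) K"
    by (rule emeasure_emeas_Suc(1)[OF compact_imp_borel[OF K(1)], symmetric])
  finally have "ennreal (d / 2 * voln m ?Q) \<le> ennreal (voln (Suc m) K)"
    unfolding emeasure_emeas_compact[OF cQ] emeasure_emeas_compact[OF K(1)]
    using p(3) voln_nonneg by (subst ennreal_mult) auto
  then have "d / 2 * voln m ?Q \<le> voln (Suc m) K"
    using voln_nonneg by (subst (asm) ennreal_le_iff) auto
  also have "voln m ?Q = (1/2) ^ m * voln m (forget m ` K)"
    using v by (intro voln_affine compact_forget K) auto
  finally show ?thesis .
qed

section \<open>Orthonormal coordinates\<close>

definition orthon :: "nat \<Rightarrow> (nat \<Rightarrow> nat \<Rightarrow> real) \<Rightarrow> bool" where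
  "orthon n q \<longleftrightarrow> (\<forall>j<n. \<forall>i\<ge>n. q j i = 0) \<and>
     (\<forall>j<n. \<forall>k<n. dotn n (q j) (q k) = (if j = k then 1 else 0))"

definition lincomb :: "nat \<Rightarrow> (nat \<Rightarrow> nat \<Rightarrow> real) \<Rightarrow> (nat \<Rightarrow> real) \<Rightarrow> nat \<Rightarrow> real" where
  "lincomb n q y = (\<lambda>i. \<Sum>j<n. y j * q j i)"

text \<open>For orthonormal \<open>q\<close> this inverts \<open>lincomb n q\<close> on vectors
  vanishing from index \<open>n\<close> on. Passing to coordinates lets an operation on one entry
  act in any prescribed direction.\<close>

definition coords :: "nat \<Rightarrow> (nat \<Rightarrow> nat \<Rightarrow> real) \<Rightarrow> (nat \<Rightarrow> real) \<Rightarrow> nat \<Rightarrow> real" where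
  "coords n q x = (\<lambda>j. if j < n then dotn n x (q j) else 0)"

lemma dotn_commute: "dotn n x y = dotn n y x"
  by (simp add: dotn_def mult.commute)

lemma dotn_lincomb: "dotn n x (lincomb n q y) = (\<Sum>j<n. y j * dotn n x (q j))"
  unfolding dotn_def lincomb_def sum_distrib_left
  by (subst sum.swap) (simp add: mult_ac)

lemma coords_lincomb:
  assumes "orthon n q" "\<forall>i\<ge>n. y i = 0"
  shows "coords n q (lincomb n q y) = y"
proof
  fix k
  show "coords n q (lincomb n q y) k = y k"
  proof (cases "k < n")
    case True
    have "coords n q (lincomb n q y) k = (\<Sum>j<n. y j * dotn n (q k) (q j))"
      using True by (simp add: coords_def dotn_commute[of n "lincomb n q y"] dotn_lincomb)
    also have "\<dots> = (\<Sum>j<n. if k = j then y j else 0)"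
      using assms(1) True by (intro sum.cong) (auto simp: orthon_def)
    finally show ?thesis using True by simp
  qed (use assms(2) in \<open>simp add: coords_def\<close>)
qed

text \<open>A one-sided inverse of a square matrix is two-sided, so orthonormal rows give
  orthonormal columns. This is where it enters that \<open>n\<close> orthonormal vectors span
  \<open>R^n\<close>.\<close>

lemma orthon_dual:
  assumes "orthon n q" "i < n" "k < n"
  shows "(\<Sum>j<n. q j i * q j k) = (if i = k then 1 else 0)"
proof -
  define Q where "Q = Matrix.mat n n (\<lambda>(i, j). q j i)"
  define R where "R = Matrix.mat n n (\<lambda>(i, j). q i j)"
  have c: "Q \<in> carrier_mat n n" "R \<in> carrier_mat n n" by (auto simp: Q_def R_def)
  have "R * Q = 1\<^sub>m n"
    using assms(1)
    by (intro eq_matI) (auto simp: Q_def R_def scalar_prod_def orthon_def dotn_def atLeast0LessThan)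
  then have "Q * R = 1\<^sub>m n" by (rule mat_mult_left_right_inverse[OF c(2,1)])
  then have "(Q * R) $$ (i, k) = (1\<^sub>m n) $$ (i, k)" by simp
  then show ?thesis
    using assms(2,3) by (simp add: Q_def R_def scalar_prod_def atLeast0LessThan)
qed

lemma lincomb_zero: "orthon n q \<Longrightarrow> n \<le> i \<Longrightarrow> lincomb n q y i = 0"
  by (simp add: lincomb_def orthon_def)

lemma lincomb_coords:
  assumes "orthon n q" "\<forall>i\<ge>n. x i = 0"
  shows "lincomb n q (coords n q x) = x"
proof
  fix k
  show "lincomb n q (coords n q x) k = x k"
  proof (cases "k < n")
    case True
    have "lincomb n q (coords n q x) k = (\<Sum>j<n. \<Sum>i<n. x i * (q j i * q j k))"
      by (simp add: lincomb_def coords_def dotn_def sum_distrib_right mult.assoc)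
    also have "\<dots> = (\<Sum>i<n. x i * (\<Sum>j<n. q j i * q j k))"
      by (subst sum.swap) (simp add: sum_distrib_left)
    also have "\<dots> = (\<Sum>i<n. if i = k then x i else 0)"
      using orthon_dual[OF assms(1) _ True] by (intro sum.cong) auto
    finally show ?thesis using True by simp
  qed (use assms lincomb_zero[OF assms(1)] in simp)
qed

lemma sum_coords_sq:
  assumes "orthon n q" "\<forall>i\<ge>n. x i = 0"
  shows "(\<Sum>j<n. (coords n q x j)\<^sup>2) = (\<Sum>i<n. (x i)\<^sup>2)"
proof -
  have "(\<Sum>i<n. (x i)\<^sup>2) = dotn n x (lincomb n q (coords n q x))"
    by (simp only: lincomb_coords[OF assms]) (simp add: dotn_def power2_eq_square)
  also have "\<dots> = (\<Sum>j<n. (coords n q x j)\<^sup>2)"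
    by (simp add: dotn_lincomb coords_def power2_eq_square)
  finally show ?thesis by simp
qed

lemma coords_unit_balln:
  assumes "orthon n q" "\<forall>i\<ge>n. x i = 0"
  shows "coords n q x \<in> unit_balln n \<longleftrightarrow> x \<in> unit_balln n"
  using sum_coords_sq[OF assms] assms(2) by (simp add: mem_unit_balln coords_def)

lemma lincomb_unit_balln:
  assumes "orthon n q" "\<forall>i\<ge>n. y i = 0"
  shows "lincomb n q y \<in> unit_balln n \<longleftrightarrow> y \<in> unit_balln n"
  using coords_unit_balln[OF assms(1), of "lincomb n q y"] lincomb_zero[OF assms(1)]
    coords_lincomb[OF assms] by simp

section \<open>Invariance of volume and surface area under orthonormal coordinates\<close>

lemma coords_linear: "coords n q (\<lambda>i. a * x i + b * y i) = (\<lambda>i. a * coords n q x i + b * coords n q y i)"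
  by (auto simp: coords_def dotn_def fun_eq_iff sum_distrib_left sum.distrib algebra_simps)

lemma coords_add: "coords n q (\<lambda>i. x i + b * y i) = (\<lambda>i. coords n q x i + b * coords n q y i)"
  using coords_linear[of n q 1 x b y] by simp

lemma compact_coords: "compact K \<Longrightarrow> compact (coords n q ` K)"
proof (rule compact_continuous_image[OF continuous_on_coordinatewise_then_product])
  fix i
  have "continuous_on K (\<lambda>x. x i)" for i :: nat
    by (rule continuous_on_subset[OF continuous_on_product_coordinates]) simp
  then show "continuous_on K (\<lambda>x. coords n q x i)"
    unfolding coords_def dotn_def by (cases "i < n") (auto intro!: continuous_intros)
qed

text \<open>Uniqueness of Haar measure applied to \<open>lincomb n q\<close>, with the unit ball as
  the invariant test set. The preimage of \<open>K\<close> under \<open>lincomb n q\<close> agrees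
  with the image of \<open>K\<close> under \<open>coords n q\<close> almost everywhere.\<close>

lemma voln_coords:
  assumes q: "orthon n q" and n: "n \<ge> 1" and K: "compact K" "\<forall>x\<in>K. \<forall>i\<ge>n. x i = 0"
  shows "voln n (coords n q ` K) = voln n K"
proof -
  have hm: "lincomb n q \<in> borel_measurable borel"
    unfolding lincomb_def by (rule borel_measurable_coordI) measurable
  have Bpos: "voln n (unit_balln n) > 0"
  proof -
    have "0 < (2 / sqrt n) ^ n" using n by simp
    then show ?thesis using voln_unit_balln_ge[OF n] by linarith
  qed
  have "emeasure (emeas n) {x. lincomb n q x \<in> K} = emeasure (emeas n) K"
  proof (rule emeas_additive_invariant[where h = "lincomb n q" and A = K and B = "unit_balln n"])
    show "lincomb n q (\<lambda>i. x i + y i) = (\<lambda>i. lincomb n q x i + lincomb n q y i)" for x y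
      by (auto simp: lincomb_def distrib_right sum.distrib)
    show "lincomb n q x i = 0" if "n \<le> i" for x i by (rule lincomb_zero[OF q that])
    show "\<exists>w. (\<forall>i\<ge>n. w i = 0) \<and> lincomb n q w = v" if "\<And>i. n \<le> i \<Longrightarrow> v i = 0" for v
      using lincomb_coords[OF q, of v] that by (intro exI[of _ "coords n q v"]) (auto simp: coords_def)
    show "unit_balln n \<in> sets borel" "K \<in> sets borel"
      by (intro compact_imp_borel compact_unit_balln K)+
    show "(\<lambda>i. - x i) \<in> unit_balln n \<longleftrightarrow> x \<in> unit_balln n" for x
      by (simp add: mem_unit_balln)
    show "lincomb n q x \<in> unit_balln n \<longleftrightarrow> x \<in> unit_balln n" if "\<forall>i\<ge>n. x i = 0" for x
      by (rule lincomb_unit_balln[OF q that])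
    show "emeasure (emeas n) (unit_balln n) \<noteq> 0" "emeasure (emeas n) (unit_balln n) \<noteq> \<infinity>"
      using Bpos by (auto simp: emeasure_emeas_compact compact_unit_balln)
  qed (rule hm)
  moreover have "emeasure (emeas n) {x. lincomb n q x \<in> K} = emeasure (emeas n) (coords n q ` K)"
  proof (rule emeasure_eq_AE)
    show "AE x in emeas n. x \<in> {x. lincomb n q x \<in> K} \<longleftrightarrow> x \<in> coords n q ` K"
      using AE_emeas[of n]
    proof eventually_elim
      fix x :: "nat \<Rightarrow> real" assume x: "\<forall>i\<ge>n. x i = 0"
      have "lincomb n q (coords n q k) \<in> K" if "k \<in> K" for k
        using lincomb_coords[OF q, of k] K(2) that by simp
      moreover have "x \<in> coords n q ` K" if "lincomb n q x \<in> K"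
        using imageI[OF that, of "coords n q"] coords_lincomb[OF q x] by simp
      ultimately show "x \<in> {x. lincomb n q x \<in> K} \<longleftrightarrow> x \<in> coords n q ` K" by blast
    qed
    show "{x. lincomb n q x \<in> K} \<in> sets (emeas n)"
      using sets_borel_vimageI[OF hm compact_imp_borel[OF K(1)]] by simp
    show "coords n q ` K \<in> sets (emeas n)"
      using compact_imp_borel[OF compact_coords[OF K(1)]] by simp
  qed
  ultimately show ?thesis
    using voln_nonneg K by (simp add: emeasure_emeas_compact compact_coords)
qed

text \<open>The coordinate map is linear and carries the unit ball onto itself.\<close>

lemma mink_sum_coords:
  assumes q: "orthon n q"
  shows "mink_sum (coords n q ` K) t (unit_balln n) = coords n q ` mink_sum K t (unit_balln n)"
proof (intro equalityI subsetI)
  fix x assume "x \<in> mink_sum (coords n q ` K) t (unit_balln n)"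
  then obtain a b where ab: "a \<in> K" "b \<in> unit_balln n" "x = (\<lambda>i. coords n q a i + t * b i)"
    by (auto simp: mink_sum_def)
  have b: "\<forall>i\<ge>n. b i = 0" using ab(2) by (simp add: mem_unit_balln)
  have "x = coords n q (\<lambda>i. a i + t * lincomb n q b i)"
    unfolding ab(3) coords_add by (simp add: coords_lincomb[OF q b])
  moreover have "(\<lambda>i. a i + t * lincomb n q b i) \<in> mink_sum K t (unit_balln n)"
    using ab lincomb_unit_balln[OF q b] by (intro mem_mink_sumI) auto
  ultimately show "x \<in> coords n q ` mink_sum K t (unit_balln n)" by blast
next
  fix x assume "x \<in> coords n q ` mink_sum K t (unit_balln n)"
  then obtain a b where ab: "a \<in> K" "b \<in> unit_balln n" "x = coords n q (\<lambda>i. a i + t * b i)"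
    by (auto simp: mink_sum_def)
  have "coords n q b \<in> unit_balln n" using coords_unit_balln[OF q] ab(2) by (auto simp: mem_unit_balln)
  from mem_mink_sumI[OF imageI[OF ab(1), of "coords n q"] this, of t]
  show "x \<in> mink_sum (coords n q ` K) t (unit_balln n)"
    unfolding ab(3) coords_add .
qed

lemma surface_area_coords:
  assumes q: "orthon n q" and n: "n \<ge> 1" and K: "compact K" "\<forall>x\<in>K. \<forall>i\<ge>n. x i = 0"
  shows "surface_area n (coords n q ` K) = surface_area n K"
proof -
  have "voln n (coords n q ` mink_sum K t (unit_balln n)) = voln n (mink_sum K t (unit_balln n))" for t
    using mink_sum_subset_Rn[of K n] K by (intro voln_coords q n compact_mink_sum) blast+
  then show ?thesis
    unfolding surface_area_def mink_sum_coords[OF q] voln_coords[OF assms] by simp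
qed

lemma cbody_coords:
  assumes q: "orthon n q" and K: "cbody n K"
  shows "cbody n (coords n q ` K)"
proof -
  obtain p r where r: "r > 0" "\<forall>b\<in>unit_balln n. (\<lambda>i. p i + r * b i) \<in> K"
    by (rule cbodyE[OF K])
  have cK: "compact K" "\<forall>x\<in>K. \<forall>i\<ge>n. x i = 0" "convexn K" using K by (auto simp: cbody_def)
  have "convexn (coords n q ` K)"
    unfolding convexn_def
  proof clarify
    fix x y and t :: real assume a: "x \<in> K" "y \<in> K" "t \<in> {0..1}"
    then have "(\<lambda>i. (1 - t) * x i + t * y i) \<in> K" by (intro convexnD[OF cK(3)]) auto
    from imageI[OF this, of "coords n q"]
    show "(\<lambda>i. (1 - t) * coords n q x i + t * coords n q y i) \<in> coords n q ` K"
      unfolding coords_linear .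
  qed
  moreover have "(\<lambda>i. coords n q p i + r * b i) \<in> coords n q ` K" if b: "b \<in> unit_balln n" for b
  proof -
    have z: "\<forall>i\<ge>n. b i = 0" using b by (simp add: mem_unit_balln)
    have "lincomb n q b \<in> unit_balln n" using lincomb_unit_balln[OF q z] b by simp
    from imageI[OF r(2)[rule_format, OF this], of "coords n q"]
    show ?thesis unfolding coords_add coords_lincomb[OF q z] .
  qed
  moreover have "\<forall>x\<in>coords n q ` K. \<forall>i\<ge>n. x i = 0" by (auto simp: coords_def)
  ultimately show ?thesis
    unfolding cbody_def using compact_coords[OF cK(1)] r(1) by blast
qed

section \<open>Bodies in minimal surface area position\<close>

text \<open>Otherwise \<open>1 + x \<le> exp x\<close> would give \<open>2 < exp (1/2)\<close>, that
  is \<open>4 < exp 1\<close>. This estimate is the source of the factor \<open>n\<close> in the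
  lower bound for projections.\<close>

lemma root_two_ge:
  fixes c :: real
  assumes "n \<ge> 1" "c > 0" "c ^ n = 2"
  shows "1 + 1 / (2 * real n) \<le> c"
proof (rule ccontr)
  assume "\<not> ?thesis"
  then have "c < 1 + 1 / (2 * real n)" by simp
  also have "\<dots> \<le> exp (1 / (2 * real n))" by (rule exp_ge_add_one_self)
  finally have "c ^ n < exp (1 / (2 * real n)) ^ n"
    using assms by (intro power_strict_mono) auto
  also have "exp (1 / (2 * real n)) ^ n = exp (1 / 2)"
    using assms(1) by (simp add: exp_of_nat_mult[symmetric])
  finally have "2 < exp (1 / 2 :: real)" using assms(3) by simp
  then have "2 * 2 < exp (1 / 2 :: real) * exp (1 / 2)" by (intro mult_strict_mono) auto
  also have "\<dots> = exp 1" by (simp add: exp_add[symmetric])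
  also have "\<dots> \<le> 3" by (rule exp_le)
  finally show False by simp
qed

text \<open>In the basis \<open>q\<close> the map is diagonal with entries \<open>c\<close> and a
  last entry \<open>c / 2\<close>, so its determinant is \<open>c ^ Suc m / 2 = 1\<close>. It is
  conjugated back to the standard basis because minimality speaks about matrices acting on
  \<open>K\<close> itself.\<close>

lemma stretch_in_SLn:
  assumes q: "orthon (Suc m) q" and c: "c > 0" "c ^ Suc m = 2"
  shows "\<exists>T\<in>SLn (Suc m). \<forall>x. mat_map (Suc m) T x = lincomb (Suc m) q (\<lambda>i. c * halve m (coords (Suc m) q x) i)"
proof -
  let ?n = "Suc m"
  define d where "d i = (if i = m then c / 2 else c)" for i
  define Q where "Q = Matrix.mat ?n ?n (\<lambda>(i, j). q j i)"
  define R where "R = Matrix.mat ?n ?n (\<lambda>(i, j). q i j)"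
  define Dg where "Dg = Matrix.mat ?n ?n (\<lambda>(i, j). if i = j then d i else 0)"
  have car: "Q \<in> carrier_mat ?n ?n" "R \<in> carrier_mat ?n ?n" "Dg \<in> carrier_mat ?n ?n"
    by (auto simp: Q_def R_def Dg_def)
  have entry: "(A * B) $$ (i, j) = (\<Sum>k<?n. A $$ (i, k) * B $$ (k, j))"
    if "A \<in> carrier_mat ?n ?n" "B \<in> carrier_mat ?n ?n" "i < ?n" "j < ?n" for A B :: "real mat" and i j
    using that by (auto simp: scalar_prod_def atLeast0LessThan simp del: sum.lessThan_Suc)
  have QR: "Q * R = 1\<^sub>m ?n"
  proof (rule eq_matI)
    show "(Q * R) $$ (i, j) = 1\<^sub>m ?n $$ (i, j)" if "i < dim_row (1\<^sub>m ?n)" "j < dim_col (1\<^sub>m ?n)" for i j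
      using orthon_dual[OF q, of i j] that
      by (simp add: Q_def R_def scalar_prod_def atLeast0LessThan del: sum.lessThan_Suc)
  qed (auto simp: Q_def R_def)
  have "Determinant.det Dg = prod_list (diag_mat Dg)"
    by (rule det_upper_triangular[OF _ car(3)]) (auto simp: Dg_def)
  also have "\<dots> = (\<Prod>i<?n. d i)"
    by (simp add: prod_list_diag_prod Dg_def atLeast0LessThan del: prod.lessThan_Suc)
  also have "\<dots> = c ^ m * (c / 2)"
    by (simp add: d_def)
  also have "\<dots> = 1" using c(2) by (simp add: mult.commute)
  finally have detD: "Determinant.det Dg = 1" .
  let ?T = "Q * Dg * R"
  \<comment> \<open>\<open>Q\<close> may reverse orientation, but its determinant cancels against
    that of its inverse \<open>R\<close>.\<close>
  have "Determinant.det ?T = Determinant.det Q * Determinant.det Dg * Determinant.det R"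
    using car by (simp add: det_mult[of _ ?n])
  also have "\<dots> = Determinant.det (Q * R)"
    using car by (simp add: det_mult[of _ ?n] detD)
  also have "\<dots> = 1" by (simp add: QR)
  finally have "?T \<in> SLn ?n" using car by (simp add: SLn_def)
  moreover have "mat_map ?n ?T x = lincomb ?n q (\<lambda>i. c * halve m (coords ?n q x) i)" for x
  proof
    fix i
    show "mat_map ?n ?T x i = lincomb ?n q (\<lambda>i. c * halve m (coords ?n q x) i) i"
    proof (cases "i < ?n")
      case True
      have QD: "(Q * Dg) $$ (i, k) = q k i * d k" if "k < ?n" for k
      proof -
        have "(Q * Dg) $$ (i, k) = (\<Sum>l<?n. q l i * (if l = k then d l else 0))"
          using True that by (simp add: Q_def Dg_def scalar_prod_def atLeast0LessThan del: sum.lessThan_Suc)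
        also have "\<dots> = (\<Sum>l<?n. if l = k then q l i * d l else 0)"
          by (intro sum.cong) auto
        finally show ?thesis using that by (simp del: sum.lessThan_Suc)
      qed
      have T: "?T $$ (i, j) = (\<Sum>k<?n. q k i * d k * q k j)" if "j < ?n" for j
      proof -
        have "?T $$ (i, j) = (\<Sum>k<?n. (Q * Dg) $$ (i, k) * R $$ (k, j))"
          by (rule entry) (use True that car in auto)
        also have "\<dots> = (\<Sum>k<?n. q k i * d k * q k j)"
          using that by (intro sum.cong) (auto simp: QD R_def simp del: index_mult_mat(1))
        finally show ?thesis .
      qed
      have "mat_map ?n ?T x i = (\<Sum>j<?n. \<Sum>k<?n. q k i * d k * q k j * x j)"
        using True by (simp add: mat_map_def T sum_distrib_right del: sum.lessThan_Suc index_mult_mat(1))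
      also have "\<dots> = (\<Sum>k<?n. d k * dotn ?n x (q k) * q k i)"
        unfolding dotn_def by (subst sum.swap) (simp add: sum_distrib_left sum_distrib_right mult_ac del: sum.lessThan_Suc)
      also have "\<dots> = (\<Sum>k<?n. c * halve m (coords ?n q x) k * q k i)"
        by (intro sum.cong) (auto simp: d_def halve_def coords_def)
      finally show ?thesis by (simp add: lincomb_def del: sum.lessThan_Suc)
    next
      case False
      then show ?thesis using lincomb_zero[OF q, of i] by (simp add: mat_map_def)
    qed
  qed
  ultimately show ?thesis by blast
qed

text \<open>Halving the body in the direction \<open>q m\<close> and rescaling it to its former volume cannot
  decrease the surface area of a body in minimal position.\<close>

lemma surface_area_le_shadow:
  assumes min: "minimal_surface_area_position (Suc m) K" and K: "cbody (Suc m) K" and m: "m \<ge> 1"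
    and q: "orthon (Suc m) q"
  shows "surface_area (Suc m) K / (4 * Suc m) \<le> voln m (forget m ` coords (Suc m) q ` K)"
proof -
  let ?n = "Suc m"
  let ?L = "coords ?n q ` K"
  let ?c = "root ?n 2"
  have c: "?c > 0" "?c ^ ?n = 2" by (simp, rule real_root_pow_pos2, simp_all)
  obtain T where T: "T \<in> SLn ?n" "\<And>x. mat_map ?n T x = lincomb ?n q (\<lambda>i. ?c * halve m (coords ?n q x) i)"
    using stretch_in_SLn[OF q c] by blast
  define M where "M = (\<lambda>x i. ?c * x i) ` halve m ` ?L"
  have cK: "compact K" "\<forall>x\<in>K. \<forall>i\<ge>?n. x i = 0" using K by (auto simp: cbody_def)
  have L: "cbody ?n ?L" by (rule cbody_coords[OF q K])
  have Mz: "\<forall>x\<in>M. \<forall>i\<ge>?n. x i = 0" by (auto simp: M_def halve_def coords_def)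
  have cM: "compact M" unfolding M_def by (intro compact_scale_image compact_halve compact_coords cK)
  have im: "mat_map ?n T ` K = lincomb ?n q ` M"
    by (simp add: M_def image_image T(2))
  have "coords ?n q (lincomb ?n q y) = y" if "y \<in> M" for y
    by (rule coords_lincomb[OF q]) (use Mz that in auto)
  then have TK: "coords ?n q ` mat_map ?n T ` K = M" by (simp add: im image_image)
  have "continuous_on M (lincomb ?n q)"
  proof (rule continuous_on_coordinatewise_then_product)
    fix i
    have "continuous_on M (\<lambda>x. x i)" for i :: nat
      by (rule continuous_on_subset[OF continuous_on_product_coordinates]) simp
    then show "continuous_on M (\<lambda>x. lincomb ?n q x i)"
      unfolding lincomb_def by (intro continuous_intros)
  qed
  then have cT: "compact (mat_map ?n T ` K)" unfolding im by (rule compact_continuous_image[OF _ cM])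
  have Tz: "\<forall>x\<in>mat_map ?n T ` K. \<forall>i\<ge>?n. x i = 0" by (auto simp: mat_map_def)
  have "surface_area ?n K \<le> surface_area ?n (mat_map ?n T ` K)"
    using min T(1) by (simp add: minimal_surface_area_position_def)
  \<comment> \<open>Read in the coordinates of \<open>q\<close>, the transformed body is
    \<open>M\<close>, the halved coordinate body scaled by \<open>?c\<close>.\<close>
  also have "\<dots> = surface_area ?n M"
    using surface_area_coords[OF q _ cT Tz] unfolding TK by simp
  also have "\<dots> = ?c ^ m * surface_area ?n (halve m ` ?L)"
    unfolding M_def using surface_area_scale[OF cbody_halve[OF L] _ c(1)] by simp
  also have "\<dots> \<le> ?c ^ m * (surface_area ?n ?L / 2 + voln m (forget m ` ?L))"
    using c(1) by (intro mult_left_mono surface_area_halve_le L m) auto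
  also have "surface_area ?n ?L = surface_area ?n K"
    using surface_area_coords[OF q _ cK] by simp
  \<comment> \<open>One more factor \<open>?c\<close> completes \<open>?c ^ m\<close> to
    \<open>?c ^ ?n = 2\<close>; half of the surface area then doubles to the whole and cancels,
    leaving the gain \<open>?c - 1\<close>.\<close>
  finally have "?c * surface_area ?n K \<le> ?c * (?c ^ m * (surface_area ?n K / 2 + voln m (forget m ` ?L)))"
    using c(1) by (intro mult_left_mono) auto
  also have "\<dots> = ?c ^ ?n * (surface_area ?n K / 2 + voln m (forget m ` ?L))" by simp
  also have "\<dots> = surface_area ?n K + 2 * voln m (forget m ` ?L)" unfolding c(2) by simp
  finally have 1: "(?c - 1) * surface_area ?n K \<le> 2 * voln m (forget m ` ?L)"
    by (simp add: left_diff_distrib)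
  \<comment> \<open>Replacing \<open>?c - 1\<close> by its lower bound requires a nonnegative
    surface area, which the isoperimetric inequality supplies.\<close>
  have "0 \<le> 2 * sqrt ?n * root ?n (voln ?n K) ^ (?n - 1)" using voln_nonneg by simp
  also have "\<dots> \<le> surface_area ?n K" by (rule surface_area_limit(2)[OF K]) simp
  finally have S0: "0 \<le> surface_area ?n K" .
  have "1 / (2 * real ?n) * surface_area ?n K \<le> (?c - 1) * surface_area ?n K"
    using root_two_ge[OF _ c] by (intro mult_right_mono S0) auto
  with 1 have "1 / (2 * real ?n) * surface_area ?n K \<le> 2 * voln m (forget m ` ?L)" by linarith
  then show ?thesis by (simp add: field_simps)
qed

section \<open>Projections onto hyperplanes in coordinates\<close>

text \<open>The direction \<xi> is placed last, at index \<open>m\<close>, the coordinate on which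
  \<open>halve m\<close> and \<open>forget m\<close> act.\<close>

lemma orthon_perp_basis:
  assumes "perp_basis (Suc m) \<xi> u" "\<xi> \<in> topspace (nsphere m)"
  shows "orthon (Suc m) (\<lambda>j. if j < m then u j else \<xi>)"
proof -
  have "dotn (Suc m) \<xi> \<xi> = 1" using dotn_sphere[of "Suc m" \<xi>] assms(2) by simp
  moreover have "\<forall>i\<ge>Suc m. \<xi> i = 0" using assms(2) by (simp add: nsphere_def topspace_Euclidean_space)
  moreover have "dotn (Suc m) (u j) \<xi> = 0" "dotn (Suc m) \<xi> (u j) = 0" if "j < m" for j
    using assms(1) that dotn_commute[of "Suc m" \<xi> "u j"] by (auto simp: perp_basis_def)
  ultimately show ?thesis
    using assms(1) unfolding orthon_def perp_basis_def
    by (auto simp: topspace_Euclidean_space less_Suc_eq)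
qed

text \<open>Expanding \<open>x\<close> in the full basis and removing its component along \<xi>
  leaves the combination of the \<open>u j\<close>, whose coefficients are the first
  \<open>m\<close> coordinates. The basis \<open>u\<close> is arbitrary, so the one picked in
  \<open>surface_area_perp\<close> is covered.\<close>

lemma perp_coords_proj:
  assumes u: "perp_basis (Suc m) \<xi> u" and \<xi>: "\<xi> \<in> topspace (nsphere m)"
    and K: "\<forall>x\<in>K. \<forall>i\<ge>Suc m. x i = 0"
  shows "perp_coords (Suc m) u (proj_perp (Suc m) \<xi> ` K)
    = forget m ` coords (Suc m) (\<lambda>j. if j < m then u j else \<xi>) ` K"
proof -
  let ?q = "\<lambda>j. if j < m then u j else \<xi>"
  have q: "orthon (Suc m) ?q" by (rule orthon_perp_basis[OF u \<xi>])
  have decomp: "x i = (\<Sum>j<m. dotn (Suc m) x (u j) * u j i) + dotn (Suc m) x \<xi> * \<xi> i" if "x \<in> K" for x i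
    using fun_cong[OF lincomb_coords[OF q, of x], of i] K that
    by (simp add: lincomb_def coords_def)
  have uu: "dotn (Suc m) (\<lambda>i. \<Sum>j<m. y j * u j i) (u k) = y k" if "k < m" for y k
  proof -
    have "dotn (Suc m) (\<lambda>i. \<Sum>j<m. y j * u j i) (u k) = (\<Sum>j<m. y j * dotn (Suc m) (u j) (u k))"
      unfolding dotn_def sum_distrib_left sum_distrib_right by (subst sum.swap) (simp add: mult_ac)
    also have "\<dots> = (\<Sum>j<m. if j = k then y j else 0)"
      using u that by (intro sum.cong) (auto simp: perp_basis_def)
    finally show ?thesis using that by simp
  qed
  show ?thesis
  proof (intro equalityI subsetI)
    fix y assume "y \<in> perp_coords (Suc m) u (proj_perp (Suc m) \<xi> ` K)"
    then obtain x where y: "\<forall>i\<ge>m. y i = 0" and x: "x \<in> K"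
      "(\<lambda>i. \<Sum>j<m. y j * u j i) = (\<lambda>i. x i - dotn (Suc m) x \<xi> * \<xi> i)"
      by (auto simp: perp_coords_def proj_perp_def topspace_Euclidean_space)
    have "y = forget m (coords (Suc m) ?q x)"
    proof
      fix k
      show "y k = forget m (coords (Suc m) ?q x) k"
      proof (cases "k < m")
        case True
        have "(\<lambda>i. \<Sum>j<m. y j * u j i) = (\<lambda>i. \<Sum>j<m. dotn (Suc m) x (u j) * u j i)"
          unfolding x(2) using decomp[OF x(1)] by auto
        then have "y k = dotn (Suc m) x (u k)" using uu[OF True] by metis
        then show ?thesis using True by (simp add: forget_def coords_def)
      next
        case False
        then show ?thesis using y by (simp add: forget_def coords_def)
      qed
    qed
    then show "y \<in> forget m ` coords (Suc m) ?q ` K" using x(1) by blast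
  next
    fix y assume "y \<in> forget m ` coords (Suc m) ?q ` K"
    then obtain x where x: "x \<in> K" "y = forget m (coords (Suc m) ?q x)" by blast
    have "(\<lambda>i. \<Sum>j<m. y j * u j i) = proj_perp (Suc m) \<xi> x"
    proof
      fix i
      have "(\<Sum>j<m. y j * u j i) = (\<Sum>j<m. dotn (Suc m) x (u j) * u j i)"
        by (intro sum.cong) (auto simp: x(2) forget_def coords_def)
      then show "(\<Sum>j<m. y j * u j i) = proj_perp (Suc m) \<xi> x i"
        using decomp[OF x(1), of i] by (simp add: proj_perp_def)
    qed
    moreover have "\<forall>i\<ge>m. y i = 0" by (auto simp: x(2) forget_def coords_def)
    ultimately show "y \<in> perp_coords (Suc m) u (proj_perp (Suc m) \<xi> ` K)"
      using x(1) by (auto simp: perp_coords_def topspace_Euclidean_space)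
  qed
qed

section \<open>The crude upper bound for the surface area\<close>

text \<open>If every point of \<open>K\<close> were within \<open>v / 4\<close> of \<open>p\<close>
  in each coordinate, \<open>K\<close> would fit into a cube of side \<open>v / 2\<close>, too small
  for the volume \<open>v ^ Suc m\<close>. The Euclidean distance of a violating point from
  \<open>p\<close> is at least its coordinate distance.\<close>

lemma exists_long_chord:
  assumes K: "cbody (Suc m) K"
  defines "v \<equiv> root (Suc m) (voln (Suc m) K)"
  obtains p \<xi> \<delta> where "\<xi> \<in> topspace (nsphere m)" "p \<in> K" "(\<lambda>i. p i + \<delta> * \<xi> i) \<in> K" "v / 4 \<le> \<delta>"
proof -
  let ?n = "Suc m"
  have cK: "compact K" "\<forall>x\<in>K. \<forall>i\<ge>?n. x i = 0" using K by (auto simp: cbody_def)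
  have vpos: "v > 0" "v ^ ?n = voln ?n K"
    using cbody_voln_pos[OF K] real_root_pow_pos2[of ?n "voln ?n K"] by (auto simp: v_def)
  obtain p where p: "p \<in> K" by (rule cbodyE[OF K])
  have "\<exists>x\<in>K. \<exists>i<?n. v / 4 < \<bar>x i - p i\<bar>"
  proof (rule ccontr)
    assume "\<not> ?thesis"
    then have small: "\<bar>x i - p i\<bar> \<le> v / 4" if "x \<in> K" "i < ?n" for x i using that by force
    let ?Q = "{x :: nat \<Rightarrow> real. \<forall>i<?n. \<bar>x i\<bar> \<le> v / 4}"
    have Q: "?Q \<in> sets borel" by measurable
    have cT: "compact ((\<lambda>x i. 1 * x i + - p i) ` K)" by (rule compact_affine_image[OF cK(1)])
    have "voln ?n ((\<lambda>x i. 1 * x i + - p i) ` K) = 1 ^ ?n * voln ?n K"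
      using cK(2) p by (intro voln_affine cK(1)) auto
    then have e: "emeasure (emeas ?n) ((\<lambda>x i. 1 * x i + - p i) ` K) = ennreal (voln ?n K)"
      using emeasure_emeas_compact[OF cT, of ?n] by simp
    have "emeasure (emeas ?n) ((\<lambda>x i. 1 * x i + - p i) ` K) \<le> emeasure (emeas ?n) ?Q"
      using Q small by (intro emeasure_mono) auto
    then have "ennreal (voln ?n K) \<le> ennreal ((2 * (v / 4)) ^ ?n)"
      unfolding e using vpos(1) by (subst (asm) emeasure_emeas_box) auto
    then have "v ^ ?n \<le> (2 * (v / 4)) ^ ?n"
      using vpos by (subst (asm) ennreal_le_iff) auto
    then have "v \<le> 2 * (v / 4)"
      by (rule power_le_imp_le_base) (use vpos in simp)
    then show False using vpos by simp
  qed
  then obtain x i where x: "x \<in> K" "i < ?n" "v / 4 < \<bar>x i - p i\<bar>" by blast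
  let ?w = "\<lambda>i. x i - p i"
  define \<delta> where "\<delta> = L2_set ?w {..<?n}"
  have "\<bar>x i - p i\<bar> \<le> \<delta>"
    unfolding \<delta>_def using x(2) member_le_L2_set[of "{..<?n}" i "\<lambda>i. \<bar>?w i\<bar>"]
    by (simp add: L2_set_def)
  then have \<delta>: "v / 4 \<le> \<delta>" "\<delta> > 0" using x(3) vpos(1) by linarith+
  have d2: "(\<Sum>i<?n. (?w i)\<^sup>2) = \<delta>\<^sup>2"
    unfolding \<delta>_def L2_set_def by (simp add: sum_nonneg del: sum.lessThan_Suc)
  show ?thesis
  proof (rule that[of "\<lambda>i. ?w i / \<delta>" p \<delta>])
    have "(\<Sum>i\<le>m. (?w i / \<delta>)\<^sup>2) = (\<Sum>i<?n. (?w i)\<^sup>2) / \<delta>\<^sup>2"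
      unfolding lessThan_Suc_atMost by (simp add: power_divide sum_divide_distrib)
    also have "\<dots> = 1" using \<delta>(2) d2 by simp
    finally have "(\<Sum>i\<le>m. (?w i / \<delta>)\<^sup>2) = 1" .
    moreover have "x i = p i" if "Suc m \<le> i" for i using cK(2)[rule_format, OF x(1) that] cK(2)[rule_format, OF p that] by simp
    ultimately show "(\<lambda>i. ?w i / \<delta>) \<in> topspace (nsphere m)"
      by (auto simp: nsphere_def topspace_Euclidean_space)
    show "p \<in> K" by fact
    show "(\<lambda>i. p i + \<delta> * (?w i / \<delta>)) \<in> K" using \<delta>(2) x(1) by simp
    show "v / 4 \<le> \<delta>" by fact
  qed
qed

text \<open>The conclusion does not mention a direction, so the projection bound is used only for
  the direction of a long chord. There the volume of the projection is controlled from above by that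
  of \<open>K\<close>.\<close>

lemma surface_area_le_root:
  assumes min: "minimal_surface_area_position (Suc m) K" and K: "cbody (Suc m) K" and m: "m \<ge> 1"
  shows "surface_area (Suc m) K / (4 * Suc m) \<le> 2 ^ (m + 3) * root (Suc m) (voln (Suc m) K) ^ m"
proof -
  let ?n = "Suc m"
  let ?v = "root ?n (voln ?n K)"
  let ?S = "surface_area ?n K / (4 * Suc m)"
  have cK: "\<forall>x\<in>K. \<forall>i\<ge>?n. x i = 0" using K by (auto simp: cbody_def)
  have vpos: "?v > 0" "?v ^ ?n = voln ?n K"
    using cbody_voln_pos[OF K] real_root_pow_pos2[of ?n "voln ?n K"] by auto
  obtain p \<xi> \<delta> where \<xi>: "\<xi> \<in> topspace (nsphere m)" and p: "p \<in> K" "(\<lambda>i. p i + \<delta> * \<xi> i) \<in> K" "?v / 4 \<le> \<delta>"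
    by (rule exists_long_chord[OF K])
  obtain u where u: "perp_basis ?n \<xi> u" using perp_basis_exists[of ?n \<xi>] \<xi> by auto
  define q where "q = (\<lambda>j. if j < m then u j else \<xi>)"
  have q: "orthon ?n q" unfolding q_def by (rule orthon_perp_basis[OF u \<xi>])
  let ?L = "coords ?n q ` K"
  have L: "compact ?L" "convexn ?L" "\<forall>x\<in>?L. \<forall>i\<ge>?n. x i = 0"
    using cbody_coords[OF q K] by (auto simp: cbody_def)
  \<comment> \<open>\<xi> is the last basis vector, so in coordinates the chord is parallel to the
    last axis, as \<open>chord_voln_le\<close> requires.\<close>
  have "coords ?n q \<xi> = (\<lambda>i. if i = m then 1 else 0)"
    using q by (auto simp: coords_def orthon_def q_def fun_eq_iff less_Suc_eq)
  then have "coords ?n q (\<lambda>i. p i + \<delta> * \<xi> i) = (coords ?n q p)(m := coords ?n q p m + \<delta>)"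
    unfolding coords_add by auto
  then have "(coords ?n q p)(m := coords ?n q p m + \<delta>) \<in> ?L"
    using imageI[OF p(2), of "coords ?n q"] by (simp only:)
  then have "\<delta> / 2 * ((1/2) ^ m * voln m (forget m ` ?L)) \<le> voln ?n ?L"
    using p(3) vpos(1) by (intro chord_voln_le[OF L imageI[OF p(1)]]) linarith+
  also have "voln ?n ?L = ?v ^ ?n"
    using voln_coords[OF q _ _ cK] K vpos(2) by (simp add: cbody_def)
  finally have 1: "\<delta> / 2 * ((1/2) ^ m * voln m (forget m ` ?L)) \<le> ?v ^ ?n" .
  \<comment> \<open>The chord length \<delta> is at least \<open>?v / 4\<close>, so
    \<open>\<delta> / 2\<close> is at least \<open>?v / 8\<close>; together with the half-size
    factor this accounts for \<open>2 ^ (m + 3)\<close>.\<close>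
  have "?v / 8 * ((1/2) ^ m * ?S) \<le> ?v / 8 * ((1/2) ^ m * voln m (forget m ` ?L))"
    using vpos(1) by (intro mult_left_mono surface_area_le_shadow min K m q) auto
  also have "\<dots> \<le> \<delta> / 2 * ((1/2) ^ m * voln m (forget m ` ?L))"
    using p(3) voln_nonneg by (intro mult_right_mono) auto
  also note 1
  also have "?v / 8 * ((1/2) ^ m * ?S) = ?v * (?S / 2 ^ (m + 3))"
    by (simp add: power_add power_divide mult_ac)
  finally have "?v * (?S / 2 ^ (m + 3)) \<le> ?v * ?v ^ m" by simp
  then have "?S / 2 ^ (m + 3) \<le> ?v ^ m"
    by (rule mult_left_le_imp_le[OF _ vpos(1)])
  then have "?S \<le> ?v ^ m * 2 ^ (m + 3)"
    by (simp only: pos_divide_le_eq zero_less_power zero_less_numeral)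
  then show ?thesis by (simp only: mult.commute)
qed

theorem theorem1p2:
  shows "\<exists>c::real. c > 0 \<and>
    (\<forall>n::nat. \<forall>K::(nat \<Rightarrow> real) set.
       n \<ge> 2 \<longrightarrow> convex_body n K \<longrightarrow> minimal_surface_area_position n K \<longrightarrow>
       voln n K powr (1 / real n) *
         (INF \<xi>\<in>topspace (nsphere (n - 1)). surface_area_perp n \<xi> (proj_perp n \<xi> ` K))
       \<ge> c / sqrt (real n) * surface_area n K)"
proof (intro exI[of _ "1/64"] conjI allI impI)
  fix n :: nat and K :: "(nat \<Rightarrow> real) set"
  assume n: "n \<ge> 2" and body: "convex_body n K" and min': "minimal_surface_area_position n K"
  define m where "m = n - 1"
  have nm: "n = Suc m" and m: "m \<ge> 1" using n by (auto simp: m_def)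
  have K: "cbody (Suc m) K" using convex_body_imp_cbody[OF body] nm by simp
  have min: "minimal_surface_area_position (Suc m) K" using min' nm by simp
  have cK: "\<forall>x\<in>K. \<forall>i\<ge>Suc m. x i = 0" using K by (auto simp: cbody_def)
  define v where "v = root (Suc m) (voln (Suc m) K)"
  define s where "s = surface_area (Suc m) K / (4 * Suc m)"
  have v: "v > 0" using cbody_voln_pos[OF K] by (simp add: v_def)
  have "0 \<le> 2 * sqrt (Suc m) * root (Suc m) (voln (Suc m) K) ^ (Suc m - 1)" using voln_nonneg by simp
  also have "\<dots> \<le> surface_area (Suc m) K" by (rule surface_area_limit(2)[OF K]) simp
  finally have s0: "s \<ge> 0" by (simp add: s_def)
  define w where "w = root m s"
  have w: "w \<ge> 0" "w ^ m = s" using s0 m by (auto simp: w_def)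
  have w16: "w \<le> 16 * v"
  proof -
    have "w ^ m \<le> 2 ^ (m + 3) * v ^ m"
      using surface_area_le_root[OF min K m] w(2) by (simp add: s_def v_def)
    \<comment> \<open>\<open>m + 3 \<le> 4 * m\<close> because \<open>m \<ge> 1\<close>; the
      \<open>m\<close>-th root of the exponential factor is thus at most 16.\<close>
    also have "\<dots> \<le> 2 ^ (4 * m) * v ^ m"
      using m v by (intro mult_right_mono power_increasing) auto
    also have "\<dots> = (16 * v) ^ m" by (simp add: power_mult power_mult_distrib)
    finally show ?thesis
      using m v w(1) by (metis One_nat_def Suc_le_D power_le_imp_le_base mult_nonneg_nonneg less_imp_le zero_le_numeral)
  qed
  have key: "1/64 / sqrt n * surface_area n K / v \<le> surface_area_perp n \<xi> (proj_perp n \<xi> ` K)"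
    if \<xi>: "\<xi> \<in> topspace (nsphere (n - 1))" for \<xi>
  proof -
    have \<xi>': "\<xi> \<in> topspace (nsphere m)" using \<xi> nm by simp
    \<comment> \<open>The projected surface area is defined through this particular basis, so the
      argument runs with exactly this choice.\<close>
    define u where "u = (SOME u. perp_basis n \<xi> u)"
    have u: "perp_basis (Suc m) \<xi> u"
      unfolding u_def using perp_basis_exists[of n \<xi>] \<xi> n nm by (metis One_nat_def Suc_leD numeral_2_eq_2 someI_ex)
    define q where "q = (\<lambda>j. if j < m then u j else \<xi>)"
    have q: "orthon (Suc m) q" unfolding q_def by (rule orthon_perp_basis[OF u \<xi>'])
    let ?P = "forget m ` coords (Suc m) q ` K"
    have P: "surface_area_perp n \<xi> (proj_perp n \<xi> ` K) = surface_area m ?P"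
      unfolding surface_area_perp_def u_def[symmetric]
      using perp_coords_proj[OF u \<xi>' cK] by (simp add: q_def nm)
    have "w \<le> root m (voln m ?P)"
      unfolding w_def s_def using m surface_area_le_shadow[OF min K m q] by (intro real_root_le_mono) auto
    then have "2 * sqrt m * w ^ (m - 1) \<le> 2 * sqrt m * root m (voln m ?P) ^ (m - 1)"
      using w(1) by (intro mult_left_mono power_mono) auto
    also have "\<dots> \<le> surface_area m ?P"
      by (intro surface_area_limit(2) cbody_forget cbody_coords q K m)
    finally have lower: "2 * sqrt m * w ^ (m - 1) \<le> surface_area m ?P" .
    \<comment> \<open>Here the constant 64 is settled: \<open>S(K) = 4 n s\<close> turns the left
      side into \<open>sqrt n / 16 * s\<close>, and \<open>n \<le> 4 m\<close> gives
      \<open>sqrt n \<le> 2 * sqrt m\<close>.\<close>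
    have "surface_area n K / (64 * sqrt n) \<le> sqrt m / 8 * s"
    proof -
      have "sqrt n \<le> sqrt (4 * m)" using n nm by (intro real_sqrt_le_mono) simp
      then have le: "sqrt n \<le> 2 * sqrt m" by (simp add: real_sqrt_mult)
      have S: "surface_area n K = 4 * n * s" by (simp add: s_def nm field_simps)
      have cancel: "4 * (r * r) * s / (64 * r) = r / 16 * s" if "r > 0" for r :: real
        using that by (simp add: field_simps)
      have "surface_area n K / (64 * sqrt n) = 4 * (sqrt n * sqrt n) * s / (64 * sqrt n)"
        unfolding S by simp
      also have "\<dots> = sqrt n / 16 * s"
        by (rule cancel) (use n in simp)
      also have "\<dots> \<le> sqrt m / 8 * s" using le s0 by (intro mult_right_mono) auto
      finally show ?thesis .
    qed
    \<comment> \<open>The power \<open>m - 1\<close> matches the isoperimetric inequality, and the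
      remaining factor is at most \<open>16 * v\<close>; then \<open>16 / 8\<close> restores the
      isoperimetric constant 2. For \<open>m = 1\<close> the power is 1 and the bound used is the
      value 2 for a segment.\<close>
    also have "s = w ^ (m - 1) * w" using w(2) m by (cases m) (auto simp: mult.commute)
    also have "sqrt m / 8 * (w ^ (m - 1) * w) \<le> sqrt m / 8 * (w ^ (m - 1) * (16 * v))"
      using w16 w(1) by (intro mult_left_mono) auto
    also have "\<dots> = 2 * sqrt m * w ^ (m - 1) * v" by simp
    also have "\<dots> \<le> surface_area m ?P * v" using lower v by (intro mult_right_mono) auto
    finally have "surface_area n K / (64 * sqrt n) \<le> surface_area m ?P * v" .
    then have "surface_area n K / (64 * sqrt n) / v \<le> surface_area m ?P"
      by (simp only: pos_divide_le_eq[OF v])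
    then show ?thesis by (simp add: P)
  qed
  \<comment> \<open>A bound valid in every direction passes to the infimum only over a nonempty
    sphere.\<close>
  obtain \<xi>0 where "\<xi>0 \<in> topspace (nsphere m)" by (rule exists_long_chord[OF K])
  then have "topspace (nsphere (n - 1)) \<noteq> {}" using nm by auto
  then have "1/64 / sqrt n * surface_area n K / v
      \<le> (INF \<xi>\<in>topspace (nsphere (n - 1)). surface_area_perp n \<xi> (proj_perp n \<xi> ` K))"
    by (rule cINF_greatest) (rule key)
  then have "1/64 / sqrt n * surface_area n K
      \<le> v * (INF \<xi>\<in>topspace (nsphere (n - 1)). surface_area_perp n \<xi> (proj_perp n \<xi> ` K))"
    by (simp only: pos_divide_le_eq[OF v] mult.commute[of v])
  moreover have "voln n K powr (1 / real n) = v"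
    using cbody_voln_pos[OF K] by (simp add: v_def nm root_powr_inverse)
  ultimately show "1/64 / sqrt (real n) * surface_area n K \<le> voln n K powr (1 / real n) *
         (INF \<xi>\<in>topspace (nsphere (n - 1)). surface_area_perp n \<xi> (proj_perp n \<xi> ` K))"
    by simp
qed simp

end
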